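(* Assume the prior $P_{\mathtt{x}}$ is centered, has unit variance and bounded support. Then for all $0\le\lambda<\lambda_c$, the (sequences of) probability measures $\mathbb{P}_\lambda$ and $\mathbb{P}_0$, indexed by $N$, are mutually contiguous as $N\to\infty$.
   Context: Let $P_{\mathtt{x}}$ (the prior) be a probability distribution on $\mathbb{R}$ with bounded support. Spiked Wigner model with the diagonal discarded: for $\lambda\ge 0$ and $N\ge 1$, $\boldsymbol{Y}=\{Y_{ij}:1\le i<j\le N\}$ with $Y_{ij}=\sqrt{\lambda/N}\,x_i^*x_j^*+W_{ij}$, where $W_{ij}\sim\mathcal{N}(0,1)$ i.i.d., and $\boldsymbol{x}^*=(x_1^*,\dots,x_N^* )$ has i.i.d. coordinates from $P_{\mathtt{x}}$, independent of $\boldsymbol W$. $\mathbb{P}_\lambda$ denotes the law of $\boldsymbol{Y}$ (dependence on $N$ is suppressed). For $r\ge0$ let $\psi(r)=\mathbb{E}_{x^*,z}\log\int\exp\big(\sqrt r zx+rxx^*-\tfrac r2x^2\big)\mathrm{d}P_{\mathtt{x}}(x)$ with $z\sim\mathcal{N}(0,1)$ and $x^*\sim P_{\mathtt{x}}$ independent. Let $F(\lambda,q)=\psi(\lambda q)-\frac{\lambda q^2}{4}$ and $\phi_{\mathsf{RS}}(\lambda)=\sup_{q\ge0}F(\lambda,q)$. The reconstruction threshold is $\lambda_c=\sup\{\lambda>0:\phi_{\mathsf{RS}}(\lambda)=0\}$ (with $\sup\emptyset=0$). Mutual contiguity: for every sequence of events $A_N$, $\mathbb{P}_0(A_N)\to0$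 if and only if $\mathbb{P}_\lambda(A_N)\to0$. *)

theory Defs
  imports "HOL-Probability.Probability"
begin

definition measure_support :: "'a::topological_space measure \<Rightarrow> 'a set" where
  "measure_support M = {x. \<forall>U. open U \<and> x \<in> U \<longrightarrow> emeasure M U > 0}"

definition upper_pairs :: "nat \<Rightarrow> (nat \<times> nat) set" where
  "upper_pairs N = {(i, j). 1 \<le> i \<and> i < j \<and> j \<le> N}"

text \<open>
  The law of the observations, obtained by pushing forward the joint law of the spike and
  of the independent noise. Size \<open>N = 0\<close> is a harmless degenerate case (no observations);
  it is irrelevant for limits in \<open>N\<close>.
\<close>

definition spiked_wigner_law ::
    "real measure \<Rightarrow> real \<Rightarrow> nat \<Rightarrow> (nat \<times> nat \<Rightarrow> real) measure" where
  "spiked_wigner_law P lam N =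
     distr ((\<Pi>\<^sub>M i\<in>{1..N}. P) \<Otimes>\<^sub>M (\<Pi>\<^sub>M e\<in>upper_pairs N. std_normal_distribution))
       (\<Pi>\<^sub>M e\<in>upper_pairs N. (borel :: real measure))
       (\<lambda>(x, w). \<lambda>(i, j)\<in>upper_pairs N. sqrt (lam / real N) * x i * x j + w (i, j))"

definition psi :: "real measure \<Rightarrow> real \<Rightarrow> real" where
  "psi P r =
     (\<integral>(xs, z).
        ln (\<integral>x. exp (sqrt r * z * x + r * x * xs - r / 2 * x\<^sup>2) \<partial>P)
        \<partial>(P \<Otimes>\<^sub>M std_normal_distribution))"

definition RS_potential :: "real measure \<Rightarrow> real \<Rightarrow> real \<Rightarrow> real" where
  "RS_potential P lam q = psi P (lam * q) - lam * q\<^sup>2 / 4"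

text \<open>
  The supremum is taken in the extended reals, so no boundedness is presupposed.
\<close>

definition phi_RS :: "real measure \<Rightarrow> real \<Rightarrow> ereal" where
  "phi_RS P lam = (SUP q\<in>{0..}. ereal (RS_potential P lam q))"

text \<open>
  In \<^typ>\<open>ennreal\<close> the supremum of the empty set is \<open>0\<close>, as the convention for the
  threshold requires.
\<close>

definition lambda_c :: "real measure \<Rightarrow> ennreal" where
  "lambda_c P = (SUP lam\<in>{lam. lam > 0 \<and> phi_RS P lam = 0}. ennreal lam)"

text \<open>
  Meant for sequences with \<open>sets (Q N) = sets (R N)\<close> for all \<open>N\<close>.
\<close>

definition mutually_contiguous :: "(nat \<Rightarrow> 'a measure) \<Rightarrow> (nat \<Rightarrow> 'a measure) \<Rightarrow> bool" where
  "mutually_contiguous Q R \<longleftrightarrow>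
     (\<forall>A. (\<forall>N. A N \<in> sets (Q N)) \<longrightarrow>
        ((\<lambda>N. measure (Q N) (A N)) \<longlonglongrightarrow> 0) \<longleftrightarrow> ((\<lambda>N. measure (R N) (A N)) \<longlonglongrightarrow> 0))"

end

(*
  Let L be the likelihood ratio of P_lambda and P_0, and let x, x' be replicas drawn from the
  posterior, with overlap R. Contiguity holds once L is tight under P_lambda and 1/L is tight
  under P_0.

  Large overlaps. Since lambda < lambda_c, psi r <= r^2 / (4 lambda') for some lambda' > lambda.
  Kahane's convexity inequality, applied to a fractional moment of the partition function
  restricted to spikes with R near m, compares the matrix channel with independent scalar
  channels at signal strength lambda |m|. Small moments turn the bound into exp (N s F(lambda, |m|)),
  which is exponentially small; no concentration inequality is needed. Hence the posterior
  probability of |R| > eps is exponentially small on average.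

  Small overlaps. psi dominates the relative entropy of two Gaussians, so lambda' <= 1, and for
  lambda < 1 the second moment of L restricted to |R| <= eps is bounded. Together with the first
  step this gives tightness of L, and of N <R^2>, under P_lambda.

  Lower tail. ln L is convex in the noise, with squared gradient at most lambda N <R^2> / 2. So on a
  set of non-vanishing P_0-probability ln L is bounded below and has bounded gradient, and the
  supremum of its tangent planes there is a Lipschitz minorant. Rotating an independent copy of the
  noise into the original one shows that such a function has dimension-free fluctuations.
*)
theory Submission
  imports Defs "HOL-Real_Asymp.Real_Asymp"
begin

section \<open>Gaussian product measures\<close>

text \<open>The first moment of a restricted partition function is dominated by atypical noise,
  whereas a product of independent factors has \<open>s\<close>-th moment at most
  \<open>exp (s E ln Z + O(s^2))\<close> with an error additive in the coordinates; hence small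
  \<open>s\<close>. Kahane's inequality for the concave power \<open>s\<close> bounds the moment of
  the family with the larger kernel by that of the family with the smaller one. Here the kernels are
  \<open>l N R^2 / 2\<close>, up to a bounded diagonal term, and \<open>l |m| N R\<close>, and
  \<open>|m| R <= (R^2 + m^2) / 2\<close> orders them up to a constant. That constant costs
  \<open>l m^2 / 4\<close> per coordinate, linearising the interaction with the planted spike gains
  \<open>l m^2 / 2\<close>, and with \<open>psi (l |m|)\<close> this is exactly the potential. The
  prior may be asymmetric, so a negative \<open>m\<close> produces a scalar channel with reversed
  signal; Gibbs' inequality covers it. The obstacle in the lower tail is that overlaps are
  controlled under the spiked law. Under the unspiked law this leaves only a set of non-vanishing
  probability, outside of which the gradient of \<open>ln L\<close> is unknown; convexity carries
  the information from that set to the whole space.\<close>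

definition Gauss :: "'i set \<Rightarrow> ('i \<Rightarrow> real) measure" where
  "Gauss I = (\<Pi>\<^sub>M i\<in>I. std_normal_distribution)"

text \<open>The Cameron-Martin density of the Gaussian law translated by \<open>c\<close>,
  equivalently the exponential of a linear functional normalised to mean one. It serves both as
  likelihood ratio of a fixed spike and as Boltzmann weight of a replica.\<close>

definition wick :: "'i set \<Rightarrow> ('i \<Rightarrow> real) \<Rightarrow> ('i \<Rightarrow> real) \<Rightarrow> real" where
  "wick I c w = exp ((\<Sum>i\<in>I. c i * w i) - (\<Sum>i\<in>I. (c i)\<^sup>2) / 2)"

text \<open>Gives joint measurability of a curried function the form of a composition rule, so that
  it can be declared \<open>measurable\<close> inside a proof.\<close>

lemma measurable_split_compose:
  assumes F: "(\<lambda>p. F (fst p) (snd p)) \<in> borel_measurable (A \<Otimes>\<^sub>M B)"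
    and "f \<in> measurable M A" "g \<in> measurable M B"
  shows "(\<lambda>p. F (f p) (g p)) \<in> borel_measurable M"
  using measurable_compose[OF measurable_Pair[OF assms(2,3)] F] by simp

lemma sets_Gauss [measurable_cong]: "sets (Gauss I) = sets (\<Pi>\<^sub>M i\<in>I. (borel :: real measure))"
  unfolding Gauss_def by (intro sets_PiM_cong) auto

lemma space_Gauss: "space (Gauss I) = (\<Pi>\<^sub>E i\<in>I. UNIV)"
  unfolding Gauss_def by (simp add: space_PiM)

lemma prob_space_std_normal: "prob_space std_normal_distribution"
  by (rule prob_space_normal_density) simp

lemma prob_space_Gauss: "prob_space (Gauss I)"
  unfolding Gauss_def by (intro prob_space_PiM prob_space_std_normal)

lemma sigma_finite_Gauss: "sigma_finite_measure (Gauss I)"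
  using prob_space_Gauss by (rule prob_space_imp_sigma_finite)

lemma nn_integral_Gauss_empty: "(\<integral>\<^sup>+w. f w \<partial>Gauss {}) = f (\<lambda>_. undefined)"
  unfolding Gauss_def
  by (simp add: PiM_empty nn_integral_count_space_finite)

lemma nn_integral_Gauss_insert:
  assumes "finite I" "i \<notin> I" "f \<in> borel_measurable (Gauss (insert i I))"
  shows "(\<integral>\<^sup>+w. f w \<partial>Gauss (insert i I)) =
    (\<integral>\<^sup>+x. (\<integral>\<^sup>+y. f (x(i := y)) \<partial>std_normal_distribution) \<partial>Gauss I)"
proof -
  interpret product_sigma_finite "\<lambda>_::'a. std_normal_distribution"
    by (rule product_sigma_finite.intro) (intro prob_space_imp_sigma_finite prob_space_std_normal)
  show ?thesis
    using product_nn_integral_insert[OF assms(1,2)] assms(3) unfolding Gauss_def by blast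
qed

lemma wick_pos [simp]: "0 < wick I c w" "0 \<le> wick I c w"
  unfolding wick_def by auto

lemma wick_insert:
  assumes "finite I" "i \<notin> I"
  shows "wick (insert i I) c w = wick I c w * exp (c i * w i - (c i)\<^sup>2 / 2)"
  unfolding wick_def using assms by (simp add: exp_add[symmetric] field_simps)

lemma wick_cong:
  assumes "\<And>i. i \<in> I \<Longrightarrow> c i = d i" "\<And>i. i \<in> I \<Longrightarrow> v i = w i"
  shows "wick I c v = wick I d w"
  unfolding wick_def using assms by (simp cong: sum.cong)

lemma wick_add: "wick I c (\<lambda>i. d i + w i) = wick I c w * exp (\<Sum>i\<in>I. c i * d i)"
  unfolding wick_def by (simp add: exp_add[symmetric] algebra_simps sum.distrib)

lemma measurable_Gauss_component:
  assumes g: "g \<in> measurable N (Gauss I)" and i: "i \<in> I"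
  shows "(\<lambda>x. g x i) \<in> borel_measurable N"
proof -
  have "g \<in> measurable N (\<Pi>\<^sub>M i\<in>I. (borel :: real measure))"
    using g measurable_cong_sets[OF refl sets_Gauss[of I], of N] by simp
  then show ?thesis using i by measurable
qed

lemma measurable_wick [measurable]:
  "wick I c \<in> borel_measurable (Gauss I)"
  unfolding wick_def by measurable

section \<open>Translation and rotation of Gaussian product measures\<close>

lemma nn_integral_std_normal_shift:
  assumes [measurable]: "F \<in> borel_measurable borel"
  shows "(\<integral>\<^sup>+w. F (a + w) \<partial>std_normal_distribution) =
    (\<integral>\<^sup>+w. F w * ennreal (exp (a * w - a\<^sup>2 / 2)) \<partial>std_normal_distribution)"
proof -
  have "(\<integral>\<^sup>+w. F w * ennreal (exp (a * w - a\<^sup>2 / 2)) \<partial>std_normal_distribution)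
     = (\<integral>\<^sup>+w. ennreal (std_normal_density w) * (F w * ennreal (exp (a * w - a\<^sup>2 / 2))) \<partial>lborel)"
    by (subst nn_integral_density) auto
  also have "\<dots> = (\<integral>\<^sup>+w. ennreal (std_normal_density (w - a)) * F w \<partial>lborel)"
  proof (rule nn_integral_cong)
    fix w :: real
    \<comment> \<open>Completing the square: the exponential tilt of the density is its translate by
      \<open>a\<close>.\<close>
    have "std_normal_density w * exp (a * w - a\<^sup>2 / 2) = std_normal_density (w - a)"
      unfolding std_normal_density_def
      by (simp add: exp_add[symmetric]) (simp add: power2_eq_square algebra_simps diff_divide_distrib add_divide_distrib)
    then have e: "ennreal (std_normal_density (w - a)) = ennreal (std_normal_density w) * ennreal (exp (a * w - a\<^sup>2 / 2))"
      by (simp add: ennreal_mult[symmetric])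
    show "ennreal (std_normal_density w) * (F w * ennreal (exp (a * w - a\<^sup>2 / 2))) = ennreal (std_normal_density (w - a)) * F w"
      unfolding e by (simp add: mult_ac)
  qed
  also have "\<dots> = (\<integral>\<^sup>+w. ennreal (std_normal_density w) * F (a + w) \<partial>lborel)"
    by (subst nn_integral_real_affine[where c = 1 and t = a]) auto
  also have "\<dots> = (\<integral>\<^sup>+w. F (a + w) \<partial>std_normal_distribution)"
    by (subst nn_integral_density) auto
  finally show ?thesis by simp
qed

lemma measurable_fun_upd_borel [measurable]:
  assumes "x \<in> measurable M (\<Pi>\<^sub>M i\<in>I. (borel :: real measure))" "y \<in> borel_measurable M"
  shows "(\<lambda>p. (x p)(i := y p)) \<in> measurable M (\<Pi>\<^sub>M i\<in>insert i I. (borel :: real measure))"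
  using measurable_fun_upd[of "insert i I" I i x M "\<lambda>_. borel" y] assms by simp

text \<open>Coordinates are peeled off one at a time: the one-dimensional translation formula acts
  on the new coordinate, the induction hypothesis on the resulting inner integral, and
  \<open>wick\<close> factorises accordingly. The translate is restricted to \<open>I\<close>
  because points of a product space are extensional functions.\<close>

lemma nn_integral_Gauss_shift:
  assumes "finite I" "F \<in> borel_measurable (Gauss I)"
  shows "(\<integral>\<^sup>+w. F (\<lambda>i\<in>I. a i + w i) \<partial>Gauss I) = (\<integral>\<^sup>+w. F w * ennreal (wick I a w) \<partial>Gauss I)"
  using assms
proof (induction I arbitrary: F rule: finite_induct)
  case empty
  show ?case
    unfolding nn_integral_Gauss_empty by (simp add: wick_def restrict_def)
next
  case (insert i I)
  note [measurable] = insert.prems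
  have F': "(\<lambda>p. F ((fst p)(i := snd p))) \<in> borel_measurable (Gauss I \<Otimes>\<^sub>M borel)"
    by measurable
  interpret sf: sigma_finite_measure std_normal_distribution
    by (intro prob_space_imp_sigma_finite prob_space_std_normal)
  have "(\<integral>\<^sup>+w. F (\<lambda>j\<in>insert i I. a j + w j) \<partial>Gauss (insert i I))
      = (\<integral>\<^sup>+x. (\<integral>\<^sup>+y. F (\<lambda>j\<in>insert i I. a j + (x(i := y)) j) \<partial>std_normal_distribution) \<partial>Gauss I)"
    by (rule nn_integral_Gauss_insert) (use insert.hyps in \<open>auto\<close>)
  also have "\<dots> = (\<integral>\<^sup>+x. (\<integral>\<^sup>+y. F ((\<lambda>j\<in>I. a j + x j)(i := a i + y)) \<partial>std_normal_distribution) \<partial>Gauss I)"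
    using insert.hyps
    by (intro nn_integral_cong arg_cong[where f = F]) (auto simp: fun_eq_iff)
  also have "\<dots> = (\<integral>\<^sup>+x. (\<integral>\<^sup>+y. F ((\<lambda>j\<in>I. a j + x j)(i := y)) * ennreal (exp (a i * y - (a i)\<^sup>2 / 2)) \<partial>std_normal_distribution) \<partial>Gauss I)"
    by (intro nn_integral_cong nn_integral_std_normal_shift) measurable
  also have "\<dots> = (\<integral>\<^sup>+x. (\<integral>\<^sup>+y. F (x(i := y)) * ennreal (exp (a i * y - (a i)\<^sup>2 / 2)) \<partial>std_normal_distribution) * ennreal (wick I a x) \<partial>Gauss I)"
    by (rule insert.IH[where F = "\<lambda>x. (\<integral>\<^sup>+y. F (x(i := y)) * ennreal (exp (a i * y - (a i)\<^sup>2 / 2)) \<partial>std_normal_distribution)"]) measurable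
  also have "\<dots> = (\<integral>\<^sup>+x. (\<integral>\<^sup>+y. F (x(i := y)) * ennreal (wick (insert i I) a (x(i := y))) \<partial>std_normal_distribution) \<partial>Gauss I)"
  proof (intro nn_integral_cong)
    fix x assume "x \<in> space (Gauss I)"
    then have [measurable]: "x \<in> space (\<Pi>\<^sub>M i\<in>I. (borel :: real measure))"
      by (simp add: space_Gauss space_PiM)
    have "wick I a (x(i := y)) = wick I a x" for y
      using insert.hyps by (intro wick_cong) auto
    moreover have "(\<lambda>y. F (x(i := y)) * ennreal (exp (a i * y - (a i)\<^sup>2 / 2))) \<in> borel_measurable borel"
      by measurable
    ultimately show "(\<integral>\<^sup>+y. F (x(i := y)) * ennreal (exp (a i * y - (a i)\<^sup>2 / 2)) \<partial>std_normal_distribution) * ennreal (wick I a x)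
      = (\<integral>\<^sup>+y. F (x(i := y)) * ennreal (wick (insert i I) a (x(i := y))) \<partial>std_normal_distribution)"
      using insert.hyps by (subst nn_integral_multc[symmetric]) (simp_all add: wick_insert ennreal_mult mult_ac)
  qed
  also have "\<dots> = (\<integral>\<^sup>+w. F w * ennreal (wick (insert i I) a w) \<partial>Gauss (insert i I))"
    by (rule nn_integral_Gauss_insert[symmetric]) (use insert.hyps in \<open>auto\<close>)
  finally show ?case .
qed

text \<open>A rotation with \<open>c \<noteq> 0\<close> is a product of two one-dimensional
  substitutions, \<open>u = c x + s y\<close> at fixed \<open>y\<close> and then
  \<open>v = (y - s u) / c\<close> at fixed \<open>u\<close>. Their Jacobians \<open>1 / |c|\<close>
  and \<open>|c|\<close> cancel, and the product density depends only on the radius. Only Fubini and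
  one-variable Lebesgue integrals are involved.\<close>

lemma nn_integral_std_normal_rotate:
  fixes c s :: real
  assumes [measurable]: "(\<lambda>p. F (fst p) (snd p)) \<in> borel_measurable (borel \<Otimes>\<^sub>M borel)"
    and cs: "c\<^sup>2 + s\<^sup>2 = 1" "c \<noteq> 0"
  shows "(\<integral>\<^sup>+x. (\<integral>\<^sup>+y. F (c * x + s * y) (c * y - s * x) \<partial>std_normal_distribution) \<partial>std_normal_distribution) =
    (\<integral>\<^sup>+x. (\<integral>\<^sup>+y. F x y \<partial>std_normal_distribution) \<partial>std_normal_distribution)"
proof -
  let ?\<phi> = "\<lambda>x. ennreal (std_normal_density x)"
  note [measurable] = measurable_split_compose[OF assms(1)]
  have dens: "(\<integral>\<^sup>+x. (\<integral>\<^sup>+y. G x y \<partial>std_normal_distribution) \<partial>std_normal_distribution)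
     = (\<integral>\<^sup>+x. (\<integral>\<^sup>+y. ?\<phi> x * ?\<phi> y * G x y \<partial>lborel) \<partial>lborel)"
    if [measurable]: "(\<lambda>p. G (fst p) (snd p)) \<in> borel_measurable (borel \<Otimes>\<^sub>M borel)" for G
  proof -
    note [measurable] = measurable_split_compose[OF that]
    show ?thesis
      by (subst nn_integral_density, measurable, subst nn_integral_density, measurable)
         (simp add: nn_integral_cmult[symmetric] mult_ac)
  qed
  have "(\<integral>\<^sup>+x. (\<integral>\<^sup>+y. F (c * x + s * y) (c * y - s * x) \<partial>std_normal_distribution) \<partial>std_normal_distribution)
     = (\<integral>\<^sup>+x. (\<integral>\<^sup>+y. ?\<phi> x * ?\<phi> y * F (c * x + s * y) (c * y - s * x) \<partial>lborel) \<partial>lborel)"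
    by (rule dens) measurable
  also have "\<dots> = (\<integral>\<^sup>+y. (\<integral>\<^sup>+x. ?\<phi> x * ?\<phi> y * F (c * x + s * y) (c * y - s * x) \<partial>lborel) \<partial>lborel)"
    by (rule lborel_pair.Fubini') measurable
  also have "\<dots> = (\<integral>\<^sup>+y. (\<integral>\<^sup>+u. ennreal \<bar>1 / c\<bar> * (?\<phi> ((u - s * y) / c) * ?\<phi> y * F u ((y - s * u) / c)) \<partial>lborel) \<partial>lborel)"
  proof (rule nn_integral_cong)
    fix y :: real
    have e1: "c * (- (s * y / c) + 1 / c * u) + s * y = u" for u
      using cs by (simp add: field_simps)
    have e2: "c * y - s * (- (s * y / c) + 1 / c * u) = (y - s * u) / c" for u
    proof -
      have "c * y - s * (- (s * y / c) + 1 / c * u) = ((c\<^sup>2 + s\<^sup>2) * y - s * u) / c"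
        using cs(2) by (simp add: field_simps power2_eq_square)
      then show ?thesis using cs by simp
    qed
    have e3: "- (s * y / c) + 1 / c * u = (u - s * y) / c" for u
      by (simp add: diff_divide_distrib)
    have "(\<integral>\<^sup>+x. ?\<phi> x * ?\<phi> y * F (c * x + s * y) (c * y - s * x) \<partial>lborel)
        = ennreal \<bar>1 / c\<bar> * (\<integral>\<^sup>+u. ?\<phi> (- (s * y / c) + 1 / c * u) * ?\<phi> y * F (c * (- (s * y / c) + 1 / c * u) + s * y) (c * y - s * (- (s * y / c) + 1 / c * u)) \<partial>lborel)"
      by (rule nn_integral_real_affine) (use cs in auto)
    also have "\<dots> = ennreal \<bar>1 / c\<bar> * (\<integral>\<^sup>+u. ?\<phi> ((u - s * y) / c) * ?\<phi> y * F u ((y - s * u) / c) \<partial>lborel)"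
      unfolding e1 e2 unfolding e3 ..
    also have "\<dots> = (\<integral>\<^sup>+u. ennreal \<bar>1 / c\<bar> * (?\<phi> ((u - s * y) / c) * ?\<phi> y * F u ((y - s * u) / c)) \<partial>lborel)"
      by (subst nn_integral_cmult) auto
    finally show "(\<integral>\<^sup>+x. ?\<phi> x * ?\<phi> y * F (c * x + s * y) (c * y - s * x) \<partial>lborel) = \<dots>" .
  qed
  also have "\<dots> = (\<integral>\<^sup>+u. (\<integral>\<^sup>+y. ennreal \<bar>1 / c\<bar> * (?\<phi> ((u - s * y) / c) * ?\<phi> y * F u ((y - s * u) / c)) \<partial>lborel) \<partial>lborel)"
    by (rule lborel_pair.Fubini') measurable
  also have "\<dots> = (\<integral>\<^sup>+u. (\<integral>\<^sup>+v. ?\<phi> u * ?\<phi> v * F u v \<partial>lborel) \<partial>lborel)"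
  proof (rule nn_integral_cong)
    fix u :: real
    have e1: "(u - s * (s * u + c * v)) / c = c * u - s * v" for v
    proof -
      have "u - s * (s * u + c * v) = (c\<^sup>2 + s\<^sup>2) * u - s * (s * u + c * v)" using cs by simp
      then show ?thesis using cs(2) by (simp add: field_simps power2_eq_square)
    qed
    have e2: "(s * u + c * v - s * u) / c = v" for v using cs by simp
    have e3: "ennreal \<bar>c\<bar> * (ennreal \<bar>1 / c\<bar> * X) = X" for X
    proof -
      have "ennreal \<bar>c\<bar> * ennreal \<bar>1 / c\<bar> = 1"
        using cs by (simp add: ennreal_mult[symmetric] abs_mult[symmetric])
      then show ?thesis by (simp add: mult.assoc[symmetric])
    qed
    have e4: "?\<phi> (c * u - s * v) * ?\<phi> (s * u + c * v) = ?\<phi> u * ?\<phi> v" for v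
    proof -
      have "(c * u - s * v)\<^sup>2 + (s * u + c * v)\<^sup>2 = (c\<^sup>2 + s\<^sup>2) * u\<^sup>2 + (c\<^sup>2 + s\<^sup>2) * v\<^sup>2"
        by (simp add: power2_eq_square algebra_simps)
      then have q: "(c * u - s * v)\<^sup>2 + (s * u + c * v)\<^sup>2 = u\<^sup>2 + v\<^sup>2" using cs by simp
      have "std_normal_density p * std_normal_density q = 1 / (2 * pi) * exp (- (p\<^sup>2 + q\<^sup>2) / 2)" for p q
        unfolding std_normal_density_def by (simp add: exp_add[symmetric] field_simps)
      then have "std_normal_density (c * u - s * v) * std_normal_density (s * u + c * v) = std_normal_density u * std_normal_density v"
        by (simp only: q)
      then show ?thesis by (simp add: ennreal_mult[symmetric])
    qed
    have "(\<integral>\<^sup>+y. ennreal \<bar>1 / c\<bar> * (?\<phi> ((u - s * y) / c) * ?\<phi> y * F u ((y - s * u) / c)) \<partial>lborel)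
       = ennreal \<bar>c\<bar> * (\<integral>\<^sup>+v. ennreal \<bar>1 / c\<bar> * (?\<phi> ((u - s * (s * u + c * v)) / c) * ?\<phi> (s * u + c * v) * F u ((s * u + c * v - s * u) / c)) \<partial>lborel)"
      by (rule nn_integral_real_affine) (use cs in auto)
    also have "\<dots> = (\<integral>\<^sup>+v. ?\<phi> u * ?\<phi> v * F u v \<partial>lborel)"
      unfolding e1 e2 e4 by (subst nn_integral_cmult[symmetric]) (measurable, simp only: e3)
    finally show "(\<integral>\<^sup>+y. ennreal \<bar>1 / c\<bar> * (?\<phi> ((u - s * y) / c) * ?\<phi> y * F u ((y - s * u) / c)) \<partial>lborel) = \<dots>" .
  qed
  also have "\<dots> = (\<integral>\<^sup>+x. (\<integral>\<^sup>+y. F x y \<partial>std_normal_distribution) \<partial>std_normal_distribution)"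
    by (rule dens[symmetric]) measurable
  finally show ?thesis .
qed

text \<open>The two copies are rotated one coordinate pair at a time; \<open>split\<close> exposes
  the same coordinate of both copies as the two innermost integrals.\<close>

lemma nn_integral_Gauss_rotate:
  fixes c s :: real
  assumes "finite I"
    and "(\<lambda>p. F (fst p) (snd p)) \<in> borel_measurable (Gauss I \<Otimes>\<^sub>M Gauss I)"
    and cs: "c\<^sup>2 + s\<^sup>2 = 1" "c \<noteq> 0"
  shows "(\<integral>\<^sup>+x. (\<integral>\<^sup>+y. F (\<lambda>i\<in>I. c * x i + s * y i) (\<lambda>i\<in>I. c * y i - s * x i) \<partial>Gauss I) \<partial>Gauss I) =
    (\<integral>\<^sup>+x. (\<integral>\<^sup>+y. F x y \<partial>Gauss I) \<partial>Gauss I)"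
  using assms(1,2)
proof (induction I arbitrary: F rule: finite_induct)
  case empty
  show ?case
    unfolding nn_integral_Gauss_empty by (simp add: restrict_def)
next
  case (insert i I)
  let ?g = std_normal_distribution
  note [measurable] = measurable_split_compose[OF insert.prems]
  interpret G: sigma_finite_measure "Gauss I" by (rule sigma_finite_Gauss)
  interpret g: sigma_finite_measure ?g
    by (intro prob_space_imp_sigma_finite prob_space_std_normal)
  interpret Gi: sigma_finite_measure "Gauss (insert i I)" by (rule sigma_finite_Gauss)
  interpret gG: pair_sigma_finite ?g "Gauss I" ..
  have split: "(\<integral>\<^sup>+x. (\<integral>\<^sup>+y. H x y \<partial>Gauss (insert i I)) \<partial>Gauss (insert i I))
     = (\<integral>\<^sup>+x. (\<integral>\<^sup>+y. (\<integral>\<^sup>+x0. (\<integral>\<^sup>+y0. H (x(i := x0)) (y(i := y0)) \<partial>?g) \<partial>?g) \<partial>Gauss I) \<partial>Gauss I)"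
    if H: "(\<lambda>p. H (fst p) (snd p)) \<in> borel_measurable (Gauss (insert i I) \<Otimes>\<^sub>M Gauss (insert i I))" for H
  proof -
    note [measurable] = measurable_split_compose[OF H]
    have "(\<integral>\<^sup>+x. (\<integral>\<^sup>+y. H x y \<partial>Gauss (insert i I)) \<partial>Gauss (insert i I))
      = (\<integral>\<^sup>+x. (\<integral>\<^sup>+x0. (\<integral>\<^sup>+y. H (x(i := x0)) y \<partial>Gauss (insert i I)) \<partial>?g) \<partial>Gauss I)"
      by (rule nn_integral_Gauss_insert) (use insert.hyps in \<open>auto\<close>)
    also have "\<dots> = (\<integral>\<^sup>+x. (\<integral>\<^sup>+x0. (\<integral>\<^sup>+y. (\<integral>\<^sup>+y0. H (x(i := x0)) (y(i := y0)) \<partial>?g) \<partial>Gauss I) \<partial>?g) \<partial>Gauss I)"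
    proof (intro nn_integral_cong nn_integral_Gauss_insert insert.hyps)
      fix x x0 assume "x \<in> space (Gauss I)"
      then have "x(i := x0) \<in> space (Gauss (insert i I))"
        by (auto simp: space_Gauss PiE_def extensional_def)
      then show "H (x(i := x0)) \<in> borel_measurable (Gauss (insert i I))"
        by (intro measurable_split_compose[OF H, where f = "\<lambda>_. x(i := x0)" and g = "\<lambda>y. y"]) auto
    qed
    also have "\<dots> = (\<integral>\<^sup>+x. (\<integral>\<^sup>+y. (\<integral>\<^sup>+x0. (\<integral>\<^sup>+y0. H (x(i := x0)) (y(i := y0)) \<partial>?g) \<partial>?g) \<partial>Gauss I) \<partial>Gauss I)"
    proof (intro nn_integral_cong)
      fix x assume "x \<in> space (Gauss I)"
      then have [measurable]: "x \<in> space (\<Pi>\<^sub>M i\<in>I. (borel :: real measure))"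
        by (simp add: space_Gauss space_PiM)
      show "(\<integral>\<^sup>+x0. (\<integral>\<^sup>+y. (\<integral>\<^sup>+y0. H (x(i := x0)) (y(i := y0)) \<partial>?g) \<partial>Gauss I) \<partial>?g)
        = (\<integral>\<^sup>+y. (\<integral>\<^sup>+x0. (\<integral>\<^sup>+y0. H (x(i := x0)) (y(i := y0)) \<partial>?g) \<partial>?g) \<partial>Gauss I)"
        by (rule gG.Fubini'[symmetric]) measurable
    qed
    finally show ?thesis .
  qed
  have "(\<integral>\<^sup>+x. (\<integral>\<^sup>+y. F (\<lambda>j\<in>insert i I. c * x j + s * y j) (\<lambda>j\<in>insert i I. c * y j - s * x j) \<partial>Gauss (insert i I)) \<partial>Gauss (insert i I))
    = (\<integral>\<^sup>+x. (\<integral>\<^sup>+y. (\<integral>\<^sup>+x0. (\<integral>\<^sup>+y0. F (\<lambda>j\<in>insert i I. c * (x(i := x0)) j + s * (y(i := y0)) j)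
        (\<lambda>j\<in>insert i I. c * (y(i := y0)) j - s * (x(i := x0)) j) \<partial>?g) \<partial>?g) \<partial>Gauss I) \<partial>Gauss I)"
    by (rule split) measurable
  also have "\<dots> = (\<integral>\<^sup>+x. (\<integral>\<^sup>+y. (\<integral>\<^sup>+x0. (\<integral>\<^sup>+y0. F ((\<lambda>j\<in>I. c * x j + s * y j)(i := c * x0 + s * y0))
        ((\<lambda>j\<in>I. c * y j - s * x j)(i := c * y0 - s * x0)) \<partial>?g) \<partial>?g) \<partial>Gauss I) \<partial>Gauss I)"
    using insert.hyps
    by (intro nn_integral_cong arg_cong2[where f = F]) (auto simp: fun_eq_iff)
  also have "\<dots> = (\<integral>\<^sup>+x. (\<integral>\<^sup>+y. (\<integral>\<^sup>+x0. (\<integral>\<^sup>+y0. F ((\<lambda>j\<in>I. c * x j + s * y j)(i := x0))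
        ((\<lambda>j\<in>I. c * y j - s * x j)(i := y0)) \<partial>?g) \<partial>?g) \<partial>Gauss I) \<partial>Gauss I)"
    by (intro nn_integral_cong nn_integral_std_normal_rotate cs) measurable
  also have "\<dots> = (\<integral>\<^sup>+x. (\<integral>\<^sup>+y. (\<integral>\<^sup>+x0. (\<integral>\<^sup>+y0. F (x(i := x0)) (y(i := y0)) \<partial>?g) \<partial>?g) \<partial>Gauss I) \<partial>Gauss I)"
    by (rule insert.IH[where F = "\<lambda>x y. (\<integral>\<^sup>+x0. (\<integral>\<^sup>+y0. F (x(i := x0)) (y(i := y0)) \<partial>?g) \<partial>?g)"]) measurable
  also have "\<dots> = (\<integral>\<^sup>+x. (\<integral>\<^sup>+y. F x y \<partial>Gauss (insert i I)) \<partial>Gauss (insert i I))"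
    by (rule split[symmetric]) (use insert.prems in simp)
  finally show ?case .
qed

text \<open>Decomposes one Gaussian vector into two independent ones. This is what lets variance be
  moved in small portions from one family of features to another.\<close>

lemma nn_integral_Gauss_split:
  fixes c s :: real
  assumes "finite I" and [measurable]: "F \<in> borel_measurable (Gauss I)"
    and cs: "c\<^sup>2 + s\<^sup>2 = 1"
  shows "(\<integral>\<^sup>+x. (\<integral>\<^sup>+y. F (\<lambda>i\<in>I. c * x i + s * y i) \<partial>Gauss I) \<partial>Gauss I) = (\<integral>\<^sup>+x. F x \<partial>Gauss I)"
proof -
  interpret G: prob_space "Gauss I" by (rule prob_space_Gauss)
  show ?thesis
  proof (cases "c = 0")
    case False
    then show ?thesis
      using nn_integral_Gauss_rotate[of I "\<lambda>x y. F x" c s] assms G.emeasure_space_1 by simp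
  next
    \<comment> \<open>A right angle is outside the rotation formula. The pair
      \<open>(s, - c)\<close> is used instead, after exchanging the two copies.\<close>
    case True
    then have "s \<noteq> 0" using cs by auto
    interpret GG: pair_sigma_finite "Gauss I" "Gauss I" ..
    have "(\<integral>\<^sup>+x. (\<integral>\<^sup>+y. F (\<lambda>i\<in>I. s * x i + (- c) * y i) \<partial>Gauss I) \<partial>Gauss I) = (\<integral>\<^sup>+x. F x \<partial>Gauss I)"
      using nn_integral_Gauss_rotate[of I "\<lambda>x y. F x" s "- c"] assms G.emeasure_space_1 \<open>s \<noteq> 0\<close>
      by (simp add: add.commute)
    moreover have "(\<integral>\<^sup>+x. (\<integral>\<^sup>+y. F (\<lambda>i\<in>I. c * x i + s * y i) \<partial>Gauss I) \<partial>Gauss I)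
      = (\<integral>\<^sup>+y. (\<integral>\<^sup>+x. F (\<lambda>i\<in>I. c * x i + s * y i) \<partial>Gauss I) \<partial>Gauss I)"
      by (rule GG.Fubini') measurable
    ultimately show ?thesis using True by simp
  qed
qed

section \<open>Exponential and second moments of linear functionals\<close>

lemma nn_integral_wick:
  assumes "finite I"
  shows "(\<integral>\<^sup>+w. ennreal (wick I c w) \<partial>Gauss I) = 1"
  using nn_integral_Gauss_shift[OF assms, of "\<lambda>_. 1" c]
    prob_space.emeasure_space_1[OF prob_space_Gauss, of I] by simp

lemma nn_integral_exp_Gauss:
  assumes "finite I"
  shows "(\<integral>\<^sup>+w. ennreal (exp (\<Sum>i\<in>I. c i * w i)) \<partial>Gauss I) = ennreal (exp ((\<Sum>i\<in>I. (c i)\<^sup>2) / 2))"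
proof -
  have "exp (\<Sum>i\<in>I. c i * w i) = exp ((\<Sum>i\<in>I. (c i)\<^sup>2) / 2) * wick I c w" for w
    unfolding wick_def by (simp add: exp_diff)
  then show ?thesis
    using nn_integral_wick[OF assms, of c] by (simp add: ennreal_mult nn_integral_cmult)
qed

lemma nn_integral_exp_std_normal:
  "(\<integral>\<^sup>+w. ennreal (exp (a * w)) \<partial>std_normal_distribution) = ennreal (exp (a\<^sup>2 / 2))"
proof -
  have "(\<integral>\<^sup>+w. ennreal (exp (a * w)) \<partial>std_normal_distribution)
      = (\<integral>\<^sup>+w. ennreal (exp (a\<^sup>2 / 2)) * (1 * ennreal (exp (a * w - a\<^sup>2 / 2))) \<partial>std_normal_distribution)"
    by (intro nn_integral_cong) (simp add: ennreal_mult[symmetric] exp_add[symmetric])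
  also have "\<dots> = ennreal (exp (a\<^sup>2 / 2)) * (\<integral>\<^sup>+w. 1 * ennreal (exp (a * w - a\<^sup>2 / 2)) \<partial>std_normal_distribution)"
    by (rule nn_integral_cmult) measurable
  also have "\<dots> = ennreal (exp (a\<^sup>2 / 2))"
    by (subst nn_integral_std_normal_shift[symmetric])
       (use prob_space.emeasure_space_1[OF prob_space_std_normal] in auto)
  finally show ?thesis .
qed

text \<open>The bound \<open>t^2 <= exp t + exp (- t)\<close> reduces the second moment to the
  exponential moments already known. The value \<open>4\<close> is crude; what counts is its
  independence of the dimension.\<close>

lemma nn_integral_linear_square_le:
  assumes "finite I" "(\<Sum>i\<in>I. (c i)\<^sup>2) \<le> 1"
  shows "(\<integral>\<^sup>+w. ennreal ((\<Sum>i\<in>I. c i * w i)\<^sup>2) \<partial>Gauss I) \<le> 4"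
proof -
  have sq: "t\<^sup>2 \<le> exp t + exp (- t)" for t :: real
  proof -
    have *: "t\<^sup>2 \<le> exp t + exp (- t)" if "t \<ge> 0" for t :: real
    proof -
      have "exp (t / 2) * exp (t / 2) = exp t" by (simp add: exp_add[symmetric])
      moreover have "1 + t / 2 + (t / 2)\<^sup>2 / 2 \<le> exp (t / 2)"
        using exp_lower_Taylor_quadratic[of "t / 2"] that by simp
      ultimately have "(1 + t / 2 + (t / 2)\<^sup>2 / 2)\<^sup>2 \<le> exp t"
        using that by (smt (verit, best) power2_eq_square mult_mono zero_le_power2 divide_nonneg_nonneg)
      moreover have "t\<^sup>2 \<le> (1 + t / 2 + (t / 2)\<^sup>2 / 2)\<^sup>2"
      proof (rule power_mono)
        have "0 \<le> (t / 2 - 1)\<^sup>2" by simp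
        then show "t \<le> 1 + t / 2 + (t / 2)\<^sup>2 / 2" by (simp add: power2_eq_square algebra_simps)
      qed (use that in auto)
      ultimately show ?thesis using exp_ge_zero[of "- t"] by linarith
    qed
    show ?thesis using *[of t] *[of "- t"] by (cases "t \<ge> 0") auto
  qed
  have e: "exp ((\<Sum>i\<in>I. (c i)\<^sup>2) / 2) \<le> 2"
  proof -
    have "exp ((\<Sum>i\<in>I. (c i)\<^sup>2) / 2) \<le> exp (1 / 2 :: real)" using assms(2) by simp
    also have "\<dots> \<le> 1 + 1 / 2 + (1 / 2)\<^sup>2" by (rule exp_bound) auto
    also have "\<dots> \<le> 2" by (simp add: power2_eq_square)
    finally show ?thesis .
  qed
  have "(\<integral>\<^sup>+w. ennreal ((\<Sum>i\<in>I. c i * w i)\<^sup>2) \<partial>Gauss I)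
    \<le> (\<integral>\<^sup>+w. ennreal (exp (\<Sum>i\<in>I. c i * w i)) + ennreal (exp (\<Sum>i\<in>I. (- c i) * w i)) \<partial>Gauss I)"
    using sq by (intro nn_integral_mono) (simp add: sum_negf ennreal_plus[symmetric] del: ennreal_plus)
  also have "\<dots> = ennreal (exp ((\<Sum>i\<in>I. (c i)\<^sup>2) / 2)) + ennreal (exp ((\<Sum>i\<in>I. (c i)\<^sup>2) / 2))"
    using assms(1) nn_integral_exp_Gauss[of I c] nn_integral_exp_Gauss[of I "\<lambda>i. - c i"]
    by (subst nn_integral_add) auto
  also have "\<dots> \<le> ennreal 4"
    using e by (subst ennreal_plus[symmetric]) (auto intro!: ennreal_leI simp del: ennreal_numeral)
  finally show ?thesis by simp
qed

section \<open>Dimension-free Gaussian lower tails of convex functions\<close>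

text \<open>\<open>X j\<close> rotates \<open>x\<close> into \<open>y\<close> in \<open>n\<close> steps; the increment of a maximum of affine functions is bounded
  below by that of the active piece, whose mean square is of order \<open>K\<^sup>2 h\<^sup>2\<close> with \<open>n h = pi / 2\<close>.\<close>

lemma gauss_max_affine_separation:
  fixes c :: "nat \<Rightarrow> real" and \<beta> :: "nat \<Rightarrow> 'i \<Rightarrow> real"
  assumes I: "finite I" and S: "finite S" "S \<noteq> {}"
    and K: "0 < K" "\<And>k. k \<in> S \<Longrightarrow> (\<Sum>i\<in>I. (\<beta> k i)\<^sup>2) \<le> K\<^sup>2"
    and g_def: "\<And>w. g w = Max ((\<lambda>k. c k + (\<Sum>i\<in>I. \<beta> k i * w i)) ` S)"
    and m: "0 < m"
  shows "measure (Gauss I) {w \<in> space (Gauss I). t \<le> g w} * measure (Gauss I) {w \<in> space (Gauss I). g w \<le> t - m} * m\<^sup>2 \<le> 64 * K\<^sup>2"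
proof -
  interpret G: prob_space "Gauss I" by (rule prob_space_Gauss)
  interpret GG: pair_sigma_finite "Gauss I" "Gauss I" ..
  define l where "l k w = c k + (\<Sum>i\<in>I. \<beta> k i * w i)" for k w
  have g: "g w = Max ((\<lambda>k. l k w) ` S)" for w unfolding g_def l_def ..
  have l_meas: "l k \<in> borel_measurable (Gauss I)" for k unfolding l_def by measurable
  have g_meas: "g \<in> borel_measurable (Gauss I)"
    unfolding g[abs_def] by (intro borel_measurable_Max S l_meas)
  note [measurable] = l_meas g_meas
  \<comment> \<open>The active piece is selected as the least index attaining the maximum, which
    makes the selection measurable.\<close>
  define \<iota> where "\<iota> w = (LEAST k. k \<in> S \<and> l k w = g w)" for w
  have \<iota>: "\<iota> w \<in> S \<and> l (\<iota> w) w = g w" for w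
  proof -
    have "g w \<in> (\<lambda>k. l k w) ` S" unfolding g by (rule Max_in) (use S in auto)
    then obtain k where "k \<in> S \<and> l k w = g w" by auto
    then show ?thesis unfolding \<iota>_def by (rule LeastI)
  qed
  have [measurable]: "\<iota> \<in> measurable (Gauss I) (count_space UNIV)"
  proof -
    have "Measurable.pred (Gauss I) (\<lambda>w. l k w = g w)" for k
      unfolding pred_def by (rule borel_measurable_eq[OF l_meas g_meas])
    then have "Measurable.pred (Gauss I) (\<lambda>w. k \<in> S \<and> l k w = g w)" for k
      by (intro pred_intros_logic) auto
    then show ?thesis unfolding \<iota>_def by (rule measurable_Least)
  qed
  have [measurable]: "(\<lambda>w. \<beta> (\<iota> w) i) \<in> borel_measurable (Gauss I)" for i
    by (rule measurable_compose[of \<iota> _ "count_space UNIV"]) measurable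
  define d where "d = card I"
  \<comment> \<open>One step more than the dimension. The factor \<open>cos h - 1\<close> acts on
    all of \<open>u\<close>, whose squared length is of order \<open>d\<close>, and contributes
    order \<open>h^4 d\<close> to the mean square of a step; \<open>n > d\<close> keeps this below
    the order \<open>h^2\<close> of the part along \<open>v\<close>.\<close>
  define n where "n = d + 1"
  define h where "h = pi / (2 * real n)"
  have n0: "0 < real n" unfolding n_def by simp
  have h0: "0 < h" unfolding h_def using n0 by simp
  have h2: "h \<le> 2 / real n"
  proof -
    have "h = (pi / 2) / real n" unfolding h_def by simp
    also have "\<dots> \<le> 2 / real n" using pi_less_4 n0 by (intro divide_right_mono) auto
    finally show ?thesis .
  qed
  have hn: "real n * h = pi / 2" unfolding h_def n_def by (simp add: field_simps)
  \<comment> \<open>The increment of the affine piece active at \<open>u\<close> when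
    \<open>u\<close> is turned by the angle \<open>h\<close> towards \<open>v\<close>. The piece is
    chosen at the starting point, so for fixed \<open>u\<close> the increment is affine in
    \<open>v\<close>.\<close>
  define \<xi> where "\<xi> u v = (\<Sum>i\<in>I. \<beta> (\<iota> u) i * ((cos h - 1) * u i + sin h * v i))" for u v
  have xi_meas: "(\<lambda>p. \<xi> (fst p) (snd p)) \<in> borel_measurable (Gauss I \<Otimes>\<^sub>M Gauss I)"
    unfolding \<xi>_def by measurable
  note [measurable] = measurable_split_compose[OF xi_meas]
  define X where "X j x y = (\<lambda>i\<in>I. cos (real j * h) * x i + sin (real j * h) * y i)" for j and x y :: "'i \<Rightarrow> real"
  define Y where "Y j x y = (\<lambda>i\<in>I. cos (real j * h) * y i - sin (real j * h) * x i)" for j and x y :: "'i \<Rightarrow> real"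
  \<comment> \<open>By the addition formulas \<open>X (Suc j)\<close> arises from \<open>X j\<close>
    and \<open>Y j\<close> by one turn of angle \<open>h\<close>. Keeping the old piece can only
    underestimate the maximum at the new point.\<close>
  have step: "g (X j x y) + \<xi> (X j x y) (Y j x y) \<le> g (X (Suc j) x y)" for j x y
  proof -
    let ?k = "\<iota> (X j x y)"
    have rot: "X (Suc j) x y i = cos h * X j x y i + sin h * Y j x y i" if "i \<in> I" for i
      using that unfolding X_def Y_def
      by (simp add: distrib_right cos_add sin_add) (simp add: algebra_simps)
    have "l ?k (X (Suc j) x y) = c ?k + (\<Sum>i\<in>I. \<beta> ?k i * X j x y i + \<beta> ?k i * ((cos h - 1) * X j x y i + sin h * Y j x y i))"
      unfolding l_def using rot by (intro arg_cong2[where f = "(+)"] sum.cong refl) (auto simp: algebra_simps)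
    also have "\<dots> = l ?k (X j x y) + \<xi> (X j x y) (Y j x y)"
      unfolding \<xi>_def l_def by (simp add: sum.distrib)
    also have "l ?k (X j x y) = g (X j x y)" using \<iota> by blast
    finally have "g (X j x y) + \<xi> (X j x y) (Y j x y) = l ?k (X (Suc j) x y)" ..
    also have "\<dots> \<le> g (X (Suc j) x y)"
      unfolding g by (rule Max_ge) (use S \<iota> in auto)
    finally show ?thesis .
  qed
  have tel: "g x + (\<Sum>j<n. \<xi> (X j x y) (Y j x y)) \<le> g y" for x y
  proof -
    have cong: "g u = g v" if "\<And>i. i \<in> I \<Longrightarrow> u i = v i" for u v
      unfolding g l_def using that by (simp cong: sum.cong)
    have "g (X 0 x y) + (\<Sum>j<k. \<xi> (X j x y) (Y j x y)) \<le> g (X k x y)" for k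
    proof (induction k)
      case (Suc k)
      then show ?case using step[of k x y] by simp
    qed simp
    from this[of n] show ?thesis
      using cong[of "X 0 x y" x] cong[of "X n x y" y] by (simp add: X_def hn)
  qed
  have bK: "(\<Sum>i\<in>I. (\<beta> (\<iota> u) i)\<^sup>2) \<le> K\<^sup>2" for u using K(2) \<iota> by blast
  have lin: "(\<integral>\<^sup>+y. ennreal ((\<Sum>i\<in>I. \<beta> (\<iota> x) i * y i)\<^sup>2) \<partial>Gauss I) \<le> ennreal (4 * K\<^sup>2)" for x
  proof -
    have "(\<Sum>i\<in>I. \<beta> (\<iota> x) i * y i)\<^sup>2 = K\<^sup>2 * (\<Sum>i\<in>I. (\<beta> (\<iota> x) i / K) * y i)\<^sup>2" for y
      using K(1) by (simp add: power_mult_distrib[symmetric] sum_distrib_left)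
    then have "(\<integral>\<^sup>+y. ennreal ((\<Sum>i\<in>I. \<beta> (\<iota> x) i * y i)\<^sup>2) \<partial>Gauss I)
      = ennreal (K\<^sup>2) * (\<integral>\<^sup>+y. ennreal ((\<Sum>i\<in>I. (\<beta> (\<iota> x) i / K) * y i)\<^sup>2) \<partial>Gauss I)"
      by (simp add: ennreal_mult nn_integral_cmult)
    also have "\<dots> \<le> ennreal (K\<^sup>2) * 4"
      using bK[of x] K(1) by (intro mult_left_mono nn_integral_linear_square_le I) (auto simp: power_divide sum_divide_distrib[symmetric])
    finally show ?thesis by (simp add: ennreal_mult mult.commute)
  qed
  have sq1: "(\<integral>\<^sup>+x. ennreal ((x i)\<^sup>2) \<partial>Gauss I) \<le> 4" if "i \<in> I" for i
  proof -
    have "(\<Sum>j\<in>I. (if j = i then 1 else 0) * x j) = x i" for x :: "'i \<Rightarrow> real"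
      using that I by (simp add: if_distrib[of "\<lambda>u. u * _"] cong: if_cong)
    moreover have "(\<Sum>j\<in>I. (if j = i then 1 else 0 :: real)\<^sup>2) \<le> 1"
    proof -
      have "(if j = i then 1 else 0 :: real)\<^sup>2 = (if j = i then 1 else 0)" for j by simp
      then show ?thesis using I that by simp
    qed
    ultimately show ?thesis
      using nn_integral_linear_square_le[of I "\<lambda>j. if j = i then 1 else 0"] I by simp
  qed
  have xi2: "(\<integral>\<^sup>+x. (\<integral>\<^sup>+y. ennreal ((\<xi> x y)\<^sup>2) \<partial>Gauss I) \<partial>Gauss I) \<le> ennreal (16 * K\<^sup>2 * h\<^sup>2)"
  proof -
    have cosh: "(1 - cos h)\<^sup>2 \<le> h ^ 4 / 4"
    proof -
      have "1 - cos h \<le> h\<^sup>2 / 2"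
      proof -
        have "(sin (h / 2))\<^sup>2 \<le> (h / 2)\<^sup>2" using abs_sin_x_le_abs_x[of "h / 2"] by (simp only: abs_le_square_iff)
        then show ?thesis using cos_double_sin[of "h / 2"] by (simp add: power_divide)
      qed
      then have "(1 - cos h)\<^sup>2 \<le> (h\<^sup>2 / 2)\<^sup>2" by (intro power_mono) auto
      then show ?thesis by (simp add: power_divide)
    qed
    have sinh: "(sin h)\<^sup>2 \<le> h\<^sup>2"
      using abs_sin_x_le_abs_x[of h] by (simp add: abs_le_square_iff)
    have pt: "(\<xi> x y)\<^sup>2 \<le> h ^ 4 / 2 * K\<^sup>2 * (\<Sum>i\<in>I. (x i)\<^sup>2) + 2 * h\<^sup>2 * (\<Sum>i\<in>I. \<beta> (\<iota> x) i * y i)\<^sup>2" for x y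
    proof -
      define p where "p = (\<Sum>i\<in>I. \<beta> (\<iota> x) i * x i)"
      define q where "q = (\<Sum>i\<in>I. \<beta> (\<iota> x) i * y i)"
      have "\<xi> x y = (cos h - 1) * p + sin h * q"
        unfolding \<xi>_def p_def q_def by (simp add: algebra_simps sum.distrib sum_distrib_left sum_subtractf)
      then have "(\<xi> x y)\<^sup>2 \<le> 2 * ((1 - cos h)\<^sup>2 * p\<^sup>2) + 2 * ((sin h)\<^sup>2 * q\<^sup>2)"
        using sum_squares_bound[of "(cos h - 1) * p" "sin h * q"]
        by (simp add: power2_sum power_mult_distrib power2_commute[of 1] mult_ac)
      also have "\<dots> \<le> 2 * (h ^ 4 / 4 * (K\<^sup>2 * (\<Sum>i\<in>I. (x i)\<^sup>2))) + 2 * (h\<^sup>2 * q\<^sup>2)"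
      proof (intro add_mono mult_left_mono mult_mono cosh sinh)
        have "p\<^sup>2 \<le> (\<Sum>i\<in>I. (\<beta> (\<iota> x) i)\<^sup>2) * (\<Sum>i\<in>I. (x i)\<^sup>2)"
          unfolding p_def by (rule Cauchy_Schwarz_ineq_sum)
        also have "\<dots> \<le> K\<^sup>2 * (\<Sum>i\<in>I. (x i)\<^sup>2)" by (intro mult_right_mono bK sum_nonneg) auto
        finally show "p\<^sup>2 \<le> K\<^sup>2 * (\<Sum>i\<in>I. (x i)\<^sup>2)" .
      qed auto
      finally show ?thesis unfolding q_def by (simp add: mult_ac)
    qed
    have "(\<integral>\<^sup>+x. (\<integral>\<^sup>+y. ennreal ((\<xi> x y)\<^sup>2) \<partial>Gauss I) \<partial>Gauss I)
      \<le> (\<integral>\<^sup>+x. (\<integral>\<^sup>+y. ennreal (h ^ 4 / 2 * K\<^sup>2) * (\<Sum>i\<in>I. ennreal ((x i)\<^sup>2)) + ennreal (2 * h\<^sup>2) * ennreal ((\<Sum>i\<in>I. \<beta> (\<iota> x) i * y i)\<^sup>2) \<partial>Gauss I) \<partial>Gauss I)"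
    proof (intro nn_integral_mono)
      fix x y :: "'i \<Rightarrow> real"
      have "ennreal ((\<xi> x y)\<^sup>2) \<le> ennreal (h ^ 4 / 2 * K\<^sup>2 * (\<Sum>i\<in>I. (x i)\<^sup>2) + 2 * h\<^sup>2 * (\<Sum>i\<in>I. \<beta> (\<iota> x) i * y i)\<^sup>2)"
        by (rule ennreal_leI[OF pt])
      also have "\<dots> = ennreal (h ^ 4 / 2 * K\<^sup>2) * (\<Sum>i\<in>I. ennreal ((x i)\<^sup>2)) + ennreal (2 * h\<^sup>2) * ennreal ((\<Sum>i\<in>I. \<beta> (\<iota> x) i * y i)\<^sup>2)"
      proof -
        have split: "ennreal (c1 * X + c2 * Y) = ennreal c1 * ennreal X + ennreal c2 * ennreal Y"
          if "0 \<le> c1" "0 \<le> c2" "0 \<le> X" "0 \<le> Y" for c1 c2 X Y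
          using that by (simp add: ennreal_mult)
        show ?thesis by (subst split) (auto simp: sum_nonneg)
      qed
      finally show "ennreal ((\<xi> x y)\<^sup>2) \<le> \<dots>" .
    qed
    also have "\<dots> = (\<integral>\<^sup>+x. ennreal (h ^ 4 / 2 * K\<^sup>2) * (\<Sum>i\<in>I. ennreal ((x i)\<^sup>2)) + ennreal (2 * h\<^sup>2) * (\<integral>\<^sup>+y. ennreal ((\<Sum>i\<in>I. \<beta> (\<iota> x) i * y i)\<^sup>2) \<partial>Gauss I) \<partial>Gauss I)"
      by (intro nn_integral_cong) (simp add: nn_integral_add nn_integral_cmult G.emeasure_space_1)
    also have "\<dots> \<le> (\<integral>\<^sup>+x. ennreal (h ^ 4 / 2 * K\<^sup>2) * (\<Sum>i\<in>I. ennreal ((x i)\<^sup>2)) + ennreal (2 * h\<^sup>2) * ennreal (4 * K\<^sup>2) \<partial>Gauss I)"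
      by (intro nn_integral_mono add_mono order_refl mult_left_mono lin) simp
    also have "\<dots> = ennreal (h ^ 4 / 2 * K\<^sup>2) * (\<Sum>i\<in>I. (\<integral>\<^sup>+x. ennreal ((x i)\<^sup>2) \<partial>Gauss I)) + ennreal (2 * h\<^sup>2) * ennreal (4 * K\<^sup>2)"
      by (simp add: nn_integral_add nn_integral_cmult nn_integral_sum G.emeasure_space_1 del: sum_ennreal)
    also have "\<dots> \<le> ennreal (h ^ 4 / 2 * K\<^sup>2) * (\<Sum>i\<in>I. 4) + ennreal (2 * h\<^sup>2) * ennreal (4 * K\<^sup>2)"
      by (intro add_mono order_refl mult_left_mono sum_mono sq1) auto
    also have "\<dots> = ennreal (h ^ 4 / 2 * K\<^sup>2 * (4 * real d) + 2 * h\<^sup>2 * (4 * K\<^sup>2))"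
    proof -
      have "(\<Sum>i\<in>I. (4::ennreal)) = ennreal (4 * real d)"
        unfolding d_def by (simp add: ennreal_mult ennreal_of_nat_eq_real_of_nat mult.commute)
      moreover have "ennreal c1 * ennreal X + ennreal c2 * ennreal Y = ennreal (c1 * X + c2 * Y)"
        if "0 \<le> c1" "0 \<le> c2" "0 \<le> X" "0 \<le> Y" for c1 c2 X Y
        using that by (simp add: ennreal_mult)
      ultimately show ?thesis by simp
    qed
    also have "\<dots> \<le> ennreal (16 * K\<^sup>2 * h\<^sup>2)"
    proof (rule ennreal_leI)
      have "h\<^sup>2 * real d \<le> (2 / real n)\<^sup>2 * real d"
        using h0 h2 by (intro mult_right_mono power_mono) auto
      also have "\<dots> \<le> 4"
      proof -
        have "real d \<le> (real n)\<^sup>2" unfolding n_def by (simp add: power2_eq_square algebra_simps)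
        then show ?thesis unfolding n_def by (simp add: power_divide divide_le_eq)
      qed
      finally have "h\<^sup>2 * K\<^sup>2 * 2 * (h\<^sup>2 * real d) \<le> h\<^sup>2 * K\<^sup>2 * 2 * 4" by (intro mult_left_mono) auto
      then show "h ^ 4 / 2 * K\<^sup>2 * (4 * real d) + 2 * h\<^sup>2 * (4 * K\<^sup>2) \<le> 16 * K\<^sup>2 * h\<^sup>2"
        by (simp add: power4_eq_xxxx power2_eq_square algebra_simps)
    qed
    finally show ?thesis .
  qed
  define P where "P = {w \<in> space (Gauss I). t \<le> g w}"
  define Q where "Q = {w \<in> space (Gauss I). g w \<le> t - m}"
  have [measurable]: "P \<in> sets (Gauss I)" "Q \<in> sets (Gauss I)" unfolding P_def Q_def by measurable
  have "ennreal (m\<^sup>2) * (emeasure (Gauss I) P * emeasure (Gauss I) Q)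
     = (\<integral>\<^sup>+x. (\<integral>\<^sup>+y. ennreal (m\<^sup>2) * (indicator P x * indicator Q y) \<partial>Gauss I) \<partial>Gauss I)"
    by (simp add: nn_integral_cmult nn_integral_multc)
  \<comment> \<open>A Chebyshev argument on the product space: for \<open>x\<close> in
    \<open>P\<close> and \<open>y\<close> in \<open>Q\<close> the telescoped increments sum to at
    most \<open>- m\<close>, and Cauchy-Schwarz over the steps yields the factor
    \<open>n\<close>.\<close>
  also have "\<dots> \<le> (\<integral>\<^sup>+x. (\<integral>\<^sup>+y. (\<Sum>j<n. ennreal (real n) * ennreal ((\<xi> (X j x y) (Y j x y))\<^sup>2)) \<partial>Gauss I) \<partial>Gauss I)"
  proof (intro nn_integral_mono)
    fix x y :: "'i \<Rightarrow> real"
    show "ennreal (m\<^sup>2) * (indicator P x * indicator Q y) \<le> (\<Sum>j<n. ennreal (real n) * ennreal ((\<xi> (X j x y) (Y j x y))\<^sup>2))"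
    proof (cases "x \<in> P \<and> y \<in> Q")
      case True
      then have "(\<Sum>j<n. \<xi> (X j x y) (Y j x y)) \<le> - m" using tel[of x y] unfolding P_def Q_def by auto
      then have "m\<^sup>2 \<le> (\<Sum>j<n. 1 * \<xi> (X j x y) (Y j x y))\<^sup>2" using m by (simp add: abs_le_square_iff[symmetric])
      also have "\<dots> \<le> (\<Sum>j<n. 1\<^sup>2) * (\<Sum>j<n. (\<xi> (X j x y) (Y j x y))\<^sup>2)" by (rule Cauchy_Schwarz_ineq_sum)
      also have "\<dots> = (\<Sum>j<n. real n * (\<xi> (X j x y) (Y j x y))\<^sup>2)" by (simp add: sum_distrib_left)
      finally have "ennreal (m\<^sup>2) \<le> ennreal (\<Sum>j<n. real n * (\<xi> (X j x y) (Y j x y))\<^sup>2)" by (rule ennreal_leI)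
      then show ?thesis using True by (simp add: sum_ennreal[symmetric] ennreal_mult)
    qed (auto simp: indicator_def)
  qed
  also have "\<dots> = (\<Sum>j<n. ennreal (real n) * (\<integral>\<^sup>+x. (\<integral>\<^sup>+y. ennreal ((\<xi> (X j x y) (Y j x y))\<^sup>2) \<partial>Gauss I) \<partial>Gauss I))"
    unfolding X_def Y_def by (simp add: nn_integral_sum nn_integral_cmult)
  \<comment> \<open>Each pair \<open>(X j, Y j)\<close> is again a pair of independent Gaussian
    vectors, so all steps have the same mean square. Strictness of \<open>j < n\<close> keeps the
    cosine positive, as the rotation formula demands a nonzero one.\<close>
  also have "\<dots> = (\<Sum>j<n. ennreal (real n) * (\<integral>\<^sup>+x. (\<integral>\<^sup>+y. ennreal ((\<xi> x y)\<^sup>2) \<partial>Gauss I) \<partial>Gauss I))"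
  proof (intro sum.cong refl arg_cong2[where f = "(*)"])
    fix j assume "j \<in> {..<n}"
    then have "real j * h < real n * h" using h0 by (intro mult_strict_right_mono) auto
    then have "0 < cos (real j * h)" using hn h0 by (intro cos_gt_zero_pi) (auto intro: less_le_trans[of _ 0] simp: )
    then show "(\<integral>\<^sup>+x. (\<integral>\<^sup>+y. ennreal ((\<xi> (X j x y) (Y j x y))\<^sup>2) \<partial>Gauss I) \<partial>Gauss I) = (\<integral>\<^sup>+x. (\<integral>\<^sup>+y. ennreal ((\<xi> x y)\<^sup>2) \<partial>Gauss I) \<partial>Gauss I)"
      unfolding X_def Y_def
      by (intro nn_integral_Gauss_rotate[where F = "\<lambda>x y. ennreal ((\<xi> x y)\<^sup>2)"] I) auto
  qed
  also have "\<dots> \<le> (\<Sum>j<n. ennreal (real n) * ennreal (16 * K\<^sup>2 * h\<^sup>2))"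
    by (intro sum_mono mult_left_mono xi2) auto
  also have "\<dots> = ennreal (16 * K\<^sup>2 * (real n * h)\<^sup>2)"
  proof -
    have "ennreal (real n) * ennreal (16 * K\<^sup>2 * h\<^sup>2) = ennreal (real n * (16 * K\<^sup>2 * h\<^sup>2))"
      by (rule ennreal_mult[symmetric]) auto
    then have "(\<Sum>j<n. ennreal (real n) * ennreal (16 * K\<^sup>2 * h\<^sup>2)) = (\<Sum>j<n. ennreal (real n * (16 * K\<^sup>2 * h\<^sup>2)))"
      by (simp only:)
    also have "\<dots> = ennreal (\<Sum>j<n. real n * (16 * K\<^sup>2 * h\<^sup>2))"
      by (rule sum_ennreal) auto
    finally show ?thesis by (simp add: power_mult_distrib power2_eq_square mult_ac)
  qed
  \<comment> \<open>\<open>n h = pi / 2\<close> is at most \<open>2\<close>, whence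
    \<open>16 * 4 = 64\<close>.\<close>
  also have "\<dots> \<le> ennreal (64 * K\<^sup>2)"
  proof (rule ennreal_leI)
    have "(pi / 2)\<^sup>2 \<le> 2\<^sup>2" using pi_less_4 by (intro power_mono) auto
    then have "16 * K\<^sup>2 * (pi / 2)\<^sup>2 \<le> 16 * K\<^sup>2 * 2\<^sup>2" by (intro mult_left_mono) auto
    then show "16 * K\<^sup>2 * (real n * h)\<^sup>2 \<le> 64 * K\<^sup>2" unfolding hn by simp
  qed
  finally have "ennreal (m\<^sup>2 * (measure (Gauss I) P * measure (Gauss I) Q)) \<le> ennreal (64 * K\<^sup>2)"
    by (simp add: G.emeasure_eq_measure ennreal_mult)
  then have "m\<^sup>2 * (measure (Gauss I) P * measure (Gauss I) Q) \<le> 64 * K\<^sup>2" by (subst (asm) ennreal_le_iff) auto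
  then show ?thesis unfolding P_def Q_def by (simp add: mult_ac)
qed

text \<open>The supremum of the tangent planes at the points of \<open>A\<close> minorises
  \<open>f\<close>, is at least \<open>- C\<close> on \<open>A\<close> and has slope at most
  \<open>K\<close>, so the separation estimate limits how often it drops. To obtain a maximum of
  finitely many planes, \<open>A\<close> is cut into cubes with one base point each; this costs
  \<open>1\<close> in height and up to half of \<open>p\<close>, which doubles \<open>64\<close> to
  \<open>128\<close>.\<close>

lemma gauss_lower_tail:
  fixes f :: "('i \<Rightarrow> real) \<Rightarrow> real" and \<beta> :: "('i \<Rightarrow> real) \<Rightarrow> 'i \<Rightarrow> real"
  assumes I: "finite I" and A: "A \<in> sets (Gauss I)" and f [measurable]: "f \<in> borel_measurable (Gauss I)"
    and tangent: "\<And>v w. v \<in> A \<Longrightarrow> w \<in> space (Gauss I) \<Longrightarrow> - C + (\<Sum>i\<in>I. \<beta> v i * (w i - v i)) \<le> f w"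
    and slope: "\<And>v. v \<in> A \<Longrightarrow> (\<Sum>i\<in>I. (\<beta> v i)\<^sup>2) \<le> K\<^sup>2" and K: "0 < K"
    and p: "0 < p" "p \<le> measure (Gauss I) A" and m: "0 < m"
  shows "measure (Gauss I) {w \<in> space (Gauss I). f w \<le> - C - 1 - m} * p * m\<^sup>2 \<le> 128 * K\<^sup>2"
proof -
  interpret G: prob_space "Gauss I" by (rule prob_space_Gauss)
  note [measurable] = A
  define d where "d = real (card I) + 1"
  \<comment> \<open>With this mesh, moving a point inside its cell changes a plane of slope
    \<open>K\<close> by at most \<open>K \<eta> = 1 / d\<close> per coordinate, hence by at most
    \<open>1\<close> in total.\<close>
  define \<eta> where "\<eta> = 1 / (K * d)"
  have d0: "0 < d" unfolding d_def by simp
  have \<eta>0: "0 < \<eta>" unfolding \<eta>_def using d0 K by simp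
  define Q where "Q = (\<Pi>\<^sub>E i\<in>I. (UNIV :: int set))"
  have Q: "countable Q" "Q \<noteq> {}" unfolding Q_def using I by (auto intro!: countable_PiE simp: PiE_eq_empty_iff)
  define e where "e = from_nat_into Q"
  have e_surj: "\<exists>k. q = e k" if "q \<in> Q" for q
    using from_nat_into_surj[OF Q(1) that] unfolding e_def by metis
  define cell where "cell k = {w \<in> space (Gauss I). \<forall>i\<in>I. \<lfloor>w i / \<eta>\<rfloor> = e k i}" for k
  have cell_meas [measurable]: "cell k \<in> sets (Gauss I)" for k
    unfolding cell_def using I by measurable
  have cover: "\<exists>k. w \<in> cell k" if "w \<in> space (Gauss I)" for w
  proof -
    have "(\<lambda>i\<in>I. \<lfloor>w i / \<eta>\<rfloor>) \<in> Q" unfolding Q_def by simp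
    then obtain k where "(\<lambda>i\<in>I. \<lfloor>w i / \<eta>\<rfloor>) = e k" using e_surj by blast
    then have "\<lfloor>w i / \<eta>\<rfloor> = e k i" if "i \<in> I" for i using that by (metis restrict_apply')
    then show ?thesis using that unfolding cell_def by auto
  qed
  \<comment> \<open>By continuity from below, finitely many of the countably many cells already
    carry more than \<open>p / 2\<close>.\<close>
  define An where "An n = (\<Union>k<n. A \<inter> cell k)" for n
  have [measurable]: "An n \<in> sets (Gauss I)" for n unfolding An_def by measurable
  have "incseq An" unfolding An_def incseq_def by (auto intro: less_le_trans)
  then have "(\<lambda>n. measure (Gauss I) (An n)) \<longlonglongrightarrow> measure (Gauss I) (\<Union>n. An n)"
    by (intro G.finite_Lim_measure_incseq) auto
  moreover have "(\<Union>n. An n) = A"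
    using cover sets.sets_into_space[OF A] unfolding An_def by blast
  ultimately have "(\<lambda>n. measure (Gauss I) (An n)) \<longlonglongrightarrow> measure (Gauss I) A" by simp
  then have "\<forall>\<^sub>F n in sequentially. p / 2 < measure (Gauss I) (An n)"
    by (rule order_tendstoD(1)) (use p in linarith)
  then obtain n where n: "p / 2 < measure (Gauss I) (An n)" by (auto simp: eventually_sequentially)
  define S where "S = {k. k < n \<and> A \<inter> cell k \<noteq> {}}"
  define pt where "pt k = (SOME v. v \<in> A \<inter> cell k)" for k
  have pt: "pt k \<in> A" "pt k \<in> cell k" if "k \<in> S" for k
  proof -
    have "\<exists>v. v \<in> A \<inter> cell k" using that unfolding S_def by auto
    then have "pt k \<in> A \<inter> cell k" unfolding pt_def by (rule someI_ex)
    then show "pt k \<in> A" "pt k \<in> cell k" by auto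
  qed
  have S: "finite S" "S \<noteq> {}"
  proof -
    have "An n \<noteq> {}" using n p by auto
    then show "S \<noteq> {}" unfolding An_def S_def by auto
  qed (simp add: S_def)
  define c where "c k = - C - (\<Sum>i\<in>I. \<beta> (pt k) i * pt k i)" for k
  define g where "g w = Max ((\<lambda>k. c k + (\<Sum>i\<in>I. \<beta> (pt k) i * w i)) ` S)" for w
  have l: "c k + (\<Sum>i\<in>I. \<beta> (pt k) i * w i) = - C + (\<Sum>i\<in>I. \<beta> (pt k) i * (w i - pt k i))" for k w
    unfolding c_def by (simp add: algebra_simps sum_subtractf)
  have g_le: "g w \<le> f w" if "w \<in> space (Gauss I)" for w
    unfolding g_def l using S tangent[OF pt(1) that] by (subst Max_le_iff) auto
  have g_ge: "- C - 1 \<le> g w" if "w \<in> An n" for w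
  proof -
    from that obtain k where k: "k < n" "w \<in> A" "w \<in> cell k" unfolding An_def by auto
    then have kS: "k \<in> S" unfolding S_def by auto
    have "\<bar>\<beta> (pt k) i * (w i - pt k i)\<bar> \<le> K * \<eta>" if i: "i \<in> I" for i
    proof -
      have "\<lfloor>w i / \<eta>\<rfloor> = \<lfloor>pt k i / \<eta>\<rfloor>" using k(3) pt(2)[OF kS] i unfolding cell_def by auto
      then have "\<bar>w i / \<eta> - pt k i / \<eta>\<bar> \<le> 1" by linarith
      then have "\<bar>w i - pt k i\<bar> \<le> \<eta>" using \<eta>0 by (simp add: diff_divide_distrib[symmetric] divide_le_eq)
      moreover have "\<bar>\<beta> (pt k) i\<bar> \<le> K"
      proof -
        have "(\<beta> (pt k) i)\<^sup>2 \<le> (\<Sum>i\<in>I. (\<beta> (pt k) i)\<^sup>2)" using i I by (intro member_le_sum) auto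
        also have "\<dots> \<le> K\<^sup>2" by (rule slope[OF pt(1)[OF kS]])
        finally show ?thesis using K by (simp add: abs_le_square_iff[symmetric])
      qed
      ultimately show ?thesis unfolding abs_mult using K by (intro mult_mono) auto
    qed
    then have "(\<Sum>i\<in>I. \<bar>\<beta> (pt k) i * (w i - pt k i)\<bar>) \<le> real (card I) * (K * \<eta>)"
      by (intro sum_bounded_above) auto
    also have "\<dots> = real (card I) / d" unfolding \<eta>_def using K by simp
    also have "\<dots> \<le> 1" unfolding d_def by simp
    finally have "(\<Sum>i\<in>I. \<beta> (pt k) i * (w i - pt k i)) \<ge> - 1"
      using sum_abs[of "\<lambda>i. \<beta> (pt k) i * (w i - pt k i)" I] by linarith
    then have "- C - 1 \<le> - C + (\<Sum>i\<in>I. \<beta> (pt k) i * (w i - pt k i))" by simp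
    also have "\<dots> \<le> g w" unfolding g_def l by (rule Max_ge) (use S kS in auto)
    finally show ?thesis .
  qed
  have g_meas [measurable]: "g \<in> borel_measurable (Gauss I)"
    unfolding g_def[abs_def] by (intro borel_measurable_Max S) measurable
  let ?P = "{w \<in> space (Gauss I). - C - 1 \<le> g w}" and ?Q = "{w \<in> space (Gauss I). g w \<le> - C - 1 - m}"
  have P: "p / 2 \<le> measure (Gauss I) ?P"
  proof -
    have "measure (Gauss I) (An n) \<le> measure (Gauss I) ?P"
      using g_ge sets.sets_into_space[of "An n" "Gauss I"] by (intro G.finite_measure_mono) auto
    then show ?thesis using n by linarith
  qed
  have "measure (Gauss I) {w \<in> space (Gauss I). f w \<le> - C - 1 - m} \<le> measure (Gauss I) ?Q"
    using g_le by (intro G.finite_measure_mono) (auto intro: order_trans)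
  then have "measure (Gauss I) {w \<in> space (Gauss I). f w \<le> - C - 1 - m} * p * m\<^sup>2 \<le> measure (Gauss I) ?Q * (2 * measure (Gauss I) ?P) * m\<^sup>2"
    using P p by (intro mult_right_mono mult_mono) auto
  also have "\<dots> = 2 * (measure (Gauss I) ?P * measure (Gauss I) ?Q * m\<^sup>2)" by simp
  also have "\<dots> \<le> 2 * (64 * K\<^sup>2)"
    by (intro mult_left_mono gauss_max_affine_separation[OF I S K _ g_def m] slope pt) auto
  finally show ?thesis by simp
qed

section \<open>The effect of a small Gaussian tilt on fractional moments\<close>

text \<open>Near \<open>u = 1\<close> this is Taylor's formula:
  \<open>|s (s - 1) (s - 2)| <= 2\<close> and \<open>t powr (s - 3) <= 8\<close> for
  \<open>t >= 1 / 2\<close> give \<open>16\<close> even before division by \<open>3!\<close>. For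
  \<open>|u - 1| > 1 / 2\<close> each term is at most a multiple of \<open>|u - 1|^3\<close>, with
  Bernoulli's inequality on the upper side.\<close>

lemma powr_second_order:
  fixes s u :: real
  assumes s: "0 < s" "s < 1" and u: "0 \<le> u"
  shows "\<bar>u powr s - (1 + s * (u - 1) - s * (1 - s) / 2 * (u - 1)\<^sup>2)\<bar> \<le> 16 * \<bar>u - 1\<bar> ^ 3"
proof (cases "\<bar>u - 1\<bar> \<le> 1 / 2")
  case True
  then have u2: "1 / 2 \<le> u" "u \<le> 3 / 2" unfolding abs_le_iff by linarith+
  show ?thesis
  proof (cases "u = 1")
    case False
    define df where "df m x = (\<Prod>i<m. s - real i) * x powr (s - real m)" for m and x :: real
    have "\<exists>t. (if u < 1 then u < t \<and> t < 1 else 1 < t \<and> t < u) \<and>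
       u powr s = (\<Sum>m<3. df m 1 / fact m * (u - 1) ^ m) + df 3 t / fact 3 * (u - 1) ^ 3"
    proof (rule Taylor[where a = "1/2" and b = "3/2"])
      show "\<forall>m t. m < 3 \<and> 1 / 2 \<le> t \<and> t \<le> 3 / 2 \<longrightarrow> (df m has_real_derivative df (Suc m) t) (at t)"
        unfolding df_def by (auto intro!: derivative_eq_intros simp: field_simps)
    qed (use u2 False in \<open>auto simp: df_def fun_eq_iff\<close>)
    then obtain t where t: "if u < 1 then u < t \<and> t < 1 else 1 < t \<and> t < u"
      and eq: "u powr s = (\<Sum>m<3. df m 1 / fact m * (u - 1) ^ m) + df 3 t / fact 3 * (u - 1) ^ 3" by blast
    have t2: "1 / 2 \<le> t" using t u2 by (auto split: if_splits)
    have sum: "(\<Sum>m<3. df m 1 / fact m * (u - 1) ^ m) = 1 + s * (u - 1) - s * (1 - s) / 2 * (u - 1)\<^sup>2"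
      unfolding df_def by (simp add: numeral_3_eq_3 lessThan_Suc power2_eq_square field_simps)
    have "\<bar>df 3 t\<bar> \<le> 16"
    proof -
      have "\<bar>s * (s - 1) * (s - 2)\<bar> \<le> 1 * 1 * 2"
        unfolding abs_mult using s by (intro mult_mono) auto
      moreover have "t powr (s - 3) \<le> (1 / 2) powr (s - 3)"
        using t2 s by (intro powr_mono2') auto
      moreover have "(1 / 2 :: real) powr (s - 3) \<le> (1 / 2) powr (- 3)"
        using s by (intro powr_mono') auto
      moreover have "(1 / 2 :: real) powr (- 3) = 8" by (simp add: powr_minus power3_eq_cube)
      ultimately have "\<bar>s * (s - 1) * (s - 2)\<bar> * t powr (s - 3) \<le> 2 * 8"
        by (intro mult_mono) auto
      moreover have "df 3 t = (s * (s - 1) * (s - 2)) * t powr (s - 3)"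
        unfolding df_def by (simp add: numeral_3_eq_3 lessThan_Suc mult_ac)
      ultimately show ?thesis by (simp add: abs_mult)
    qed
    then have "\<bar>df 3 t\<bar> / 6 * \<bar>u - 1\<bar> ^ 3 \<le> 16 * \<bar>u - 1\<bar> ^ 3"
      by (intro mult_right_mono) auto
    moreover have "u powr s - (1 + s * (u - 1) - s * (1 - s) / 2 * (u - 1)\<^sup>2) = df 3 t / 6 * (u - 1) ^ 3"
      unfolding eq sum by (simp add: fact_numeral)
    moreover have "\<bar>df 3 t / 6 * (u - 1) ^ 3\<bar> = \<bar>df 3 t\<bar> / 6 * \<bar>u - 1\<bar> ^ 3"
      by (simp add: abs_mult power_abs)
    ultimately show ?thesis by linarith
  qed auto
next
  case False
  define d where "d = \<bar>u - 1\<bar>"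
  have d: "1 / 2 < d" using False d_def by simp
  have d2: "(u - 1)\<^sup>2 = d\<^sup>2" unfolding d_def by simp
  have s1: "s * (1 - s) \<le> 1 * 1" "0 \<le> s * (1 - s)" using s by (intro mult_mono, auto)
  have dd: "d * (1 / 2)\<^sup>2 \<le> d * d\<^sup>2" "d\<^sup>2 * (1 / 2) \<le> d\<^sup>2 * d" "(1 / 2) ^ 3 \<le> d ^ 3"
    using d by (intro mult_left_mono power_mono, auto)+
  have up: "u powr s \<le> 1 + s * (u - 1)"
  proof (cases "u = 0")
    case False
    then show ?thesis
      using Youngs_inequality_0[of s "1 - s" u 1] s u by (simp add: algebra_simps)
  qed (use s in auto)
  have sd: "\<bar>s * (u - 1)\<bar> \<le> d" unfolding d_def abs_mult using s by (intro mult_left_le_one_le) auto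
  have sd2: "0 \<le> s * (1 - s) / 2 * d\<^sup>2" "s * (1 - s) / 2 * d\<^sup>2 \<le> d\<^sup>2"
  proof -
    have "s * (1 - s) / 2 * d\<^sup>2 \<le> 1 * d\<^sup>2" using s1 by (intro mult_right_mono) auto
    then show "s * (1 - s) / 2 * d\<^sup>2 \<le> d\<^sup>2" by simp
  qed (use s1 in auto)
  have d3: "d \<le> 4 * d ^ 3" "d\<^sup>2 \<le> 2 * d ^ 3" "1 \<le> 8 * d ^ 3"
    using dd by (simp_all add: power2_eq_square power3_eq_cube)
  have "u powr s \<ge> 0" by simp
  then show ?thesis
    using up sd sd2 d3 unfolding d2 d_def[symmetric] abs_le_iff by linarith
qed

lemma exp_minus_linear_le:
  fixes y :: real
  shows "\<bar>exp y - 1 - y\<bar> \<le> y\<^sup>2 / 2 * exp \<bar>y\<bar>"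
proof -
  obtain t where t: "\<bar>t\<bar> \<le> \<bar>y\<bar>" "exp y = (\<Sum>m<2. y ^ m / fact m) + exp t / fact 2 * y ^ 2"
    using Maclaurin_exp_le by blast
  have "exp y - 1 - y = y\<^sup>2 / 2 * exp t"
    using t(2) by (simp add: numeral_2_eq_2 field_simps)
  moreover have "y\<^sup>2 / 2 * exp t \<le> y\<^sup>2 / 2 * exp \<bar>y\<bar>"
    using t(1) by (intro mult_left_mono) auto
  moreover have "0 \<le> y\<^sup>2 / 2 * exp t" by simp
  ultimately show ?thesis by linarith
qed

text \<open>The bound is uniform in the coefficients, so that at a fixed Gaussian point averages
  over feature vectors are integrals of bounded functions. The factor \<open>1 + A\<close> dominates
  \<open>|c i|\<close> without a square root.\<close>

lemma wick_le_exp: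
  assumes fin: "finite K" and bound: "(\<Sum>i\<in>K. (c i)\<^sup>2) \<le> A" and A0: "0 \<le> A"
  shows "wick K (\<lambda>i. h * c i) g \<le> exp (\<bar>h\<bar> * (1 + A) * (\<Sum>i\<in>K. \<bar>g i\<bar>))"
proof -
  have ci: "\<bar>c i\<bar> \<le> 1 + A" if "i \<in> K" for i
  proof -
    have "(c i)\<^sup>2 \<le> (\<Sum>i\<in>K. (c i)\<^sup>2)" using that fin by (intro member_le_sum) auto
    then have "\<bar>c i\<bar>\<^sup>2 \<le> A" using bound by simp
    moreover have "0 \<le> (\<bar>c i\<bar> - 1)\<^sup>2" by simp
    ultimately show ?thesis using A0 by (simp add: power2_eq_square algebra_simps)
  qed
  have "(\<Sum>i\<in>K. h * c i * g i) \<le> (\<Sum>i\<in>K. \<bar>h\<bar> * (1 + A) * \<bar>g i\<bar>)"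
  proof (rule sum_mono)
    fix i assume "i \<in> K"
    have "h * c i * g i \<le> \<bar>h\<bar> * \<bar>c i\<bar> * \<bar>g i\<bar>"
      by (metis abs_ge_self abs_mult)
    also have "\<dots> \<le> \<bar>h\<bar> * (1 + A) * \<bar>g i\<bar>"
      using ci[OF \<open>i \<in> K\<close>] by (intro mult_right_mono mult_left_mono) auto
    finally show "h * c i * g i \<le> \<bar>h\<bar> * (1 + A) * \<bar>g i\<bar>" .
  qed
  then show ?thesis
    unfolding wick_def using sum_nonneg[of K "\<lambda>i. (h * c i)\<^sup>2"] by (simp add: sum_distrib_left)
qed

text \<open>A probability measure on spikes \<open>x\<close> with feature vectors
  \<open>a x\<close>. The Gaussian field \<open>\<Sum>i. a x i * g i\<close> has covariance
  \<open>ker\<close>, and to the order that matters the effect of switching it on at small strength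
  \<open>h\<close> depends only on that kernel.\<close>

locale gaussian_tilt = prob_space M for M :: "'x measure" +
  fixes I :: "'i set" and a :: "'x \<Rightarrow> 'i \<Rightarrow> real" and A :: real
  assumes fin: "finite I" and meas: "\<And>i. i \<in> I \<Longrightarrow> (\<lambda>x. a x i) \<in> borel_measurable M"
    and bound: "\<And>x. x \<in> space M \<Longrightarrow> (\<Sum>i\<in>I. (a x i)\<^sup>2) \<le> A" and A0: "0 \<le> A"
begin

definition ker :: "'x \<times> 'x \<Rightarrow> real" where
  "ker p = (\<Sum>i\<in>I. a (fst p) i * a (snd p) i)"

definition U :: "real \<Rightarrow> ('i \<Rightarrow> real) \<Rightarrow> real" where
  "U h g = (\<integral>x. wick I (\<lambda>i. h * a x i) g \<partial>M)"

sublocale MM: pair_prob_space M M ..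
sublocale G: prob_space "Gauss I" by (rule prob_space_Gauss)
sublocale MG: pair_sigma_finite M "Gauss I" ..

lemma meas1 [measurable]: "f \<in> measurable N M \<Longrightarrow> i \<in> I \<Longrightarrow> (\<lambda>p. a (f p) i) \<in> borel_measurable N"
  by (rule measurable_compose[OF _ meas])

lemma meas_wick [measurable]:
  assumes [measurable]: "f \<in> measurable N M" "g \<in> measurable N (Gauss I)"
  shows "(\<lambda>p. wick I (\<lambda>i. h * a (f p) i) (g p)) \<in> borel_measurable N"
  unfolding wick_def using measurable_Gauss_component[OF assms(2)] by measurable

lemma ker_measurable [measurable]: "ker \<in> borel_measurable (M \<Otimes>\<^sub>M M)"
  unfolding ker_def by measurable

lemma ker_bound:
  assumes "p \<in> space (M \<Otimes>\<^sub>M M)"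
  shows "\<bar>ker p\<bar> \<le> A"
proof -
  have "\<bar>ker p\<bar> \<le> (\<Sum>i\<in>I. \<bar>a (fst p) i * a (snd p) i\<bar>)"
    unfolding ker_def by (rule sum_abs)
  also have "\<dots> \<le> (\<Sum>i\<in>I. ((a (fst p) i)\<^sup>2 + (a (snd p) i)\<^sup>2) / 2)"
  proof (rule sum_mono)
    fix i
    have "0 \<le> (\<bar>a (fst p) i\<bar> - \<bar>a (snd p) i\<bar>)\<^sup>2" by simp
    then show "\<bar>a (fst p) i * a (snd p) i\<bar> \<le> ((a (fst p) i)\<^sup>2 + (a (snd p) i)\<^sup>2) / 2"
      by (simp add: power2_diff abs_mult)
  qed
  also have "\<dots> = ((\<Sum>i\<in>I. (a (fst p) i)\<^sup>2) + (\<Sum>i\<in>I. (a (snd p) i)\<^sup>2)) / 2"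
    by (simp add: sum.distrib sum_divide_distrib add_divide_distrib)
  also have "\<dots> \<le> A"
    using bound[of "fst p"] bound[of "snd p"] assms by (simp add: space_pair_measure mem_Times_iff)
  finally show ?thesis .
qed

lemma wick_le:
  "x \<in> space M \<Longrightarrow> wick I (\<lambda>i. h * a x i) g \<le> exp (\<bar>h\<bar> * (1 + A) * (\<Sum>i\<in>I. \<bar>g i\<bar>))"
  by (rule wick_le_exp[OF fin bound A0])

lemma integrable_wick:
  assumes "g \<in> space (Gauss I)"
  shows "integrable M (\<lambda>x. wick I (\<lambda>i. h * a x i) g)"
proof (rule integrable_const_bound)
  show "AE x in M. norm (wick I (\<lambda>i. h * a x i) g) \<le> exp (\<bar>h\<bar> * (1 + A) * (\<Sum>i\<in>I. \<bar>g i\<bar>))"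
    using wick_le by auto
  show "(\<lambda>x. wick I (\<lambda>i. h * a x i) g) \<in> borel_measurable M"
    using assms by measurable
qed

lemma U_eq_nn: "g \<in> space (Gauss I) \<Longrightarrow> ennreal (U h g) = (\<integral>\<^sup>+x. ennreal (wick I (\<lambda>i. h * a x i) g) \<partial>M)"
  unfolding U_def by (rule nn_integral_eq_integral[symmetric]) (auto intro: integrable_wick)

lemma U_nonneg [simp]: "0 \<le> U h g"
  unfolding U_def by (intro integral_nonneg_AE) auto

lemma U_measurable [measurable]: "U h \<in> borel_measurable (Gauss I)"
  unfolding U_def by measurable

lemma nn_integral_U: "(\<integral>\<^sup>+g. ennreal (U h g) \<partial>Gauss I) = 1"
proof -
  have "(\<integral>\<^sup>+g. ennreal (U h g) \<partial>Gauss I) = (\<integral>\<^sup>+g. (\<integral>\<^sup>+x. ennreal (wick I (\<lambda>i. h * a x i) g) \<partial>M) \<partial>Gauss I)"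
    by (intro nn_integral_cong U_eq_nn)
  also have "\<dots> = (\<integral>\<^sup>+x. (\<integral>\<^sup>+g. ennreal (wick I (\<lambda>i. h * a x i) g) \<partial>Gauss I) \<partial>M)"
    by (rule MG.Fubini') measurable
  finally show ?thesis by (simp add: nn_integral_wick fin emeasure_space_1)
qed

text \<open>Two replicas: the square of an average is an average over pairs, and the product of two
  Wick exponentials is a Wick exponential times \<open>exp\<close> of the inner product of their
  coefficients.\<close>

lemma nn_integral_U_square:
  "(\<integral>\<^sup>+g. ennreal ((U h g)\<^sup>2) \<partial>Gauss I) = (\<integral>\<^sup>+p. ennreal (exp (h\<^sup>2 * ker p)) \<partial>(M \<Otimes>\<^sub>M M))"
proof -
  interpret MMG: pair_sigma_finite "M \<Otimes>\<^sub>M M" "Gauss I" ..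
  have "(\<integral>\<^sup>+g. ennreal ((U h g)\<^sup>2) \<partial>Gauss I)
     = (\<integral>\<^sup>+g. (\<integral>\<^sup>+p. ennreal (wick I (\<lambda>i. h * a (fst p) i) g * wick I (\<lambda>i. h * a (snd p) i) g) \<partial>(M \<Otimes>\<^sub>M M)) \<partial>Gauss I)"
  proof (rule nn_integral_cong)
    fix g assume g[measurable]: "g \<in> space (Gauss I)"
    have "ennreal ((U h g)\<^sup>2) = (\<integral>\<^sup>+x. ennreal (wick I (\<lambda>i. h * a x i) g) \<partial>M) * (\<integral>\<^sup>+y. ennreal (wick I (\<lambda>i. h * a y i) g) \<partial>M)"
      using U_eq_nn[OF g, symmetric] by (simp add: power2_eq_square ennreal_mult)
    also have "\<dots> = (\<integral>\<^sup>+x. (\<integral>\<^sup>+y. ennreal (wick I (\<lambda>i. h * a x i) g * wick I (\<lambda>i. h * a y i) g) \<partial>M) \<partial>M)"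
      by (simp add: nn_integral_cmult nn_integral_multc ennreal_mult)
    also have "\<dots> = (\<integral>\<^sup>+p. ennreal (wick I (\<lambda>i. h * a (fst p) i) g * wick I (\<lambda>i. h * a (snd p) i) g) \<partial>(M \<Otimes>\<^sub>M M))"
      by (subst nn_integral_fst[symmetric]) simp_all
    finally show "ennreal ((U h g)\<^sup>2) = \<dots>" .
  qed
  also have "\<dots> = (\<integral>\<^sup>+p. (\<integral>\<^sup>+g. ennreal (wick I (\<lambda>i. h * a (fst p) i) g * wick I (\<lambda>i. h * a (snd p) i) g) \<partial>Gauss I) \<partial>(M \<Otimes>\<^sub>M M))"
    by (rule MMG.Fubini') measurable
  also have "\<dots> = (\<integral>\<^sup>+p. ennreal (exp (h\<^sup>2 * ker p)) \<partial>(M \<Otimes>\<^sub>M M))"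
  proof (rule nn_integral_cong)
    fix p
    have e: "wick I (\<lambda>i. h * a (fst p) i) g * wick I (\<lambda>i. h * a (snd p) i) g
       = exp (h\<^sup>2 * ker p) * wick I (\<lambda>i. h * a (fst p) i + h * a (snd p) i) g" for g
      unfolding wick_def ker_def exp_add[symmetric]
      by (rule arg_cong[where f = exp])
         (simp add: algebra_simps sum.distrib sum_distrib_left power2_eq_square add_divide_distrib)
    show "(\<integral>\<^sup>+g. ennreal (wick I (\<lambda>i. h * a (fst p) i) g * wick I (\<lambda>i. h * a (snd p) i) g) \<partial>Gauss I) = ennreal (exp (h\<^sup>2 * ker p))"
      unfolding e using nn_integral_wick[OF fin] by (simp add: ennreal_mult nn_integral_cmult)
  qed
  finally show ?thesis .
qed

text \<open>Powers of a Wick exponential are Wick exponentials up to the factor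
  \<open>exp ((k^2 - k) v / 2)\<close>, so the centred fourth moment is
  \<open>exp (6 v) - 4 exp (3 v) + 6 exp v - 3\<close>. The terms of order zero and one in
  \<open>v\<close> cancel, leaving \<open>O(v^2) = O(h^4)\<close>; the remainders \<open>18\<close>
  and \<open>3\<close> make \<open>21\<close>.\<close>

lemma nn_integral_wick_fourth:
  assumes x: "x \<in> space M" and h: "0 < h" "h \<le> 1"
  shows "(\<integral>\<^sup>+g. ennreal ((wick I (\<lambda>i. h * a x i) g - 1) ^ 4) \<partial>Gauss I)
    \<le> ennreal (21 * exp (6 * A) * A\<^sup>2 * h ^ 4)"
proof -
  define v where "v = (\<Sum>i\<in>I. (h * a x i)\<^sup>2)"
  have v_eq: "v = h\<^sup>2 * (\<Sum>i\<in>I. (a x i)\<^sup>2)"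
    unfolding v_def by (simp add: power_mult_distrib sum_distrib_left)
  have v0: "0 \<le> v" unfolding v_def by (intro sum_nonneg) auto
  have vA: "v \<le> h\<^sup>2 * A"
    unfolding v_eq using bound[OF x] by (intro mult_left_mono) auto
  have "h\<^sup>2 * A \<le> 1 * A" using h A0 by (intro mult_right_mono) (auto simp: power_le_one)
  with vA have vA1: "v \<le> A" by simp
  have pw: "wick I (\<lambda>i. h * a x i) g ^ k = exp (real (k * k - k) / 2 * v) * wick I (\<lambda>i. real k * (h * a x i)) g" for k g
  proof -
    have "real (k * k - k) = real k * real k - real k"
      by (cases k) (auto simp: of_nat_diff algebra_simps)
    then show ?thesis
      unfolding wick_def exp_of_nat_mult[symmetric] exp_add[symmetric] v_def
      by (intro arg_cong[where f = exp])
         (simp add: algebra_simps sum_distrib_left sum_divide_distrib power2_eq_square diff_divide_distrib)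
  qed
  have int: "integrable (Gauss I) (\<lambda>g. wick I c g)" and intv: "(\<integral>g. wick I c g \<partial>Gauss I) = 1" for c
  proof -
    show "integrable (Gauss I) (\<lambda>g. wick I c g)"
      using nn_integral_wick[OF fin, of c] by (intro integrableI_nonneg) auto
    show "(\<integral>g. wick I c g \<partial>Gauss I) = 1"
      using nn_integral_wick[OF fin, of c] by (subst integral_eq_nn_integral) auto
  qed
  have expand: "(wick I (\<lambda>i. h * a x i) g - 1) ^ 4 =
      exp (6 * v) * wick I (\<lambda>i. 4 * (h * a x i)) g - 4 * (exp (3 * v) * wick I (\<lambda>i. 3 * (h * a x i)) g)
      + 6 * (exp v * wick I (\<lambda>i. 2 * (h * a x i)) g) - 4 * wick I (\<lambda>i. h * a x i) g + 1" for g
  proof -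
    have "(u - 1) ^ 4 = u ^ 4 - 4 * u ^ 3 + 6 * u ^ 2 - 4 * u + 1" for u :: real
      by (simp add: power4_eq_xxxx power3_eq_cube power2_eq_square algebra_simps)
    then show ?thesis by (simp add: pw[of g 4] pw[of g 3] pw[of g 2])
  qed
  have "(\<integral>\<^sup>+g. ennreal ((wick I (\<lambda>i. h * a x i) g - 1) ^ 4) \<partial>Gauss I)
      = ennreal (\<integral>g. (wick I (\<lambda>i. h * a x i) g - 1) ^ 4 \<partial>Gauss I)"
  proof (rule nn_integral_eq_integral)
    show "integrable (Gauss I) (\<lambda>g. (wick I (\<lambda>i. h * a x i) g - 1) ^ 4)"
      unfolding expand by (auto simp: int)
  qed simp
  also have "\<dots> \<le> ennreal (21 * exp (6 * A) * A\<^sup>2 * h ^ 4)"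
  proof (rule ennreal_leI)
    have "(\<integral>g. (wick I (\<lambda>i. h * a x i) g - 1) ^ 4 \<partial>Gauss I) = exp (6 * v) - 4 * exp (3 * v) + 6 * exp v - 3"
      unfolding expand by (simp add: int intv G.prob_space)
    also have "\<dots> \<le> 21 * exp (6 * A) * v\<^sup>2"
    proof -
      have up: "exp (k * v) \<le> 1 + k * v + (k * v)\<^sup>2 / 2 * exp (6 * A)" if "0 \<le> k" "k \<le> 6" for k
      proof -
        have "exp \<bar>k * v\<bar> \<le> exp (6 * A)"
          using that v0 vA1 by (simp add: abs_mult) (intro mult_mono, auto)
        then have "(k * v)\<^sup>2 / 2 * exp \<bar>k * v\<bar> \<le> (k * v)\<^sup>2 / 2 * exp (6 * A)"
          by (intro mult_left_mono) auto
        with exp_minus_linear_le[of "k * v"] show ?thesis by linarith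
      qed
      have "1 + 3 * v \<le> exp (3 * v)" by simp
      moreover have "exp (6 * v) \<le> 1 + 6 * v + 18 * (exp (6 * A) * v\<^sup>2)"
        using up[of 6] by (simp add: power_mult_distrib mult_ac)
      moreover have "exp v \<le> 1 + v + exp (6 * A) * v\<^sup>2 / 2"
        using up[of 1] by (simp add: mult_ac)
      ultimately show ?thesis by linarith
    qed
    also have "\<dots> \<le> 21 * exp (6 * A) * (h\<^sup>2 * A)\<^sup>2"
      using vA v0 by (intro mult_left_mono power_mono) auto
    also have "\<dots> = 21 * exp (6 * A) * A\<^sup>2 * h ^ 4"
      by (simp add: power_mult_distrib)
    finally show "(\<integral>g. (wick I (\<lambda>i. h * a x i) g - 1) ^ 4 \<partial>Gauss I) \<le> 21 * exp (6 * A) * A\<^sup>2 * h ^ 4" .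
  qed
  finally show ?thesis .
qed

lemma nn_integral_U_fourth:
  assumes h: "0 < h" "h \<le> 1"
  shows "(\<integral>\<^sup>+g. ennreal ((U h g - 1) ^ 4) \<partial>Gauss I) \<le> ennreal (21 * exp (6 * A) * A\<^sup>2 * h ^ 4)"
proof -
  have "(\<integral>\<^sup>+g. ennreal ((U h g - 1) ^ 4) \<partial>Gauss I)
     \<le> (\<integral>\<^sup>+g. (\<integral>\<^sup>+x. ennreal ((wick I (\<lambda>i. h * a x i) g - 1) ^ 4) \<partial>M) \<partial>Gauss I)"
  proof (rule nn_integral_mono)
    fix g assume g[measurable]: "g \<in> space (Gauss I)"
    have i4: "integrable M (\<lambda>x. (wick I (\<lambda>i. h * a x i) g - 1) ^ 4)"
    proof (rule integrable_const_bound)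
      show "AE x in M. norm ((wick I (\<lambda>i. h * a x i) g - 1) ^ 4) \<le> (exp (\<bar>h\<bar> * (1 + A) * (\<Sum>i\<in>I. \<bar>g i\<bar>)) + 1) ^ 4"
      proof (rule AE_I2)
        fix x assume "x \<in> space M"
        from wick_le[OF this, of h g] have "\<bar>wick I (\<lambda>i. h * a x i) g - 1\<bar> \<le> exp (\<bar>h\<bar> * (1 + A) * (\<Sum>i\<in>I. \<bar>g i\<bar>)) + 1"
          using wick_pos(2)[of I "\<lambda>i. h * a x i" g] by linarith
        then show "norm ((wick I (\<lambda>i. h * a x i) g - 1) ^ 4) \<le> (exp (\<bar>h\<bar> * (1 + A) * (\<Sum>i\<in>I. \<bar>g i\<bar>)) + 1) ^ 4"
          unfolding norm_power by (intro power_mono) (simp_all only: real_norm_def abs_ge_zero)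
      qed
    qed measurable
    have i1: "integrable M (\<lambda>x. wick I (\<lambda>i. h * a x i) g - 1)"
      using integrable_wick[OF g] by simp
    have "(U h g - 1) ^ 4 = (expectation (\<lambda>x. wick I (\<lambda>i. h * a x i) g - 1)) ^ 4"
      unfolding U_def using integrable_wick[OF g] by (simp add: prob_space)
    also have "\<dots> \<le> expectation (\<lambda>x. (wick I (\<lambda>i. h * a x i) g - 1) ^ 4)"
      by (rule jensens_inequality[where q = "\<lambda>x. x ^ 4" and I = UNIV]) (use i1 i4 in \<open>auto intro: convex_power_even\<close>)
    finally have "ennreal ((U h g - 1) ^ 4) \<le> ennreal (expectation (\<lambda>x. (wick I (\<lambda>i. h * a x i) g - 1) ^ 4))"
      by (rule ennreal_leI)
    also have "\<dots> = (\<integral>\<^sup>+x. ennreal ((wick I (\<lambda>i. h * a x i) g - 1) ^ 4) \<partial>M)"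
      by (rule nn_integral_eq_integral[symmetric]) (use i4 in auto)
    finally show "ennreal ((U h g - 1) ^ 4) \<le> \<dots>" .
  qed
  also have "\<dots> = (\<integral>\<^sup>+x. (\<integral>\<^sup>+g. ennreal ((wick I (\<lambda>i. h * a x i) g - 1) ^ 4) \<partial>Gauss I) \<partial>M)"
    by (rule MG.Fubini') measurable
  also have "\<dots> \<le> (\<integral>\<^sup>+x. ennreal (21 * exp (6 * A) * A\<^sup>2 * h ^ 4) \<partial>M)"
    by (intro nn_integral_mono nn_integral_wick_fourth h)
  also have "\<dots> = ennreal (21 * exp (6 * A) * A\<^sup>2 * h ^ 4)"
    by (simp add: emeasure_space_1)
  finally show ?thesis .
qed

definition kbar :: real where "kbar = (\<integral>p. ker p \<partial>(M \<Otimes>\<^sub>M M))"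

lemma integrable_ker: "integrable (M \<Otimes>\<^sub>M M) ker"
  by (rule MM.integrable_const_bound[where B = A]) (auto simp: ker_bound)

lemma abs_kbar_le: "\<bar>kbar\<bar> \<le> A"
proof -
  have "\<bar>kbar\<bar> \<le> (\<integral>p. \<bar>ker p\<bar> \<partial>(M \<Otimes>\<^sub>M M))"
    unfolding kbar_def by (rule integral_abs_bound)
  also have "\<dots> \<le> (\<integral>p. A \<partial>(M \<Otimes>\<^sub>M M))"
    by (intro integral_mono integrable_abs integrable_ker MM.integrable_const ker_bound) auto
  finally show ?thesis by (simp add: MM.prob_space)
qed

lemma expectation_U:
  "integrable (Gauss I) (U h)" "(\<integral>g. U h g \<partial>Gauss I) = 1"
proof -
  show "integrable (Gauss I) (U h)"
    using nn_integral_U[of h] by (intro integrableI_nonneg) auto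
  show "(\<integral>g. U h g \<partial>Gauss I) = 1"
    using nn_integral_U[of h] by (subst integral_eq_nn_integral) auto
qed

text \<open>By the replica formula the second moment is the mean of
  \<open>exp (h^2 * ker p)\<close>. Its linear term is the averaged kernel, and the rest is of order
  \<open>h^4\<close> because the kernel is bounded.\<close>

lemma expectation_U_square:
  assumes h: "0 < h" "h \<le> 1"
  shows "integrable (Gauss I) (\<lambda>g. (U h g)\<^sup>2)"
    and "\<bar>(\<integral>g. (U h g - 1)\<^sup>2 \<partial>Gauss I) - h\<^sup>2 * kbar\<bar> \<le> h ^ 4 * A\<^sup>2 * exp A"
proof -
  have kA: "\<bar>h\<^sup>2 * ker p\<bar> \<le> h\<^sup>2 * A" if "p \<in> space (M \<Otimes>\<^sub>M M)" for p
    using ker_bound[OF that] by (auto simp: abs_mult intro!: mult_left_mono)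
  have h2A: "h\<^sup>2 * A \<le> A" using h A0 by (simp add: mult_left_le_one_le power_le_one)
  have ie: "integrable (M \<Otimes>\<^sub>M M) (\<lambda>p. exp (h\<^sup>2 * ker p))"
    by (rule MM.integrable_const_bound[where B = "exp A"]) (use kA h2A in \<open>fastforce intro!: AE_I2\<close>)+
  have nn: "(\<integral>\<^sup>+g. ennreal ((U h g)\<^sup>2) \<partial>Gauss I) = ennreal (\<integral>p. exp (h\<^sup>2 * ker p) \<partial>(M \<Otimes>\<^sub>M M))"
    unfolding nn_integral_U_square by (rule nn_integral_eq_integral) (use ie in auto)
  show iU2: "integrable (Gauss I) (\<lambda>g. (U h g)\<^sup>2)"
    by (intro integrableI_nonneg) (auto simp: nn)
  have EU2: "(\<integral>g. (U h g)\<^sup>2 \<partial>Gauss I) = (\<integral>p. exp (h\<^sup>2 * ker p) \<partial>(M \<Otimes>\<^sub>M M))"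
    by (subst integral_eq_nn_integral) (auto simp: nn)
  have "(\<integral>g. (U h g - 1)\<^sup>2 \<partial>Gauss I) = (\<integral>g. (U h g)\<^sup>2 - 2 * U h g + 1 \<partial>Gauss I)"
    by (simp add: power2_diff algebra_simps)
  also have "\<dots> = (\<integral>p. exp (h\<^sup>2 * ker p) \<partial>(M \<Otimes>\<^sub>M M)) - 1"
    using iU2 expectation_U[of h] by (simp add: EU2 G.prob_space)
  finally have "(\<integral>g. (U h g - 1)\<^sup>2 \<partial>Gauss I) - h\<^sup>2 * kbar
     = (\<integral>p. exp (h\<^sup>2 * ker p) - 1 - h\<^sup>2 * ker p \<partial>(M \<Otimes>\<^sub>M M))"
    unfolding kbar_def using ie integrable_ker by (simp add: MM.prob_space)
  also have "\<bar>\<dots>\<bar> \<le> (\<integral>p. \<bar>exp (h\<^sup>2 * ker p) - 1 - h\<^sup>2 * ker p\<bar> \<partial>(M \<Otimes>\<^sub>M M))"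
    by (rule integral_abs_bound)
  also have "\<dots> \<le> (\<integral>p. h ^ 4 * A\<^sup>2 * exp A \<partial>(M \<Otimes>\<^sub>M M))"
  proof (intro integral_mono integrable_abs MM.integrable_const)
    show "integrable (M \<Otimes>\<^sub>M M) (\<lambda>p. exp (h\<^sup>2 * ker p) - 1 - h\<^sup>2 * ker p)"
      using ie integrable_ker by auto
    fix p assume p: "p \<in> space (M \<Otimes>\<^sub>M M)"
    have "\<bar>exp (h\<^sup>2 * ker p) - 1 - h\<^sup>2 * ker p\<bar> \<le> (h\<^sup>2 * ker p)\<^sup>2 / 2 * exp \<bar>h\<^sup>2 * ker p\<bar>"
      by (rule exp_minus_linear_le)
    also have "\<dots> \<le> (h\<^sup>2 * A)\<^sup>2 * exp A"
    proof (intro mult_mono)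
      have "\<bar>h\<^sup>2 * ker p\<bar>\<^sup>2 \<le> (h\<^sup>2 * A)\<^sup>2" by (intro power_mono kA p) auto
      then show "(h\<^sup>2 * ker p)\<^sup>2 / 2 \<le> (h\<^sup>2 * A)\<^sup>2" using zero_le_power2[of "h\<^sup>2 * ker p"] unfolding power2_abs by linarith
    qed (use kA[OF p] h2A in auto)
    finally show "\<bar>exp (h\<^sup>2 * ker p) - 1 - h\<^sup>2 * ker p\<bar> \<le> h ^ 4 * A\<^sup>2 * exp A"
      by (simp add: power_mult_distrib)
  qed
  finally show "\<bar>(\<integral>g. (U h g - 1)\<^sup>2 \<partial>Gauss I) - h\<^sup>2 * kbar\<bar> \<le> h ^ 4 * A\<^sup>2 * exp A"
    by (simp add: MM.prob_space)
qed

end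

text \<open>Collects the errors of one expansion: the first summand is the cubic Taylor remainder,
  bounded through second and fourth moments, the last one the error in the variance of
  \<open>U\<close>.\<close>

definition step_const :: "real \<Rightarrow> real" where
  "step_const A = 8 * (A + A\<^sup>2 * exp A + 21 * exp (6 * A) * A\<^sup>2) + A\<^sup>2 * exp A"

lemma step_const_nonneg: "0 \<le> A \<Longrightarrow> 0 \<le> step_const A"
  unfolding step_const_def by (intro add_nonneg_nonneg mult_nonneg_nonneg) auto

text \<open>\<open>u powr s\<close> is expanded to second order at \<open>u = 1\<close>, the mean of
  \<open>U\<close>. The absolute third moment in the remainder is interpolated by
  \<open>2 d^3 <= h d^2 + d^4 / h\<close>, after which the second and the fourth moment both enter
  at order \<open>h^3\<close>.\<close>

lemma (in gaussian_tilt) expectation_U_powr: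
  assumes h: "0 < h" "h \<le> 1" and s: "0 < s" "s < 1"
  shows "integrable (Gauss I) (\<lambda>g. U h g powr s)"
    and "\<bar>(\<integral>g. U h g powr s \<partial>Gauss I) - (1 - s * (1 - s) / 2 * h\<^sup>2 * kbar)\<bar> \<le> step_const A * h ^ 3"
proof -
  define c where "c = s * (1 - s) / 2"
  have c: "0 \<le> c" "c \<le> 1"
  proof -
    have "s * (1 - s) \<le> 1 * 1" using s by (intro mult_mono) auto
    then show "0 \<le> c" "c \<le> 1" unfolding c_def using s by auto
  qed
  define V where "V = (\<integral>g. (U h g - 1)\<^sup>2 \<partial>Gauss I)"
  define W where "W = (\<integral>g. (U h g - 1) ^ 4 \<partial>Gauss I)"
  have i1: "integrable (Gauss I) (\<lambda>g. U h g - 1)" using expectation_U by auto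
  have i2: "integrable (Gauss I) (\<lambda>g. (U h g - 1)\<^sup>2)"
    unfolding power2_diff using expectation_U expectation_U_square[OF h] by auto
  have i4: "integrable (Gauss I) (\<lambda>g. (U h g - 1) ^ 4)"
    using nn_integral_U_fourth[OF h] by (intro integrableI_nonneg) (auto simp: top_unique intro: le_less_trans)
  have W: "W \<le> 21 * exp (6 * A) * A\<^sup>2 * h ^ 4"
  proof -
    have "ennreal W = (\<integral>\<^sup>+g. ennreal ((U h g - 1) ^ 4) \<partial>Gauss I)"
      unfolding W_def by (rule nn_integral_eq_integral[symmetric]) (use i4 in auto)
    then have "ennreal W \<le> ennreal (21 * exp (6 * A) * A\<^sup>2 * h ^ 4)"
      using nn_integral_U_fourth[OF h] by simp
    then show ?thesis using h by (subst (asm) ennreal_le_iff) auto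
  qed
  show ip: "integrable (Gauss I) (\<lambda>g. U h g powr s)"
  proof (rule Bochner_Integration.integrable_bound)
    show "integrable (Gauss I) (\<lambda>g. 1 + U h g)" using expectation_U by auto
    show "AE g in Gauss I. norm (U h g powr s) \<le> norm (1 + U h g)"
    proof (rule AE_I2)
      fix g
      show "norm (U h g powr s) \<le> norm (1 + U h g)"
      proof (cases "U h g \<le> 1")
        case True
        then have "U h g powr s \<le> 1 powr s" using s by (intro powr_mono2) auto
        then have "U h g powr s \<le> 1" by simp
        then show ?thesis using U_nonneg[of h g] powr_ge_zero[of "U h g" s] unfolding real_norm_def by linarith
      next
        case False
        then have "U h g powr s \<le> U h g powr 1" using s by (intro powr_mono) auto
        then show ?thesis by simp
      qed
    qed
  qed measurable
  let ?D = "\<lambda>g. U h g powr s - (1 + s * (U h g - 1) - c * (U h g - 1)\<^sup>2)"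
  have "\<bar>(\<integral>g. U h g powr s \<partial>Gauss I) - (1 - c * V)\<bar> = \<bar>\<integral>g. ?D g \<partial>Gauss I\<bar>"
    unfolding V_def using ip i1 i2 expectation_U by (simp add: G.prob_space)
  also have "\<dots> \<le> (\<integral>g. \<bar>?D g\<bar> \<partial>Gauss I)" by (rule integral_abs_bound)
  also have "\<dots> \<le> (\<integral>g. 8 * (h * (U h g - 1)\<^sup>2 + (U h g - 1) ^ 4 / h) \<partial>Gauss I)"
  proof (rule integral_mono)
    show "integrable (Gauss I) (\<lambda>g. \<bar>?D g\<bar>)" using ip i1 i2 by auto
    show "integrable (Gauss I) (\<lambda>g. 8 * (h * (U h g - 1)\<^sup>2 + (U h g - 1) ^ 4 / h))" using i2 i4 by auto
    fix g
    have "\<bar>?D g\<bar> \<le> 16 * \<bar>U h g - 1\<bar> ^ 3"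
      unfolding c_def by (rule powr_second_order) (use s in auto)
    also have "\<dots> \<le> 8 * (h * (U h g - 1)\<^sup>2 + (U h g - 1) ^ 4 / h)"
    proof -
      define d where "d = \<bar>U h g - 1\<bar>"
      have "0 \<le> d\<^sup>2 * (h - d)\<^sup>2 / h" using h by auto
      also have "d\<^sup>2 * (h - d)\<^sup>2 / h = h * d\<^sup>2 + d ^ 4 / h - 2 * d ^ 3"
        using h by (simp add: power2_eq_square power3_eq_cube power4_eq_xxxx field_simps)
      finally have "2 * d ^ 3 \<le> h * d\<^sup>2 + d ^ 4 / h" by simp
      moreover have "d\<^sup>2 = (U h g - 1)\<^sup>2" "d ^ 4 = (U h g - 1) ^ 4" unfolding d_def by auto
      ultimately show ?thesis unfolding d_def[symmetric] by simp
    qed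
    finally show "\<bar>?D g\<bar> \<le> 8 * (h * (U h g - 1)\<^sup>2 + (U h g - 1) ^ 4 / h)" .
  qed
  also have "\<dots> = 8 * (h * V + W / h)"
    unfolding V_def W_def using i2 i4 by simp
  finally have main: "\<bar>(\<integral>g. U h g powr s \<partial>Gauss I) - (1 - c * V)\<bar> \<le> 8 * (h * V + W / h)" .
  have h43: "h ^ 4 \<le> h ^ 3" using h by (intro power_decreasing) auto
  have h42: "h ^ 4 \<le> h ^ 2" using h by (intro power_decreasing) auto
  have Vk: "\<bar>V - h\<^sup>2 * kbar\<bar> \<le> h ^ 4 * (A\<^sup>2 * exp A)"
    using expectation_U_square(2)[OF h] unfolding V_def by (simp add: mult_ac)
  have V: "h * V \<le> h ^ 3 * (A + A\<^sup>2 * exp A)"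
  proof -
    have "h\<^sup>2 * kbar \<le> h\<^sup>2 * A" using abs_kbar_le by (intro mult_left_mono) auto
    moreover have "h ^ 4 * (A\<^sup>2 * exp A) \<le> h\<^sup>2 * (A\<^sup>2 * exp A)" using h42 by (intro mult_right_mono) auto
    ultimately have "V \<le> h\<^sup>2 * (A + A\<^sup>2 * exp A)" using Vk unfolding distrib_left by linarith
    then have "h * V \<le> h * (h\<^sup>2 * (A + A\<^sup>2 * exp A))" using h by (intro mult_left_mono) auto
    then show ?thesis by (simp add: power3_eq_cube power2_eq_square mult_ac)
  qed
  have W': "W / h \<le> h ^ 3 * (21 * exp (6 * A) * A\<^sup>2)"
    using W h by (simp add: divide_le_eq power4_eq_xxxx power3_eq_cube mult_ac)
  have "\<bar>c * V - c * (h\<^sup>2 * kbar)\<bar> \<le> h ^ 3 * (A\<^sup>2 * exp A)"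
  proof -
    have "\<bar>c * V - c * (h\<^sup>2 * kbar)\<bar> = c * \<bar>V - h\<^sup>2 * kbar\<bar>"
      using c by (simp add: right_diff_distrib[symmetric] abs_mult)
    also have "\<dots> \<le> 1 * (h ^ 4 * (A\<^sup>2 * exp A))" using c Vk by (intro mult_mono) auto
    also have "\<dots> \<le> h ^ 3 * (A\<^sup>2 * exp A)" using h43 by (simp add: mult_right_mono)
    finally show ?thesis .
  qed
  then have "\<bar>(\<integral>g. U h g powr s \<partial>Gauss I) - (1 - c * (h\<^sup>2 * kbar))\<bar>
     \<le> 8 * (h ^ 3 * (A + A\<^sup>2 * exp A) + h ^ 3 * (21 * exp (6 * A) * A\<^sup>2)) + h ^ 3 * (A\<^sup>2 * exp A)"
  proof -
    have tri: "\<bar>p - (1 - q)\<bar> \<le> \<bar>p - (1 - r)\<bar> + \<bar>r - q\<bar>" for p q r :: real by linarith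
    have "8 * (h * V + W / h) \<le> 8 * (h ^ 3 * (A + A\<^sup>2 * exp A) + h ^ 3 * (21 * exp (6 * A) * A\<^sup>2))"
      by (intro mult_left_mono add_mono V W') auto
    with main \<open>\<bar>c * V - c * (h\<^sup>2 * kbar)\<bar> \<le> h ^ 3 * (A\<^sup>2 * exp A)\<close>
    show ?thesis
      using tri[of "\<integral>g. U h g powr s \<partial>Gauss I" "c * (h\<^sup>2 * kbar)" "c * V"] by linarith
  qed
  also have "\<dots> = step_const A * h ^ 3"
    unfolding step_const_def by (simp add: algebra_simps)
  finally show "\<bar>(\<integral>g. U h g powr s \<partial>Gauss I) - (1 - s * (1 - s) / 2 * h\<^sup>2 * kbar)\<bar> \<le> step_const A * h ^ 3"
    unfolding c_def by (simp add: mult_ac)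
qed

section \<open>Kahane's comparison inequality for fractional moments\<close>

lemma measurable_wick_pair:
  assumes "\<And>i. i \<in> I \<Longrightarrow> (\<lambda>p. c p i) \<in> borel_measurable N" "g \<in> measurable N (Gauss I)"
  shows "(\<lambda>p. wick I (c p) (g p)) \<in> borel_measurable N"
  unfolding wick_def using assms(1) measurable_Gauss_component[OF assms(2)] by measurable

text \<open>Additivity of variance for Wick exponentials: the exact identity by which a portion
  \<open>q^2\<close> is split off from a total strength \<open>r^2\<close>.\<close>

lemma wick_scaled_split:
  assumes "\<And>i. i \<in> I \<Longrightarrow> r * (\<alpha> * g i + \<beta> * g' i) = p * g i + q * g' i" "r\<^sup>2 = p\<^sup>2 + q\<^sup>2"
  shows "wick I (\<lambda>i. r * c i) (\<lambda>i\<in>I. \<alpha> * g i + \<beta> * g' i) = wick I (\<lambda>i. p * c i) g * wick I (\<lambda>i. q * c i) g'"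
proof -
  have "(\<Sum>i\<in>I. r * c i * (\<lambda>i\<in>I. \<alpha> * g i + \<beta> * g' i) i) = (\<Sum>i\<in>I. p * c i * g i + q * c i * g' i)"
  proof (rule sum.cong[OF refl])
    fix i assume i: "i \<in> I"
    have "r * c i * (\<alpha> * g i + \<beta> * g' i) = c i * (r * (\<alpha> * g i + \<beta> * g' i))" by simp
    also have "\<dots> = p * c i * g i + q * c i * g' i" unfolding assms(1)[OF i] by (simp add: algebra_simps)
    finally show "r * c i * (\<lambda>i\<in>I. \<alpha> * g i + \<beta> * g' i) i = p * c i * g i + q * c i * g' i" using i by simp
  qed
  moreover have "(\<Sum>i\<in>I. (r * c i)\<^sup>2) = (\<Sum>i\<in>I. (p * c i)\<^sup>2) + (\<Sum>i\<in>I. (q * c i)\<^sup>2)"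
    unfolding power_mult_distrib assms(2) by (simp add: distrib_right sum.distrib)
  ultimately show ?thesis
    unfolding wick_def exp_add[symmetric] by (simp add: sum.distrib algebra_simps add_divide_distrib)
qed

text \<open>Since \<open>u powr s\<close> is concave, the family \<open>a\<close>, whose kernel is
  the larger one up to \<open>\<kappa>\<close>, has the smaller fractional moment. Raising its
  kernel by \<open>\<kappa>\<close> amounts to adding a Gaussian of that variance common to all
  \<open>x\<close>, and the \<open>s\<close>-th moment of the Wick exponential of that Gaussian is
  \<open>exp (- s (1 - s) \<kappa> / 2)\<close>; this is where the factor in the conclusion comes
  from.\<close>

locale gaussian_comparison = finite_measure M for M :: "'x measure" +
  fixes I :: "'i set" and J :: "'j set" and a :: "'x \<Rightarrow> 'i \<Rightarrow> real" and b :: "'x \<Rightarrow> 'j \<Rightarrow> real"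
    and A \<kappa> s :: real
  assumes fin: "finite I" "finite J"
    and meas_a: "\<And>i. i \<in> I \<Longrightarrow> (\<lambda>x. a x i) \<in> borel_measurable M"
    and meas_b: "\<And>i. i \<in> J \<Longrightarrow> (\<lambda>x. b x i) \<in> borel_measurable M"
    and bound_a: "\<And>x. x \<in> space M \<Longrightarrow> (\<Sum>i\<in>I. (a x i)\<^sup>2) \<le> A"
    and bound_b: "\<And>x. x \<in> space M \<Longrightarrow> (\<Sum>i\<in>J. (b x i)\<^sup>2) \<le> A"
    and A0: "0 \<le> A" and \<kappa>0: "0 \<le> \<kappa>" and s: "0 < s" "s < 1"
    and kernels: "\<And>x y. x \<in> space M \<Longrightarrow> y \<in> space M \<Longrightarrow>
      (\<Sum>i\<in>J. b x i * b y i) \<le> (\<Sum>i\<in>I. a x i * a y i) + \<kappa>"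
begin

lemma meas_a' [measurable]: "f \<in> measurable N M \<Longrightarrow> i \<in> I \<Longrightarrow> (\<lambda>p. a (f p) i) \<in> borel_measurable N"
  by (rule measurable_compose[OF _ meas_a])

lemma meas_b' [measurable]: "f \<in> measurable N M \<Longrightarrow> i \<in> J \<Longrightarrow> (\<lambda>p. b (f p) i) \<in> borel_measurable N"
  by (rule measurable_compose[OF _ meas_b])

lemma meas_wick_a [measurable]:
  "f \<in> measurable N M \<Longrightarrow> g \<in> measurable N (Gauss I) \<Longrightarrow> (\<lambda>p. wick I (\<lambda>i. h * a (f p) i) (g p)) \<in> borel_measurable N"
  by (intro measurable_wick_pair borel_measurable_times borel_measurable_const meas_a')

lemma meas_wick_b [measurable]:
  "f \<in> measurable N M \<Longrightarrow> g \<in> measurable N (Gauss J) \<Longrightarrow> (\<lambda>p. wick J (\<lambda>i. h * b (f p) i) (g p)) \<in> borel_measurable N"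
  by (intro measurable_wick_pair borel_measurable_times borel_measurable_const meas_b')

text \<open>Relative error of one swap. The first factor is the additive error on a moment close to
  one; the second bounds the reciprocal of that moment, which makes the error multiplicative and so
  fit for iteration.\<close>

definition rate :: "real \<Rightarrow> real" where
  "rate h = (s * (1 - s) / 2 * \<kappa> * h\<^sup>2 + 2 * step_const A * h ^ 3) * (1 + 2 * (A + step_const A) * h\<^sup>2)"

lemma rate_nonneg: "0 \<le> h \<Longrightarrow> 0 \<le> rate h"
  unfolding rate_def using s \<kappa>0 A0 step_const_nonneg[OF A0]
  by (intro mult_nonneg_nonneg add_nonneg_nonneg) auto

text \<open>\<open>w\<close> is the part of the partition function carried by frozen Gaussians.
  Divided by its total mass it turns \<open>M\<close> into a probability measure of which both
  families are small tilts; their expansions then differ, to leading order, only through the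
  averaged kernels.\<close>

lemma tilted_step:
  assumes w: "w \<in> borel_measurable M" "\<And>x. x \<in> space M \<Longrightarrow> 0 < w x" "\<And>x. x \<in> space M \<Longrightarrow> w x \<le> C"
    and h: "0 < h" "h \<le> 1" "2 * (A + step_const A) * h\<^sup>2 \<le> 1"
  shows "(\<integral>\<^sup>+g. ennreal ((\<integral>x. w x * wick I (\<lambda>i. h * a x i) g \<partial>M) powr s) \<partial>Gauss I)
    \<le> ennreal (1 + rate h) * (\<integral>\<^sup>+g. ennreal ((\<integral>x. w x * wick J (\<lambda>i. h * b x i) g \<partial>M) powr s) \<partial>Gauss J)"
proof (cases "emeasure M (space M) = 0")
  \<comment> \<open>A null measure cannot be normalised, but then all partition functions vanish.
    This case occurs, since an overlap window may carry no prior mass.\<close>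
  case True
  then have "M = null_measure M" by (intro measure_eqI) (auto dest: sets.sets_into_space intro: emeasure_eq_0)
  then have "(\<integral>x. f x \<partial>M) = 0" for f :: "'x \<Rightarrow> real"
    by (metis integral_null_measure)
  then show ?thesis by simp
next
  case False
  note [measurable] = w(1)
  define Z where "Z = (\<integral>x. w x \<partial>M)"
  have iw: "integrable M w"
    using w by (intro integrable_const_bound[where B = C]) (auto intro!: AE_I2 simp: less_imp_le abs_of_pos)
  have Z0: "0 < Z"
  proof -
    have "Z \<noteq> 0"
    proof
      assume "Z = 0"
      then have "AE x in M. w x = 0"
        using integral_nonneg_eq_0_iff_AE[OF iw] w(2) unfolding Z_def by (auto intro: AE_I2 less_imp_le)
      then have "AE x in M. False" using AE_space
      proof eventually_elim
        case (elim x)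
        then show ?case using w(2)[of x] by simp
      qed
      then show False using False by (simp add: AE_iff_null null_sets_def)
    qed
    moreover have "0 \<le> Z" unfolding Z_def using w(2) by (intro integral_nonneg_AE) (auto intro: AE_I2 less_imp_le)
    ultimately show ?thesis by simp
  qed
  define \<mu> where "\<mu> = density M (\<lambda>x. ennreal (w x / Z))"
  have sp: "space \<mu> = space M" and sets: "sets \<mu> = sets M" unfolding \<mu>_def by auto
  have p: "prob_space \<mu>"
  proof (rule prob_spaceI)
    have "emeasure \<mu> (space \<mu>) = (\<integral>\<^sup>+x. ennreal (w x / Z) \<partial>M)"
      unfolding \<mu>_def by (subst emeasure_density) (auto intro!: nn_integral_cong)
    also have "\<dots> = ennreal (\<integral>x. w x / Z \<partial>M)"
      using iw w(2) Z0 by (intro nn_integral_eq_integral) (auto intro!: AE_I2 divide_nonneg_pos less_imp_le)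
    also have "\<dots> = 1" using Z0 unfolding Z_def by simp
    finally show "emeasure \<mu> (space \<mu>) = 1" .
  qed
  have meas\<mu>: "borel_measurable \<mu> = (borel_measurable M :: ('x \<Rightarrow> real) set)"
    by (rule measurable_cong_sets[OF sets refl])
  interpret a: gaussian_tilt \<mu> I a A
    by (intro gaussian_tilt.intro gaussian_tilt_axioms.intro p)
       (use fin meas_a bound_a A0 in \<open>auto simp: sp meas\<mu>\<close>)
  interpret b: gaussian_tilt \<mu> J b A
    by (intro gaussian_tilt.intro gaussian_tilt_axioms.intro p)
       (use fin meas_b bound_b A0 in \<open>auto simp: sp meas\<mu>\<close>)
  have inta: "(\<integral>x. w x * wick I (\<lambda>i. h * a x i) g \<partial>M) = Z * a.U h g" if [measurable]: "g \<in> space (Gauss I)" for g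
  proof -
    have "a.U h g = (\<integral>x. w x / Z * wick I (\<lambda>i. h * a x i) g \<partial>M)"
      unfolding a.U_def unfolding \<mu>_def
      by (subst integral_density) (use w(2) Z0 in \<open>auto intro!: AE_I2 divide_nonneg_pos less_imp_le\<close>)
    then show ?thesis using Z0 by (simp add: integral_mult_right_zero)
  qed
  have intb: "(\<integral>x. w x * wick J (\<lambda>i. h * b x i) g \<partial>M) = Z * b.U h g" if [measurable]: "g \<in> space (Gauss J)" for g
  proof -
    have "b.U h g = (\<integral>x. w x / Z * wick J (\<lambda>i. h * b x i) g \<partial>M)"
      unfolding b.U_def unfolding \<mu>_def
      by (subst integral_density) (use w(2) Z0 in \<open>auto intro!: AE_I2 divide_nonneg_pos less_imp_le\<close>)
    then show ?thesis using Z0 by simp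
  qed
  let ?S = "step_const A" and ?c = "s * (1 - s) / 2"
  define ea where "ea = (\<integral>g. a.U h g powr s \<partial>Gauss I)"
  define eb where "eb = (\<integral>g. b.U h g powr s \<partial>Gauss J)"
  have S0: "0 \<le> ?S" by (rule step_const_nonneg[OF A0])
  have c: "0 \<le> ?c" "?c \<le> 1"
  proof -
    have "s * (1 - s) \<le> 1 * 1" using s by (intro mult_mono) auto
    then show "0 \<le> ?c" "?c \<le> 1" using s by auto
  qed
  have kk: "b.kbar \<le> a.kbar + \<kappa>"
  proof -
    have "b.kbar \<le> (\<integral>p. a.ker p + \<kappa> \<partial>(\<mu> \<Otimes>\<^sub>M \<mu>))"
      unfolding b.kbar_def
    proof (intro integral_mono Bochner_Integration.integrable_add b.integrable_ker a.integrable_ker a.MM.integrable_const)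
      fix p assume "p \<in> space (\<mu> \<Otimes>\<^sub>M \<mu>)"
      then show "b.ker p \<le> a.ker p + \<kappa>"
        unfolding a.ker_def b.ker_def by (intro kernels) (auto simp: space_pair_measure sp)
    qed
    then show ?thesis unfolding a.kbar_def using a.integrable_ker by (simp add: a.MM.prob_space)
  qed
  have "ea \<le> (1 + rate h) * eb"
  proof -
    define y where "y = (A + ?S) * h\<^sup>2"
    define \<delta> where "\<delta> = ?c * \<kappa> * h\<^sup>2 + 2 * ?S * h ^ 3"
    have "2 * y = 2 * (A + ?S) * h\<^sup>2" unfolding y_def by (simp only: mult.assoc)
    with h(3) have "2 * y \<le> 1" by simp
    moreover have "0 \<le> y" unfolding y_def using A0 S0 by simp
    ultimately have y: "0 \<le> y" "2 * y \<le> 1" by auto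
    have \<delta>: "0 \<le> \<delta>" unfolding \<delta>_def using c \<kappa>0 S0 h by (auto intro!: add_nonneg_nonneg mult_nonneg_nonneg)
    have ea: "ea \<le> 1 - ?c * h\<^sup>2 * a.kbar + ?S * h ^ 3"
      using a.expectation_U_powr(2)[OF h(1,2) s] unfolding ea_def by linarith
    have eb: "eb \<ge> 1 - ?c * h\<^sup>2 * b.kbar - ?S * h ^ 3"
      using b.expectation_U_powr(2)[OF h(1,2) s] unfolding eb_def by linarith
    have "?c * h\<^sup>2 * b.kbar \<le> ?c * h\<^sup>2 * (a.kbar + \<kappa>)"
      using kk c by (intro mult_left_mono) auto
    also have "\<dots> = ?c * h\<^sup>2 * a.kbar + ?c * \<kappa> * h\<^sup>2" unfolding distrib_left by (simp only: mult_ac)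
    finally have 1: "ea \<le> eb + \<delta>"
      using ea eb unfolding \<delta>_def by linarith
    have "?c * h\<^sup>2 * b.kbar \<le> ?c * h\<^sup>2 * A"
      using b.abs_kbar_le c by (intro mult_left_mono) auto
    moreover have "?c * (h\<^sup>2 * A) \<le> 1 * (h\<^sup>2 * A)"
      using c A0 by (intro mult_right_mono) auto
    moreover have "?S * h ^ 3 \<le> ?S * h\<^sup>2"
      using S0 h by (intro mult_left_mono power_decreasing) auto
    ultimately have 2: "eb \<ge> 1 - y"
      using eb unfolding y_def distrib_right by (simp add: mult_ac)
    have "\<delta> * 1 \<le> \<delta> * ((1 + 2 * y) * eb)"
    proof (intro mult_left_mono \<delta>)
      have "0 \<le> y * (1 - 2 * y)" using y by simp
      then have "1 \<le> (1 + 2 * y) * (1 - y)" by (simp add: algebra_simps)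
      also have "\<dots> \<le> (1 + 2 * y) * eb" using 2 y by (intro mult_left_mono) auto
      finally show "1 \<le> (1 + 2 * y) * eb" .
    qed
    moreover have "rate h = \<delta> * (1 + 2 * y)" unfolding rate_def \<delta>_def y_def by (simp add: mult_ac)
    ultimately show ?thesis using 1 by (simp add: algebra_simps)
  qed
  moreover have "(\<integral>\<^sup>+g. ennreal ((\<integral>x. w x * wick I (\<lambda>i. h * a x i) g \<partial>M) powr s) \<partial>Gauss I) = ennreal (Z powr s * ea)"
  proof -
    have "(\<integral>\<^sup>+g. ennreal ((\<integral>x. w x * wick I (\<lambda>i. h * a x i) g \<partial>M) powr s) \<partial>Gauss I) = (\<integral>\<^sup>+g. ennreal (Z powr s * a.U h g powr s) \<partial>Gauss I)"
      using Z0 by (intro nn_integral_cong) (simp add: inta powr_mult)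
    also have "\<dots> = ennreal (Z powr s * ea)"
      unfolding ea_def using a.expectation_U_powr(1)[OF h(1,2) s] by (subst nn_integral_eq_integral) auto
    finally show ?thesis .
  qed
  moreover have "(\<integral>\<^sup>+g. ennreal ((\<integral>x. w x * wick J (\<lambda>i. h * b x i) g \<partial>M) powr s) \<partial>Gauss J) = ennreal (Z powr s * eb)"
  proof -
    have "(\<integral>\<^sup>+g. ennreal ((\<integral>x. w x * wick J (\<lambda>i. h * b x i) g \<partial>M) powr s) \<partial>Gauss J) = (\<integral>\<^sup>+g. ennreal (Z powr s * b.U h g powr s) \<partial>Gauss J)"
      using Z0 by (intro nn_integral_cong) (simp add: intb powr_mult)
    also have "\<dots> = ennreal (Z powr s * eb)"
      unfolding eb_def using b.expectation_U_powr(1)[OF h(1,2) s] by (subst nn_integral_eq_integral) auto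
    finally show ?thesis .
  qed
  moreover have "Z powr s * ea \<le> (1 + rate h) * (Z powr s * eb)"
  proof -
    have "Z powr s * ea \<le> Z powr s * ((1 + rate h) * eb)" using calculation(1) by (intro mult_left_mono) auto
    then show ?thesis by (simp add: mult_ac)
  qed
  moreover have "0 \<le> eb" unfolding eb_def by (intro integral_nonneg_AE) auto
  ultimately show ?thesis
    using rate_nonneg[of h] h by (simp add: ennreal_mult[symmetric] ennreal_leI del: ennreal_plus)
qed

text \<open>The interpolation between the two families: \<open>u\<close> is the variance left on the
  first, \<open>v\<close> the variance already moved to the second. The path runs from
  \<open>\<Phi> 1 0\<close> to \<open>\<Phi> 0 1\<close>.\<close>

definition \<Phi> :: "real \<Rightarrow> real \<Rightarrow> ennreal" where
  "\<Phi> u v = (\<integral>\<^sup>+g. (\<integral>\<^sup>+g'. ennreal ((\<integral>x. wick I (\<lambda>i. sqrt u * a x i) g * wick J (\<lambda>i. sqrt v * b x i) g' \<partial>M) powr s) \<partial>Gauss J) \<partial>Gauss I)"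

text \<open>Lindeberg swapping: moving a variance \<open>h\<^sup>2\<close> from one family of features to the other changes the
  fractional moment by \<open>h\<^sup>2\<close> times the difference of the averaged kernels, up to \<open>O(h\<^sup>3)\<close>.\<close>

lemma \<Phi>_step:
  assumes uv: "0 \<le> u" "0 \<le> v" and h: "0 < h" "h \<le> 1" "2 * (A + step_const A) * h\<^sup>2 \<le> 1"
  shows "\<Phi> (u + h\<^sup>2) v \<le> ennreal (1 + rate h) * \<Phi> u (v + h\<^sup>2)"
proof -
  define W where "W = (\<lambda>g g' x. wick I (\<lambda>i. sqrt u * a x i) g * wick J (\<lambda>i. sqrt v * b x i) g')"
  have W_meas [measurable]: "(\<lambda>p. W (g p) (g' p) (f p)) \<in> borel_measurable N"
    if [measurable]: "f \<in> measurable N M" "g \<in> measurable N (Gauss I)" "g' \<in> measurable N (Gauss J)" for f g g' and N :: "'m measure"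
    unfolding W_def by measurable
  interpret GI: prob_space "Gauss I" by (rule prob_space_Gauss)
  interpret GJ: prob_space "Gauss J" by (rule prob_space_Gauss)
  interpret GIJ: pair_sigma_finite "Gauss I" "Gauss J" ..
  \<comment> \<open>A unit Gaussian at strength \<open>sqrt (t + h\<^sup>2)\<close> is the
    superposition of independent ones at strengths \<open>sqrt t\<close> and \<open>h\<close>;
    \<open>\<alpha>\<close> and \<open>\<beta>\<close> are the cosine and sine of the corresponding
    rotation.\<close>
  have angle: "\<exists>\<alpha> \<beta>. \<alpha>\<^sup>2 + \<beta>\<^sup>2 = 1 \<and> sqrt (t + h\<^sup>2) * \<alpha> = sqrt t \<and> sqrt (t + h\<^sup>2) * \<beta> = h" if "0 \<le> t" for t
  proof (intro exI conjI)
    have p: "0 < t + h\<^sup>2" using that h by (simp add: add_nonneg_pos)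
    then have p': "sqrt (t + h\<^sup>2) \<noteq> 0" by simp
    have "t / (t + h\<^sup>2) + h\<^sup>2 / (t + h\<^sup>2) = 1"
      unfolding add_divide_distrib[symmetric] using p by simp
    then show "(sqrt t / sqrt (t + h\<^sup>2))\<^sup>2 + (h / sqrt (t + h\<^sup>2))\<^sup>2 = 1"
      using that p by (simp add: power_divide)
  qed (use h add_nonneg_pos[OF that, of "h\<^sup>2"] in auto)
  obtain \<alpha> \<beta> where ab: "\<alpha>\<^sup>2 + \<beta>\<^sup>2 = 1" "sqrt (u + h\<^sup>2) * \<alpha> = sqrt u" "sqrt (u + h\<^sup>2) * \<beta> = h"
    using angle[OF uv(1)] by blast
  obtain \<alpha>' \<beta>' where ab': "\<alpha>'\<^sup>2 + \<beta>'\<^sup>2 = 1" "sqrt (v + h\<^sup>2) * \<alpha>' = sqrt v" "sqrt (v + h\<^sup>2) * \<beta>' = h"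
    using angle[OF uv(2)] by blast
  have wa: "wick I (\<lambda>i. sqrt (u + h\<^sup>2) * c i) (\<lambda>i\<in>I. \<alpha> * g i + \<beta> * g' i) = wick I (\<lambda>i. sqrt u * c i) g * wick I (\<lambda>i. h * c i) g'" for c g g'
    by (rule wick_scaled_split) (use ab uv in \<open>auto simp: distrib_left mult.assoc[symmetric]\<close>)
  have wb: "wick J (\<lambda>i. sqrt (v + h\<^sup>2) * c i) (\<lambda>i\<in>J. \<alpha>' * g i + \<beta>' * g' i) = wick J (\<lambda>i. sqrt v * c i) g * wick J (\<lambda>i. h * c i) g'" for c g g'
    by (rule wick_scaled_split) (use ab' uv in \<open>auto simp: distrib_left mult.assoc[symmetric]\<close>)
  have "\<Phi> (u + h\<^sup>2) v = (\<integral>\<^sup>+g. (\<integral>\<^sup>+g''. (\<integral>\<^sup>+g'. ennreal ((\<integral>x. W g g' x * wick I (\<lambda>i. h * a x i) g'' \<partial>M) powr s) \<partial>Gauss J) \<partial>Gauss I) \<partial>Gauss I)"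
  proof -
    have "\<Phi> (u + h\<^sup>2) v = (\<integral>\<^sup>+g. (\<integral>\<^sup>+g''. (\<integral>\<^sup>+g'. ennreal ((\<integral>x. wick I (\<lambda>i. sqrt (u + h\<^sup>2) * a x i) (\<lambda>i\<in>I. \<alpha> * g i + \<beta> * g'' i) * wick J (\<lambda>i. sqrt v * b x i) g' \<partial>M) powr s) \<partial>Gauss J) \<partial>Gauss I) \<partial>Gauss I)"
      unfolding \<Phi>_def by (rule nn_integral_Gauss_split[OF fin(1) _ ab(1), symmetric]) measurable
    then show ?thesis unfolding wa W_def by (simp only: mult_ac)
  qed
  \<comment> \<open>The fresh increment \<open>g''\<close> must be the innermost integral, so that
    everything else is frozen during a single swap.\<close>
  also have "\<dots> = (\<integral>\<^sup>+g. (\<integral>\<^sup>+g'. (\<integral>\<^sup>+g''. ennreal ((\<integral>x. W g g' x * wick I (\<lambda>i. h * a x i) g'' \<partial>M) powr s) \<partial>Gauss I) \<partial>Gauss J) \<partial>Gauss I)"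
  proof (rule nn_integral_cong)
    fix g assume [measurable]: "g \<in> space (Gauss I)"
    show "(\<integral>\<^sup>+g''. (\<integral>\<^sup>+g'. ennreal ((\<integral>x. W g g' x * wick I (\<lambda>i. h * a x i) g'' \<partial>M) powr s) \<partial>Gauss J) \<partial>Gauss I)
       = (\<integral>\<^sup>+g'. (\<integral>\<^sup>+g''. ennreal ((\<integral>x. W g g' x * wick I (\<lambda>i. h * a x i) g'' \<partial>M) powr s) \<partial>Gauss I) \<partial>Gauss J)"
      by (rule GIJ.Fubini'[symmetric]) measurable
  qed
  also have "\<dots> \<le> (\<integral>\<^sup>+g. (\<integral>\<^sup>+g'. ennreal (1 + rate h) * (\<integral>\<^sup>+g''. ennreal ((\<integral>x. W g g' x * wick J (\<lambda>i. h * b x i) g'' \<partial>M) powr s) \<partial>Gauss J) \<partial>Gauss J) \<partial>Gauss I)"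
  proof (intro nn_integral_mono)
    fix g g' assume [measurable]: "g \<in> space (Gauss I)" "g' \<in> space (Gauss J)"
    show "(\<integral>\<^sup>+g''. ennreal ((\<integral>x. W g g' x * wick I (\<lambda>i. h * a x i) g'' \<partial>M) powr s) \<partial>Gauss I)
      \<le> ennreal (1 + rate h) * (\<integral>\<^sup>+g''. ennreal ((\<integral>x. W g g' x * wick J (\<lambda>i. h * b x i) g'' \<partial>M) powr s) \<partial>Gauss J)"
    proof (rule tilted_step[OF _ _ _ h])
      show "W g g' \<in> borel_measurable M" by measurable
      fix x assume x: "x \<in> space M"
      show "0 < W g g' x" unfolding W_def by (intro mult_pos_pos wick_pos)
      show "W g g' x \<le> exp (\<bar>sqrt u\<bar> * (1 + A) * (\<Sum>i\<in>I. \<bar>g i\<bar>)) * exp (\<bar>sqrt v\<bar> * (1 + A) * (\<Sum>i\<in>J. \<bar>g' i\<bar>))"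
        unfolding W_def by (intro mult_mono wick_le_exp fin bound_a bound_b A0 x) auto
    qed
  qed
  also have "\<dots> = ennreal (1 + rate h) * (\<integral>\<^sup>+g. (\<integral>\<^sup>+g'. (\<integral>\<^sup>+g''. ennreal ((\<integral>x. W g g' x * wick J (\<lambda>i. h * b x i) g'' \<partial>M) powr s) \<partial>Gauss J) \<partial>Gauss J) \<partial>Gauss I)"
  proof -
    have "(\<integral>\<^sup>+g'. ennreal (1 + rate h) * (\<integral>\<^sup>+g''. ennreal ((\<integral>x. W g g' x * wick J (\<lambda>i. h * b x i) g'' \<partial>M) powr s) \<partial>Gauss J) \<partial>Gauss J)
      = ennreal (1 + rate h) * (\<integral>\<^sup>+g'. (\<integral>\<^sup>+g''. ennreal ((\<integral>x. W g g' x * wick J (\<lambda>i. h * b x i) g'' \<partial>M) powr s) \<partial>Gauss J) \<partial>Gauss J)"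
      if [measurable]: "g \<in> space (Gauss I)" for g
      by (rule nn_integral_cmult) measurable
    then have "(\<integral>\<^sup>+g. (\<integral>\<^sup>+g'. ennreal (1 + rate h) * (\<integral>\<^sup>+g''. ennreal ((\<integral>x. W g g' x * wick J (\<lambda>i. h * b x i) g'' \<partial>M) powr s) \<partial>Gauss J) \<partial>Gauss J) \<partial>Gauss I)
      = (\<integral>\<^sup>+g. ennreal (1 + rate h) * (\<integral>\<^sup>+g'. (\<integral>\<^sup>+g''. ennreal ((\<integral>x. W g g' x * wick J (\<lambda>i. h * b x i) g'' \<partial>M) powr s) \<partial>Gauss J) \<partial>Gauss J) \<partial>Gauss I)"
      by (intro nn_integral_cong) simp
    also have "\<dots> = ennreal (1 + rate h) * (\<integral>\<^sup>+g. (\<integral>\<^sup>+g'. (\<integral>\<^sup>+g''. ennreal ((\<integral>x. W g g' x * wick J (\<lambda>i. h * b x i) g'' \<partial>M) powr s) \<partial>Gauss J) \<partial>Gauss J) \<partial>Gauss I)"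
      by (rule nn_integral_cmult) measurable
    finally show ?thesis .
  qed
  also have "(\<integral>\<^sup>+g. (\<integral>\<^sup>+g'. (\<integral>\<^sup>+g''. ennreal ((\<integral>x. W g g' x * wick J (\<lambda>i. h * b x i) g'' \<partial>M) powr s) \<partial>Gauss J) \<partial>Gauss J) \<partial>Gauss I)
     = \<Phi> u (v + h\<^sup>2)"
    unfolding \<Phi>_def
  proof (rule nn_integral_cong)
    fix g assume [measurable]: "g \<in> space (Gauss I)"
    show "(\<integral>\<^sup>+g'. (\<integral>\<^sup>+g''. ennreal ((\<integral>x. W g g' x * wick J (\<lambda>i. h * b x i) g'' \<partial>M) powr s) \<partial>Gauss J) \<partial>Gauss J)
      = (\<integral>\<^sup>+g'. ennreal ((\<integral>x. wick I (\<lambda>i. sqrt u * a x i) g * wick J (\<lambda>i. sqrt (v + h\<^sup>2) * b x i) g' \<partial>M) powr s) \<partial>Gauss J)"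
    proof -
      have "(\<integral>\<^sup>+g'. ennreal ((\<integral>x. wick I (\<lambda>i. sqrt u * a x i) g * wick J (\<lambda>i. sqrt (v + h\<^sup>2) * b x i) g' \<partial>M) powr s) \<partial>Gauss J)
        = (\<integral>\<^sup>+g'. (\<integral>\<^sup>+g''. ennreal ((\<integral>x. wick I (\<lambda>i. sqrt u * a x i) g * wick J (\<lambda>i. sqrt (v + h\<^sup>2) * b x i) (\<lambda>i\<in>J. \<alpha>' * g' i + \<beta>' * g'' i) \<partial>M) powr s) \<partial>Gauss J) \<partial>Gauss J)"
        by (rule nn_integral_Gauss_split[OF fin(2) _ ab'(1), symmetric]) measurable
      then show ?thesis unfolding wb W_def by (simp only: mult_ac)
    qed
  qed
  finally show ?thesis .
qed

lemma \<Phi>_chain: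
  assumes n: "0 < n" "2 * (A + step_const A) * (1 / sqrt (real n))\<^sup>2 \<le> 1" and "k \<le> n"
  shows "\<Phi> 1 0 \<le> ennreal ((1 + rate (1 / sqrt (real n))) ^ k) * \<Phi> (real (n - k) / real n) (real k / real n)"
  using \<open>k \<le> n\<close>
proof (induction k)
  case 0
  then show ?case using n by simp
next
  case (Suc k)
  let ?h = "1 / sqrt (real n)"
  have h2: "?h\<^sup>2 = 1 / real n" using n by (simp add: power_divide)
  have e1: "real (n - k) / real n = real (n - Suc k) / real n + ?h\<^sup>2"
    unfolding h2 using Suc.prems by (simp add: add_divide_distrib[symmetric] of_nat_diff)
  have e2: "real (Suc k) / real n = real k / real n + ?h\<^sup>2"
    unfolding h2 by (simp add: add_divide_distrib[symmetric])
  have "\<Phi> (real (n - k) / real n) (real k / real n) \<le> ennreal (1 + rate ?h) * \<Phi> (real (n - Suc k) / real n) (real (Suc k) / real n)"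
    unfolding e1 e2 by (rule \<Phi>_step) (use n in \<open>auto simp: divide_le_eq\<close>)
  then have "ennreal ((1 + rate ?h) ^ k) * \<Phi> (real (n - k) / real n) (real k / real n)
     \<le> ennreal ((1 + rate ?h) ^ k) * (ennreal (1 + rate ?h) * \<Phi> (real (n - Suc k) / real n) (real (Suc k) / real n))"
    by (rule mult_left_mono) simp
  with Suc show ?case
    using rate_nonneg[of ?h] by (simp add: ennreal_mult mult_ac)
qed

text \<open>With \<open>n\<close> swaps of variance \<open>1 / n\<close> the accumulated factor is
  at most \<open>exp (n * rate (1 / sqrt n))\<close>. Its exponent tends to
  \<open>s (1 - s) \<kappa> / 2\<close>, because \<open>n\<close> cubic errors sum to
  \<open>O(1 / sqrt n)\<close>. An infinite \<open>\<Phi> 0 1\<close> is set apart to keep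
  multiplication by it continuous.\<close>

lemma \<Phi>_comparison: "\<Phi> 1 0 \<le> ennreal (exp (s * (1 - s) / 2 * \<kappa>)) * \<Phi> 0 1"
proof (cases "\<Phi> 0 1 = \<top>")
  case True
  then show ?thesis by (simp add: ennreal_mult_eq_top_iff ennreal_mult_top)
next
  case False
  let ?r = "\<lambda>n. (s * (1 - s) / 2 * \<kappa> + 2 * step_const A * (1 / sqrt (real n))) * (1 + 2 * (A + step_const A) * (1 / real n))"
  have rr: "real n * rate (1 / sqrt (real n)) = ?r n" if "0 < n" for n
    using that unfolding rate_def by (simp add: field_simps power2_eq_square power3_eq_cube)
  have z1: "(\<lambda>n. 1 / sqrt (real n)) \<longlonglongrightarrow> 0"
    by (intro tendsto_divide_0[OF tendsto_const] filterlim_at_top_imp_at_infinity filterlim_compose[OF sqrt_at_top] filterlim_real_sequentially)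
  have z2: "(\<lambda>n. 1 / real n) \<longlonglongrightarrow> 0" by (rule lim_1_over_n)
  have "?r \<longlonglongrightarrow> (s * (1 - s) / 2 * \<kappa> + 2 * step_const A * 0) * (1 + 2 * (A + step_const A) * 0)"
    by (intro tendsto_intros z1 z2)
  then have "(\<lambda>n. ennreal (exp (?r n)) * \<Phi> 0 1) \<longlonglongrightarrow> ennreal (exp (s * (1 - s) / 2 * \<kappa>)) * \<Phi> 0 1"
    unfolding mult.commute[of _ "\<Phi> 0 1"]
    by (intro ennreal_tendsto_cmult tendsto_ennrealI tendsto_exp) (use False in \<open>simp_all add: less_top\<close>)
  moreover have "\<forall>\<^sub>F n in sequentially. \<Phi> 1 0 \<le> ennreal (exp (?r n)) * \<Phi> 0 1"
  proof -
    have "(\<lambda>n. 2 * (A + step_const A) * (1 / real n)) \<longlonglongrightarrow> 2 * (A + step_const A) * 0"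
      by (intro tendsto_intros z2)
    then have "\<forall>\<^sub>F n in sequentially. 2 * (A + step_const A) * (1 / real n) < 1"
      by (rule order_tendstoD(2)) simp
    moreover have "\<forall>\<^sub>F n in sequentially. (0::nat) < n" by (rule eventually_gt_at_top)
    ultimately show ?thesis
    proof eventually_elim
      case (elim n)
      have "\<Phi> 1 0 \<le> ennreal ((1 + rate (1 / sqrt (real n))) ^ n) * \<Phi> (real (n - n) / real n) (real n / real n)"
        by (rule \<Phi>_chain) (use elim in \<open>auto simp: power_divide\<close>)
      also have "\<dots> = ennreal ((1 + rate (1 / sqrt (real n))) ^ n) * \<Phi> 0 1" using elim by simp
      also have "\<dots> \<le> ennreal (exp (?r n)) * \<Phi> 0 1"
      proof (intro mult_right_mono ennreal_leI)
        have "(1 + rate (1 / sqrt (real n))) ^ n \<le> exp (rate (1 / sqrt (real n))) ^ n"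
          using rate_nonneg[of "1 / sqrt (real n)"] by (intro power_mono) auto
        also have "\<dots> = exp (?r n)" using rr[of n] elim by (simp add: exp_of_nat_mult[symmetric])
        finally show "(1 + rate (1 / sqrt (real n))) ^ n \<le> exp (?r n)" .
      qed simp
      finally show ?case .
    qed
  qed
  ultimately show ?thesis
    by (intro tendsto_lowerbound[where F = sequentially]) auto
qed

theorem gaussian_comparison_powr:
  "(\<integral>\<^sup>+g. ennreal ((\<integral>x. wick I (a x) g \<partial>M) powr s) \<partial>Gauss I)
    \<le> ennreal (exp (s * (1 - s) / 2 * \<kappa>)) * (\<integral>\<^sup>+g. ennreal ((\<integral>x. wick J (b x) g \<partial>M) powr s) \<partial>Gauss J)"
proof -
  have z: "wick K (\<lambda>i. 0) g = 1" for K :: "'k set" and g by (simp add: wick_def)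
  have 1: "emeasure (Gauss K) (space (Gauss K)) = 1" for K :: "'k set"
    by (rule prob_space.emeasure_space_1[OF prob_space_Gauss])
  show ?thesis
    using \<Phi>_comparison unfolding \<Phi>_def by (simp add: z 1)
qed

end

section \<open>The scalar channel\<close>

lemma integral_std_normal_uminus:
  fixes f :: "real \<Rightarrow> real"
  assumes [measurable]: "f \<in> borel_measurable borel"
  shows "(\<integral>z. f (- z) \<partial>std_normal_distribution) = (\<integral>z. f z \<partial>std_normal_distribution)"
proof -
  have "(\<integral>z. f (- z) \<partial>std_normal_distribution) = (\<integral>z. std_normal_density z * f (- z) \<partial>lborel)"
    by (subst integral_density) auto
  also have "\<dots> = \<bar>- 1\<bar> *\<^sub>R (\<integral>z. std_normal_density (0 + (- 1) * z) * f (- (0 + (- 1) * z)) \<partial>lborel)"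
    by (rule lborel_integral_real_affine) simp
  also have "\<dots> = (\<integral>z. f z \<partial>std_normal_distribution)"
    by (subst integral_density) (auto simp: std_normal_density_def)
  finally show ?thesis .
qed

text \<open>The integrand times the standard normal density is a multiple of the centred normal
  density with variance \<open>1 / (1 - \<tau>)\<close>.\<close>

lemma nn_integral_exp_square:
  fixes \<tau> :: real
  assumes \<tau>: "\<tau> < 1"
  shows "(\<integral>\<^sup>+y. ennreal (exp (\<tau> * y\<^sup>2 / 2)) \<partial>std_normal_distribution) = ennreal (1 / sqrt (1 - \<tau>))"
proof -
  define \<sigma> where "\<sigma> = 1 / sqrt (1 - \<tau>)"
  have \<sigma>: "0 < \<sigma>" "\<sigma>\<^sup>2 = 1 / (1 - \<tau>)" unfolding \<sigma>_def using \<tau> by (auto simp: power_divide)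
  have e: "std_normal_density y * exp (\<tau> * y\<^sup>2 / 2) = \<sigma> * normal_density 0 \<sigma> y" for y
  proof -
    have "- y\<^sup>2 / 2 + \<tau> * y\<^sup>2 / 2 = - y\<^sup>2 / (2 * \<sigma>\<^sup>2)" unfolding \<sigma>(2) using \<tau> by (simp add: field_simps)
    then show ?thesis
      unfolding std_normal_density_def normal_density_def using \<sigma>(1) by (simp add: exp_add[symmetric] real_sqrt_mult)
  qed
  have "(\<integral>\<^sup>+y. ennreal (exp (\<tau> * y\<^sup>2 / 2)) \<partial>std_normal_distribution) = (\<integral>\<^sup>+y. ennreal (std_normal_density y * exp (\<tau> * y\<^sup>2 / 2)) \<partial>lborel)"
    by (subst nn_integral_density) (auto simp: ennreal_mult)
  also have "\<dots> = (\<integral>\<^sup>+y. ennreal (\<sigma> * normal_density 0 \<sigma> y) \<partial>lborel)"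
    unfolding e ..
  also have "\<dots> = ennreal (\<integral>y. \<sigma> * normal_density 0 \<sigma> y \<partial>lborel)"
    using \<sigma>(1) integrable_normal_density[OF \<sigma>(1), of 0] by (intro nn_integral_eq_integral) auto
  also have "(\<integral>y. \<sigma> * normal_density 0 \<sigma> y \<partial>lborel) = \<sigma>"
    using integral_normal_density[OF \<sigma>(1), of 0] by simp
  finally show ?thesis unfolding \<sigma>_def .
qed

locale bounded_prior = real_distribution P for P :: "real measure" +
  fixes B :: real
  assumes B1: "1 \<le> B" and bdd: "AE x in P. \<bar>x\<bar> \<le> B"
    and mean0: "expectation (\<lambda>x. x) = 0" and var1: "expectation (\<lambda>x. x\<^sup>2) = 1"
begin

abbreviation "\<gamma> \<equiv> std_normal_distribution"

lemma [measurable_cong]: "sets P = sets borel" by (rule events_eq_borel)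

sublocale N: prob_space \<gamma> by (rule prob_space_std_normal)
sublocale PN: pair_prob_space P \<gamma> ..

lemma prob_UNIV: "prob UNIV = 1"
  using prob_space by (simp add: space_eq_univ)

lemma emeasure_UNIV: "emeasure P UNIV = 1" "emeasure \<gamma> UNIV = 1"
  using emeasure_space_1 N.emeasure_space_1 by (simp_all add: space_eq_univ)

text \<open>The density of the scalar output \<open>sqrt r * x + z\<close> with respect to the law
  of the noise, that is, the normalisation of the posterior of \<open>x\<close> given the output
  \<open>y\<close>.\<close>

definition channel :: "real \<Rightarrow> real \<Rightarrow> real" where
  "channel r y = (\<integral>x. exp (sqrt r * y * x - r / 2 * x\<^sup>2) \<partial>P)"

lemma channel_measurable [measurable]: "channel r \<in> borel_measurable borel"
  unfolding channel_def by measurable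

lemma exponent_bound:
  assumes "0 \<le> r" "\<bar>x\<bar> \<le> B"
  shows "\<bar>sqrt r * y * x - r / 2 * x\<^sup>2\<bar> \<le> sqrt r * B * \<bar>y\<bar> + r / 2 * B\<^sup>2"
proof -
  have "\<bar>sqrt r * y * x\<bar> \<le> sqrt r * \<bar>y\<bar> * B"
    unfolding abs_mult using assms by (intro mult_mono) auto
  moreover have "\<bar>r / 2 * x\<^sup>2\<bar> \<le> r / 2 * B\<^sup>2"
  proof -
    have "\<bar>x\<bar>\<^sup>2 \<le> B\<^sup>2" using assms by (intro power_mono) auto
    then show ?thesis using assms(1) by (simp add: abs_mult mult_left_mono)
  qed
  ultimately show ?thesis by (simp add: mult_ac)
qed

lemma integrable_channel:
  assumes "0 \<le> r"
  shows "integrable P (\<lambda>x. exp (sqrt r * y * x - r / 2 * x\<^sup>2))"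
proof (rule integrable_const_bound)
  show "AE x in P. norm (exp (sqrt r * y * x - r / 2 * x\<^sup>2)) \<le> exp (sqrt r * B * \<bar>y\<bar> + r / 2 * B\<^sup>2)"
    using bdd by eventually_elim (use exponent_bound[OF assms, of _ y] in \<open>force simp: abs_le_iff\<close>)
qed measurable

lemma channel_bounds:
  assumes "0 \<le> r"
  shows "channel r y \<le> exp (sqrt r * B * \<bar>y\<bar> + r / 2 * B\<^sup>2)"
    and "exp (- (sqrt r * B * \<bar>y\<bar> + r / 2 * B\<^sup>2)) \<le> channel r y"
proof -
  let ?c = "sqrt r * B * \<bar>y\<bar> + r / 2 * B\<^sup>2"
  have "channel r y \<le> (\<integral>x. exp ?c \<partial>P)"
    unfolding channel_def
  proof (rule integral_mono_AE)
    show "AE x in P. exp (sqrt r * y * x - r / 2 * x\<^sup>2) \<le> exp ?c"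
      using bdd by eventually_elim (use exponent_bound[OF assms, of _ y] in \<open>force simp: abs_le_iff\<close>)
  qed (use integrable_channel[OF assms] in \<open>simp_all only: integrable_const\<close>)
  then show "channel r y \<le> exp ?c" by (simp add: prob_UNIV)
  have "(\<integral>x. exp (- ?c) \<partial>P) \<le> channel r y"
    unfolding channel_def
  proof (rule integral_mono_AE)
    show "AE x in P. exp (- ?c) \<le> exp (sqrt r * y * x - r / 2 * x\<^sup>2)"
      using bdd by eventually_elim (use exponent_bound[OF assms, of _ y] in \<open>force simp: abs_le_iff\<close>)
  qed (use integrable_channel[OF assms] in \<open>simp_all only: integrable_const\<close>)
  then show "exp (- ?c) \<le> channel r y" by (simp add: prob_UNIV)
qed

lemma channel_pos: "0 \<le> r \<Longrightarrow> 0 < channel r y"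
  using channel_bounds(2)[of r y] by (rule less_le_trans[OF exp_gt_zero])

lemma abs_ln_channel_le:
  assumes "0 \<le> r"
  shows "\<bar>ln (channel r y)\<bar> \<le> sqrt r * B * \<bar>y\<bar> + r / 2 * B\<^sup>2"
proof -
  let ?c = "sqrt r * B * \<bar>y\<bar> + r / 2 * B\<^sup>2"
  have "ln (channel r y) \<le> ln (exp ?c)" "ln (exp (- ?c)) \<le> ln (channel r y)"
    using channel_bounds[OF assms, of y] channel_pos[OF assms, of y] by (subst ln_le_cancel_iff; simp)+
  then show ?thesis by simp
qed

lemma nn_integral_channel:
  assumes r: "0 \<le> r" and [measurable]: "F \<in> borel_measurable borel"
  shows "(\<integral>\<^sup>+x. (\<integral>\<^sup>+z. F (sqrt r * x + z) \<partial>\<gamma>) \<partial>P) = (\<integral>\<^sup>+y. F y * ennreal (channel r y) \<partial>\<gamma>)"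
proof -
  have "(\<integral>\<^sup>+x. (\<integral>\<^sup>+z. F (sqrt r * x + z) \<partial>\<gamma>) \<partial>P)
    = (\<integral>\<^sup>+x. (\<integral>\<^sup>+y. F y * ennreal (exp (sqrt r * x * y - (sqrt r * x)\<^sup>2 / 2)) \<partial>\<gamma>) \<partial>P)"
    by (intro nn_integral_cong nn_integral_std_normal_shift) measurable
  also have "\<dots> = (\<integral>\<^sup>+y. (\<integral>\<^sup>+x. F y * ennreal (exp (sqrt r * x * y - (sqrt r * x)\<^sup>2 / 2)) \<partial>P) \<partial>\<gamma>)"
    by (rule PN.Fubini'[symmetric]) measurable
  also have "\<dots> = (\<integral>\<^sup>+y. F y * ennreal (channel r y) \<partial>\<gamma>)"
  proof (rule nn_integral_cong)
    fix y
    have e: "sqrt r * x * y - (sqrt r * x)\<^sup>2 / 2 = sqrt r * y * x - r / 2 * x\<^sup>2" for x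
      using r by (simp add: power_mult_distrib mult_ac)
    have "(\<integral>\<^sup>+x. F y * ennreal (exp (sqrt r * x * y - (sqrt r * x)\<^sup>2 / 2)) \<partial>P) = F y * (\<integral>\<^sup>+x. ennreal (exp (sqrt r * y * x - r / 2 * x\<^sup>2)) \<partial>P)"
      unfolding e by (rule nn_integral_cmult) measurable
    also have "(\<integral>\<^sup>+x. ennreal (exp (sqrt r * y * x - r / 2 * x\<^sup>2)) \<partial>P) = ennreal (channel r y)"
      unfolding channel_def by (rule nn_integral_eq_integral) (use r integrable_channel in auto)
    finally show "(\<integral>\<^sup>+x. F y * ennreal (exp (sqrt r * x * y - (sqrt r * x)\<^sup>2 / 2)) \<partial>P) = F y * ennreal (channel r y)" .
  qed
  finally show ?thesis .
qed

lemma psi_eq: "0 \<le> r \<Longrightarrow> psi P r = (\<integral>p. ln (channel r (sqrt r * fst p + snd p)) \<partial>(P \<Otimes>\<^sub>M \<gamma>))"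
proof -
  assume r: "0 \<le> r"
  have "sqrt r * z * x + r * x * xs - r / 2 * x\<^sup>2 = sqrt r * (sqrt r * xs + z) * x - r / 2 * x\<^sup>2" for x z xs
  proof -
    have "sqrt r * (sqrt r * xs + z) * x = (sqrt r * sqrt r) * (xs * x) + sqrt r * z * x" by (simp add: algebra_simps)
    then show ?thesis using r by (simp add: mult_ac)
  qed
  then show ?thesis unfolding psi_def channel_def by (simp add: case_prod_unfold)
qed

lemma integrable_std_normal_abs: "integrable \<gamma> (\<lambda>z. \<bar>z\<bar>)" "integrable \<gamma> (\<lambda>z. z)" "integrable \<gamma> (\<lambda>z. z\<^sup>2)"
  "(\<integral>z. z \<partial>\<gamma>) = 0" "(\<integral>z. z\<^sup>2 \<partial>\<gamma>) = 1"
proof -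
  show 1: "integrable \<gamma> (\<lambda>z. z)" using integrable_std_normal_distribution_moment[of 1] by simp
  then show "integrable \<gamma> (\<lambda>z. \<bar>z\<bar>)" by (rule integrable_abs)
  show "integrable \<gamma> (\<lambda>z. z\<^sup>2)" using integrable_std_normal_distribution_moment[of 2] by simp
  show "(\<integral>z. z \<partial>\<gamma>) = 0" using integral_std_normal_distribution_moment_odd[of 1] by simp
  show "(\<integral>z. z\<^sup>2 \<partial>\<gamma>) = 1" using std_normal_distribution_even_moments(1)[of 1] by simp
qed

lemma integrable_pair_snd:
  fixes f :: "real \<Rightarrow> real"
  assumes "integrable \<gamma> f"
  shows "integrable (P \<Otimes>\<^sub>M \<gamma>) (\<lambda>p. f (snd p))"
proof -
  have [measurable]: "f \<in> borel_measurable borel" using assms by auto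
  have "(\<integral>\<^sup>+p. ennreal (norm (f (snd p))) \<partial>(P \<Otimes>\<^sub>M \<gamma>)) = (\<integral>\<^sup>+z. ennreal (norm (f z)) \<partial>\<gamma>)"
    by (subst N.nn_integral_fst[symmetric]) (auto simp: emeasure_UNIV)
  then show ?thesis using assms unfolding integrable_iff_bounded by simp
qed

lemma AE_pair_bdd: "AE p in P \<Otimes>\<^sub>M \<gamma>. \<bar>fst p\<bar> \<le> B"
proof -
  have "AE x in distr (P \<Otimes>\<^sub>M \<gamma>) P fst. \<bar>x\<bar> \<le> B"
    using bdd by (simp only: N.distr_pair_fst)
  then show ?thesis by (rule AE_distrD[rotated]) measurable
qed

lemma integrable_pair_bound:
  fixes F :: "real \<times> real \<Rightarrow> real"
  assumes [measurable]: "F \<in> borel_measurable (P \<Otimes>\<^sub>M \<gamma>)" and g: "integrable \<gamma> g"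
    and le: "\<And>x z. \<bar>x\<bar> \<le> B \<Longrightarrow> \<bar>F (x, z)\<bar> \<le> g z"
  shows "integrable (P \<Otimes>\<^sub>M \<gamma>) F"
proof (rule Bochner_Integration.integrable_bound[OF integrable_pair_snd[OF g]])
  show "AE p in P \<Otimes>\<^sub>M \<gamma>. norm (F p) \<le> norm (g (snd p))"
    using AE_pair_bdd
  proof eventually_elim
    case (elim p)
    show ?case using le[OF elim, of "snd p"] by simp
  qed
qed measurable

lemma abs_output_le:
  assumes "0 \<le> r" "\<bar>x\<bar> \<le> B" "\<bar>\<sigma>\<bar> \<le> 1"
  shows "\<bar>\<sigma> * (sqrt r * x) + z\<bar> \<le> sqrt r * B + \<bar>z\<bar>"
proof -
  have "\<bar>\<sigma> * (sqrt r * x)\<bar> \<le> 1 * (sqrt r * B)"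
    unfolding abs_mult using assms by (intro mult_mono) auto
  then show ?thesis by linarith
qed

lemma integrable_ln_channel:
  assumes r: "0 \<le> r" and \<sigma>: "\<bar>\<sigma>\<bar> \<le> 1" and c: "\<bar>c\<bar> \<le> 1"
  shows "integrable (P \<Otimes>\<^sub>M \<gamma>) (\<lambda>p. ln (channel r (c * (\<sigma> * (sqrt r * fst p) + snd p))))"
proof (rule integrable_pair_bound)
  show "integrable \<gamma> (\<lambda>z. sqrt r * B * (sqrt r * B + \<bar>z\<bar>) + r / 2 * B\<^sup>2)"
    using integrable_std_normal_abs(1) by auto
  fix x z :: real assume x: "\<bar>x\<bar> \<le> B"
  have "\<bar>c * (\<sigma> * (sqrt r * x) + z)\<bar> \<le> 1 * (sqrt r * B + \<bar>z\<bar>)"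
    unfolding abs_mult[of c] using abs_output_le[OF r x \<sigma>, of z] c by (intro mult_mono) auto
  then have "sqrt r * B * \<bar>c * (\<sigma> * (sqrt r * x) + z)\<bar> \<le> sqrt r * B * (sqrt r * B + \<bar>z\<bar>)"
    using r B1 by (intro mult_left_mono) auto
  then show "\<bar>ln (channel r (c * (\<sigma> * (sqrt r * fst (x, z)) + snd (x, z))))\<bar> \<le> sqrt r * B * (sqrt r * B + \<bar>z\<bar>) + r / 2 * B\<^sup>2"
    using abs_ln_channel_le[OF r, of "c * (\<sigma> * (sqrt r * x) + z)"] by simp
qed measurable

text \<open>Gibbs' inequality: \<open>channel r\<close> is the density of the scalar observation with respect to the
  noise, so that \<open>psi P r\<close> is a relative entropy.\<close>

lemma psi_ge:
  assumes r: "0 \<le> r" and [measurable]: "G \<in> borel_measurable borel"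
    and int: "integrable (P \<Otimes>\<^sub>M \<gamma>) (\<lambda>p. G (sqrt r * fst p + snd p))"
    and sub: "(\<integral>\<^sup>+y. ennreal (exp (G y)) \<partial>\<gamma>) \<le> 1"
  shows "(\<integral>p. G (sqrt r * fst p + snd p) \<partial>(P \<Otimes>\<^sub>M \<gamma>)) \<le> psi P r"
proof -
  let ?q = "\<lambda>y. exp (G y) / channel r y"
  have q: "(\<integral>\<^sup>+p. ennreal (?q (sqrt r * fst p + snd p)) \<partial>(P \<Otimes>\<^sub>M \<gamma>)) \<le> 1"
  proof -
    have "(\<integral>\<^sup>+p. ennreal (?q (sqrt r * fst p + snd p)) \<partial>(P \<Otimes>\<^sub>M \<gamma>))
       = (\<integral>\<^sup>+x. (\<integral>\<^sup>+z. ennreal (?q (sqrt r * x + z)) \<partial>\<gamma>) \<partial>P)"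
      by (subst N.nn_integral_fst[symmetric]) auto
    also have "\<dots> = (\<integral>\<^sup>+y. ennreal (?q y) * ennreal (channel r y) \<partial>\<gamma>)"
      by (rule nn_integral_channel[OF r]) measurable
    also have "\<dots> = (\<integral>\<^sup>+y. ennreal (exp (G y)) \<partial>\<gamma>)"
      using channel_pos[OF r] by (intro nn_integral_cong) (simp add: ennreal_mult[symmetric] less_imp_le less_imp_neq[THEN not_sym])
    finally show ?thesis using sub by simp
  qed
  have iq: "integrable (P \<Otimes>\<^sub>M \<gamma>) (\<lambda>p. ?q (sqrt r * fst p + snd p))"
    using q channel_pos[OF r]
    by (intro integrableI_nonneg) (auto intro!: AE_I2 divide_nonneg_pos simp: le_less_trans[OF _ ennreal_one_less_top])
  have Eq: "(\<integral>p. ?q (sqrt r * fst p + snd p) \<partial>(P \<Otimes>\<^sub>M \<gamma>)) \<le> 1"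
  proof -
    have "ennreal (\<integral>p. ?q (sqrt r * fst p + snd p) \<partial>(P \<Otimes>\<^sub>M \<gamma>)) \<le> ennreal 1"
      using q channel_pos[OF r] by (subst nn_integral_eq_integral[symmetric, OF iq]) (auto intro!: AE_I2 divide_nonneg_pos)
    then show ?thesis by (subst (asm) ennreal_le_iff) auto
  qed
  have il: "integrable (P \<Otimes>\<^sub>M \<gamma>) (\<lambda>p. ln (channel r (sqrt r * fst p + snd p)))"
    using integrable_ln_channel[OF r, of 1 1] by simp
  have "(\<integral>p. G (sqrt r * fst p + snd p) \<partial>(P \<Otimes>\<^sub>M \<gamma>))
     \<le> (\<integral>p. ln (channel r (sqrt r * fst p + snd p)) + ?q (sqrt r * fst p + snd p) - 1 \<partial>(P \<Otimes>\<^sub>M \<gamma>))"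
  proof (rule integral_mono[OF int])
    show "integrable (P \<Otimes>\<^sub>M \<gamma>) (\<lambda>p. ln (channel r (sqrt r * fst p + snd p)) + ?q (sqrt r * fst p + snd p) - 1)"
      using il iq by auto
    fix p
    have "G y \<le> ln (channel r y) + ?q y - 1" for y
    proof -
      have "ln (?q y) \<le> ?q y - 1" using channel_pos[OF r, of y] by (intro ln_le_minus_one) simp
      moreover have "ln (?q y) = G y - ln (channel r y)" using channel_pos[OF r, of y] by (simp add: ln_div)
      ultimately show ?thesis by linarith
    qed
    then show "G (sqrt r * fst p + snd p) \<le> ln (channel r (sqrt r * fst p + snd p)) + ?q (sqrt r * fst p + snd p) - 1" .
  qed
  also have "\<dots> \<le> psi P r"
    using il iq Eq by (simp add: psi_eq[OF r] PN.prob_space)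
  finally show ?thesis .
qed

lemma nn_integral_channel_one: "0 \<le> r \<Longrightarrow> (\<integral>\<^sup>+y. ennreal (channel r y) \<partial>\<gamma>) = 1"
  using nn_integral_channel[of r "\<lambda>_. 1"] by (simp add: emeasure_UNIV)

text \<open>For \<open>\<sigma> = - 1\<close> the signal is reversed. Reflecting the noise turns
  this output into the negative of the true one, and \<open>channel r (- y)\<close> is again a
  probability density with respect to the noise, so Gibbs' inequality applies. The reversed sign is
  the one met at negative overlaps.\<close>

lemma expectation_ln_channel_le_psi:
  assumes r: "0 \<le> r" and \<sigma>: "\<sigma> = 1 \<or> \<sigma> = - 1"
  shows "(\<integral>p. ln (channel r (\<sigma> * (sqrt r * fst p) + snd p)) \<partial>(P \<Otimes>\<^sub>M \<gamma>)) \<le> psi P r"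
proof (cases "\<sigma> = 1")
  case True
  then show ?thesis by (simp add: psi_eq[OF r])
next
  case False
  with \<sigma> have \<sigma>: "\<sigma> = - 1" by simp
  have nn1: "(\<integral>\<^sup>+y. ennreal (exp (ln (channel r (- y)))) \<partial>\<gamma>) \<le> 1"
  proof -
    have i: "integrable \<gamma> (channel r)" and 1: "(\<integral>y. channel r y \<partial>\<gamma>) = 1"
      using nn_integral_channel_one[OF r] channel_pos[OF r]
      by (auto intro!: integrableI_nonneg AE_I2 simp: less_imp_le integral_eq_nn_integral)
    have "integrable lborel (\<lambda>y. std_normal_density y * channel r y)"
      using i by (subst (asm) integrable_density) auto
    then have "integrable lborel (\<lambda>y. std_normal_density (0 + (- 1) * y) * channel r (0 + (- 1) * y))"
      by (rule lborel_integrable_real_affine) simp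
    then have "integrable \<gamma> (\<lambda>y. channel r (- y))"
      by (subst integrable_density) (auto simp: std_normal_density_def)
    then have "(\<integral>\<^sup>+y. ennreal (channel r (- y)) \<partial>\<gamma>) = ennreal (\<integral>y. channel r (- y) \<partial>\<gamma>)"
      using channel_pos[OF r] by (intro nn_integral_eq_integral) (auto intro!: AE_I2 less_imp_le)
    also have "\<dots> = 1" by (subst integral_std_normal_uminus) (auto simp: 1)
    finally show ?thesis using channel_pos[OF r] by simp
  qed
  have i1: "integrable (P \<Otimes>\<^sub>M \<gamma>) (\<lambda>p. ln (channel r (- 1 * (1 * (sqrt r * fst p) + snd p))))"
    by (rule integrable_ln_channel[OF r]) auto
  have i2: "integrable (P \<Otimes>\<^sub>M \<gamma>) (\<lambda>p. ln (channel r (1 * (- 1 * (sqrt r * fst p) + snd p))))"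
    by (rule integrable_ln_channel[OF r]) auto
  have "(\<integral>p. ln (channel r (\<sigma> * (sqrt r * fst p) + snd p)) \<partial>(P \<Otimes>\<^sub>M \<gamma>))
     = (\<integral>x. (\<integral>z. ln (channel r (- (sqrt r * x) + z)) \<partial>\<gamma>) \<partial>P)"
    using PN.integral_fst'[OF i2] unfolding \<sigma> by simp
  also have "\<dots> = (\<integral>x. (\<integral>z. ln (channel r (- (sqrt r * x + z))) \<partial>\<gamma>) \<partial>P)"
    by (subst integral_std_normal_uminus[symmetric]) (auto simp: algebra_simps)
  also have "\<dots> = (\<integral>p. ln (channel r (- (sqrt r * fst p + snd p))) \<partial>(P \<Otimes>\<^sub>M \<gamma>))"
    using PN.integral_fst'[OF i1] by simp
  also have "\<dots> \<le> psi P r"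
    by (rule psi_ge[OF r, of "\<lambda>y. ln (channel r (- y))"]) (use i1 nn1 in auto)
  finally show ?thesis .
qed

lemma integrable_id: "integrable P (\<lambda>x. x)" "integrable P (\<lambda>x. x\<^sup>2)"
proof -
  show "integrable P (\<lambda>x. x)"
    by (rule integrable_const_bound[where B = B]) (use bdd in auto)
  show "integrable P (\<lambda>x. x\<^sup>2)" using var1 not_integrable_integral_eq by fastforce
qed

text \<open>Gibbs' inequality against the centred Gaussian with the variance \<open>1 + r\<close> of
  the output. \<open>exp (G y)\<close> is its density relative to the noise, and the value obtained
  is the relative entropy of \<open>N(0, 1 + r)\<close> with respect to
  \<open>N(0, 1)\<close>.\<close>

lemma psi_ge_gaussian:
  assumes r: "0 \<le> r"
  shows "(r - ln (1 + r)) / 2 \<le> psi P r"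
proof -
  define \<tau> where "\<tau> = r / (1 + r)"
  define G where "G y = \<tau> * y\<^sup>2 / 2 - ln (1 + r) / 2" for y
  have \<tau>: "0 \<le> \<tau>" "1 - \<tau> = 1 / (1 + r)" "\<tau> * (1 + r) = r" unfolding \<tau>_def using r by (auto simp: field_simps)
  have G_meas [measurable]: "G \<in> borel_measurable borel" unfolding G_def[abs_def] by measurable
  have sub: "(\<integral>\<^sup>+y. ennreal (exp (G y)) \<partial>\<gamma>) \<le> 1"
  proof -
    have "exp (- (ln (1 + r) / 2)) = 1 / sqrt (1 + r)"
      using r by (simp add: exp_minus ln_sqrt[symmetric] inverse_eq_divide)
    then have "exp (G y) = 1 / sqrt (1 + r) * exp (\<tau> * y\<^sup>2 / 2)" for y
      unfolding G_def diff_conv_add_uminus exp_add by simp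
    then have "(\<integral>\<^sup>+y. ennreal (exp (G y)) \<partial>\<gamma>) = (\<integral>\<^sup>+y. ennreal (1 / sqrt (1 + r)) * ennreal (exp (\<tau> * y\<^sup>2 / 2)) \<partial>\<gamma>)"
      using r by (intro nn_integral_cong) (simp add: ennreal_mult[symmetric])
    also have "\<dots> = ennreal (1 / sqrt (1 + r)) * (\<integral>\<^sup>+y. ennreal (exp (\<tau> * y\<^sup>2 / 2)) \<partial>\<gamma>)"
      by (rule nn_integral_cmult) measurable
    also have "\<dots> = ennreal (1 / sqrt (1 + r) * (1 / sqrt (1 - \<tau>)))"
      using r \<tau>(2) by (subst nn_integral_exp_square) (auto simp: \<tau>_def ennreal_mult[symmetric])
    also have "1 / sqrt (1 + r) * (1 / sqrt (1 - \<tau>)) = 1"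
      unfolding \<tau>(2) using r by (simp add: real_sqrt_divide)
    finally show ?thesis by simp
  qed
  have int2: "integrable (P \<Otimes>\<^sub>M \<gamma>) (\<lambda>p. (sqrt r * fst p + snd p)\<^sup>2)"
  proof (rule integrable_pair_bound)
    show "integrable \<gamma> (\<lambda>z. 2 * (r * B\<^sup>2) + 2 * z\<^sup>2)" using integrable_std_normal_abs by auto
    fix x z :: real assume x: "\<bar>x\<bar> \<le> B"
    have "\<bar>x\<bar>\<^sup>2 \<le> B\<^sup>2" using x by (intro power_mono) auto
    then have "r * x\<^sup>2 \<le> r * B\<^sup>2" using r by (intro mult_left_mono) auto
    moreover have "(sqrt r * x + z)\<^sup>2 \<le> 2 * (r * x\<^sup>2) + 2 * z\<^sup>2"
      using sum_squares_bound[of "sqrt r * x" z] r by (simp add: power2_sum power_mult_distrib)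
    ultimately show "\<bar>(sqrt r * fst (x, z) + snd (x, z))\<^sup>2\<bar> \<le> 2 * (r * B\<^sup>2) + 2 * z\<^sup>2" by simp
  qed measurable
  have "(\<integral>p. (sqrt r * fst p + snd p)\<^sup>2 \<partial>(P \<Otimes>\<^sub>M \<gamma>)) = (\<integral>x. (\<integral>z. (sqrt r * x + z)\<^sup>2 \<partial>\<gamma>) \<partial>P)"
    using PN.integral_fst'[OF int2] by simp
  also have "\<dots> = (\<integral>x. r * x\<^sup>2 + 1 \<partial>P)"
  proof (rule Bochner_Integration.integral_cong[OF refl])
    fix x
    have "(\<integral>z. (sqrt r * x + z)\<^sup>2 \<partial>\<gamma>) = (\<integral>z. (r * x\<^sup>2 + (2 * sqrt r * x) * z + z\<^sup>2) \<partial>\<gamma>)"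
      using r by (intro Bochner_Integration.integral_cong) (auto simp: power2_sum power_mult_distrib)
    also have "\<dots> = (\<integral>z. r * x\<^sup>2 \<partial>\<gamma>) + (\<integral>z. (2 * sqrt r * x) * z \<partial>\<gamma>) + (\<integral>z. z\<^sup>2 \<partial>\<gamma>)"
      using integrable_std_normal_abs by simp
    also have "\<dots> = r * x\<^sup>2 + 1"
      using integrable_std_normal_abs N.prob_space by (simp add: integral_mult_right_zero)
    finally show "(\<integral>z. (sqrt r * x + z)\<^sup>2 \<partial>\<gamma>) = r * x\<^sup>2 + 1" .
  qed
  also have "\<dots> = r + 1" using integrable_id(2) var1 by (simp add: prob_UNIV)
  finally have E2: "(\<integral>p. (sqrt r * fst p + snd p)\<^sup>2 \<partial>(P \<Otimes>\<^sub>M \<gamma>)) = r + 1" .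
  have "(\<integral>p. G (sqrt r * fst p + snd p) \<partial>(P \<Otimes>\<^sub>M \<gamma>)) = \<tau> * (r + 1) / 2 - ln (1 + r) / 2"
    unfolding G_def using int2 by (simp add: E2 PN.prob_space)
  also have "\<dots> = (r - ln (1 + r)) / 2" using \<tau>(3) by (simp add: algebra_simps diff_divide_distrib)
  finally show ?thesis
    using psi_ge[OF r G_meas _ sub] int2 unfolding G_def by simp
qed

text \<open>The Gaussian lower bound behaves like \<open>r^2 / 4\<close> at the origin, which leaves
  no room for a quadratic upper bound with a smaller coefficient.\<close>

lemma threshold_le_one:
  assumes l: "0 < l" and "\<And>r. 0 \<le> r \<Longrightarrow> psi P r \<le> r\<^sup>2 / (4 * l)"
  shows "l \<le> 1"
proof (rule ccontr)
  assume "\<not> l \<le> 1"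
  \<comment> \<open>With this \<open>r\<close> the factor \<open>1 / l\<close> equals
    \<open>1 - r\<close>, so the assumed bound reads \<open>(r^2 - r^3) / 4\<close>, strictly below
    the minorant \<open>r^2 / 4 - r^3 / 6\<close> of the Gaussian bound.\<close>
  define r where "r = (1 - 1 / l)"
  have r: "0 < r" "r \<le> 1" unfolding r_def using \<open>\<not> l \<le> 1\<close> by auto
  have lnb: "ln (1 + r) \<le> r - r\<^sup>2 / 2 + r ^ 3 / 3"
  proof -
    define f :: "real \<Rightarrow> real" where "f = (\<lambda>x. x - x\<^sup>2 / 2 + x ^ 3 / 3 - ln (1 + x))"
    have "f 0 \<le> f r"
    proof (rule DERIV_nonneg_imp_nondecreasing[where f = f and a = 0 and b = r])
      fix x :: real assume x: "0 \<le> x" "x \<le> r"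
      have "(f has_real_derivative (1 - x + x\<^sup>2 - 1 / (1 + x))) (at x)"
        unfolding f_def using x by (auto intro!: derivative_eq_intros simp: power2_eq_square)
      moreover have "1 - x + x\<^sup>2 - 1 / (1 + x) = x ^ 3 / (1 + x)"
        using x by (simp add: field_simps power2_eq_square power3_eq_cube)
      ultimately show "\<exists>y. (f has_real_derivative y) (at x) \<and> 0 \<le> y"
        using x by auto
    qed (use r in auto)
    then show ?thesis unfolding f_def by simp
  qed
  have "(r - ln (1 + r)) / 2 \<le> r\<^sup>2 / (4 * l)"
    using psi_ge_gaussian[of r] assms(2)[of r] r by simp
  also have "r\<^sup>2 / (4 * l) = (r\<^sup>2 - r ^ 3) / 4"
    unfolding r_def using l by (simp add: field_simps power2_eq_square power3_eq_cube)
  finally have up: "(r - ln (1 + r)) / 2 \<le> (r\<^sup>2 - r ^ 3) / 4" .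
  have "c \<le> 0" if "(a - L) / 2 \<le> (b - c) / 4" "L \<le> a - b / 2 + c / 3" for a b c L :: real
    using that by (simp add: field_simps)
  from this[OF up lnb] have "r ^ 3 \<le> 0" .
  then show False using r by (simp add: power3_eq_cube mult_le_0_iff)
qed

lemma psi_le_of_phi_RS:
  assumes l: "0 < l" and "phi_RS P l = 0" and r: "0 \<le> r"
  shows "psi P r \<le> r\<^sup>2 / (4 * l)"
proof -
  \<comment> \<open>The potential is tested at \<open>q = r / l\<close>, where the argument of
    \<open>psi\<close> is \<open>r\<close> and the penalty is \<open>r^2 / (4 l)\<close>.\<close>
  have "ereal (RS_potential P l (r / l)) \<le> phi_RS P l"
    unfolding phi_RS_def using l r by (intro SUP_upper) auto
  then have "RS_potential P l (r / l) \<le> 0" using assms(2) by (simp add: zero_ereal_def)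
  then show ?thesis
    unfolding RS_potential_def using l by (simp add: power_divide) (simp add: power2_eq_square field_simps)
qed

lemma ex_phi_RS_zero:
  assumes "0 \<le> l" "ennreal l < lambda_c P"
  obtains l' where "l < l'" "phi_RS P l' = 0"
proof -
  obtain l' where "l' > 0" "phi_RS P l' = 0" "ennreal l < ennreal l'"
    using assms(2) unfolding lambda_c_def less_SUP_iff by auto
  then show ?thesis using assms(1) that by (auto simp: ennreal_less_iff)
qed

text \<open>For small \<open>s\<close> the moment is governed by the mean logarithm:
  \<open>exp (s l) <= 1 + s l + s^2 l^2 exp |s l| / 2\<close>, and the mean of \<open>l\<close> is
  at most \<open>psi P r\<close>. Boundedness of the prior makes \<open>l\<close> grow at most
  linearly in the noise, so the quadratic remainder is integrable.\<close>

lemma nn_integral_channel_powr: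
  assumes r: "0 \<le> r" and \<sigma>: "\<sigma> = 1 \<or> \<sigma> = - 1" and s: "0 < s" "s \<le> 1"
  shows "(\<integral>\<^sup>+x. (\<integral>\<^sup>+z. ennreal (channel r (\<sigma> * (sqrt r * x) + z) powr s) \<partial>\<gamma>) \<partial>P)
    \<le> ennreal (exp (s * psi P r + s\<^sup>2 * (2 * exp (5 * r * B\<^sup>2))))"
proof -
  define l where "l p = ln (channel r (\<sigma> * (sqrt r * fst p) + snd p))" for p :: "real \<times> real"
  define k where "k = 2 * (sqrt r * B)"
  have k0: "0 \<le> k" unfolding k_def using r B1 by auto
  have [measurable]: "l \<in> borel_measurable (P \<Otimes>\<^sub>M \<gamma>)" unfolding l_def by measurable
  have il: "integrable (P \<Otimes>\<^sub>M \<gamma>) l"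
    unfolding l_def[abs_def] using integrable_ln_channel[OF r, of \<sigma> 1] \<sigma> by auto
  have lb: "\<bar>l (x, z)\<bar> \<le> k * \<bar>z\<bar> / 2 + 3 / 2 * (r * B\<^sup>2)" if x: "\<bar>x\<bar> \<le> B" for x z
  proof -
    have "sqrt r * B * \<bar>\<sigma> * (sqrt r * x) + z\<bar> \<le> sqrt r * B * (sqrt r * B + \<bar>z\<bar>)"
      using r B1 \<sigma> abs_output_le[OF r x, of \<sigma> z] by (intro mult_left_mono) auto
    also have "\<dots> = r * B\<^sup>2 + k * \<bar>z\<bar> / 2"
    proof -
      have "sqrt r * B * (sqrt r * B + \<bar>z\<bar>) = (sqrt r * sqrt r) * (B * B) + sqrt r * B * \<bar>z\<bar>" by (simp add: algebra_simps)
      then show ?thesis unfolding k_def using r by (simp add: power2_eq_square)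
    qed
    finally show ?thesis
      using abs_ln_channel_le[OF r, of "\<sigma> * (sqrt r * x) + z"] unfolding l_def by simp
  qed
  \<comment> \<open>Dominates \<open>exp (2 * |l|)\<close>; writing a sum of two exponentials in
    place of \<open>exp (k * |z|)\<close> allows a closed form. Since
    \<open>k^2 / 2 = 2 r B^2\<close>, the mean is \<open>2 exp (5 r B^2)\<close>.\<close>
  define g where "g z = exp (3 * (r * B\<^sup>2)) * (exp (k * z) + exp ((- k) * z))" for z
  have nng: "(\<integral>\<^sup>+z. ennreal (g z) \<partial>\<gamma>) = ennreal (2 * exp (5 * r * B\<^sup>2))"
  proof -
    have "(\<integral>\<^sup>+z. ennreal (g z) \<partial>\<gamma>) = ennreal (exp (3 * (r * B\<^sup>2))) * ((\<integral>\<^sup>+z. ennreal (exp (k * z)) \<partial>\<gamma>) + (\<integral>\<^sup>+z. ennreal (exp ((- k) * z)) \<partial>\<gamma>))"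
      unfolding g_def by (simp add: ennreal_mult nn_integral_cmult nn_integral_add)
    also have "\<dots> = ennreal (exp (3 * (r * B\<^sup>2)) * (exp (k\<^sup>2 / 2) + exp (k\<^sup>2 / 2)))"
      using nn_integral_exp_std_normal[of k] nn_integral_exp_std_normal[of "- k"]
      by (simp add: ennreal_mult[symmetric] ennreal_plus[symmetric] del: ennreal_plus)
    also have "k\<^sup>2 / 2 = 2 * (r * B\<^sup>2)" unfolding k_def using r by (simp add: power_mult_distrib)
    finally show ?thesis by (simp add: exp_add[symmetric])
  qed
  have ig: "integrable \<gamma> g"
    by (intro integrableI_nonneg) (auto simp: nng, auto simp: g_def[abs_def])
  have Eg: "(\<integral>z. g z \<partial>\<gamma>) = 2 * exp (5 * r * B\<^sup>2)"
    by (subst integral_eq_nn_integral) (auto simp: nng, auto simp: g_def[abs_def])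
  have igp: "integrable (P \<Otimes>\<^sub>M \<gamma>) (\<lambda>p. g (snd p))" by (rule integrable_pair_snd[OF ig])
  have Egp: "(\<integral>p. g (snd p) \<partial>(P \<Otimes>\<^sub>M \<gamma>)) = 2 * exp (5 * r * B\<^sup>2)"
    using PN.integral_fst'[OF igp] by (simp add: Eg prob_UNIV)
  have pt: "exp (s * l p) \<le> 1 + s * l p + s\<^sup>2 * g (snd p)" if p: "\<bar>fst p\<bar> \<le> B" for p
  proof -
    have "(s * l p)\<^sup>2 / 2 * exp \<bar>s * l p\<bar> \<le> s\<^sup>2 * g (snd p)"
    proof -
      have "\<bar>s * l p\<bar> \<le> \<bar>l p\<bar>" using s by (simp add: abs_mult mult_left_le_one_le)
      then have 1: "exp \<bar>s * l p\<bar> \<le> exp \<bar>l p\<bar>" by simp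
      have 2: "(l p)\<^sup>2 / 2 \<le> exp \<bar>l p\<bar>" using exp_lower_Taylor_quadratic[of "\<bar>l p\<bar>"] by simp
      have "(l p)\<^sup>2 / 2 * exp \<bar>s * l p\<bar> \<le> exp \<bar>l p\<bar> * exp \<bar>l p\<bar>"
        using 1 2 by (intro mult_mono) auto
      also have "\<dots> = exp (2 * \<bar>l p\<bar>)" by (simp add: exp_add[symmetric])
      also have "\<dots> \<le> exp (3 * (r * B\<^sup>2) + k * \<bar>snd p\<bar>)"
        using lb[OF p, of "snd p"] by simp
      also have "\<dots> \<le> g (snd p)"
        unfolding g_def exp_add using k0 by (intro mult_left_mono) (cases "0 \<le> snd p"; simp)+
      finally have "s\<^sup>2 * ((l p)\<^sup>2 / 2 * exp \<bar>s * l p\<bar>) \<le> s\<^sup>2 * g (snd p)" by (intro mult_left_mono) auto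
      then show ?thesis by (simp add: power_mult_distrib)
    qed
    then show ?thesis using exp_minus_linear_le[of "s * l p"] by linarith
  qed
  have "(\<integral>\<^sup>+x. (\<integral>\<^sup>+z. ennreal (channel r (\<sigma> * (sqrt r * x) + z) powr s) \<partial>\<gamma>) \<partial>P)
     = (\<integral>\<^sup>+p. ennreal (exp (s * l p)) \<partial>(P \<Otimes>\<^sub>M \<gamma>))"
    using channel_pos[OF r] unfolding l_def
    by (subst N.nn_integral_fst[symmetric]) (auto simp: powr_def less_imp_neq[THEN not_sym])
  also have "\<dots> \<le> (\<integral>\<^sup>+p. ennreal (1 + s * l p + s\<^sup>2 * g (snd p)) \<partial>(P \<Otimes>\<^sub>M \<gamma>))"
    by (intro nn_integral_mono_AE eventually_mono[OF AE_pair_bdd] ennreal_leI pt)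
  also have "\<dots> = ennreal (\<integral>p. 1 + s * l p + s\<^sup>2 * g (snd p) \<partial>(P \<Otimes>\<^sub>M \<gamma>))"
  proof (rule nn_integral_eq_integral)
    show "integrable (P \<Otimes>\<^sub>M \<gamma>) (\<lambda>p. 1 + s * l p + s\<^sup>2 * g (snd p))" using il igp by auto
    show "AE p in P \<Otimes>\<^sub>M \<gamma>. 0 \<le> 1 + s * l p + s\<^sup>2 * g (snd p)"
      using AE_pair_bdd by eventually_elim (meson exp_ge_zero order_trans pt)
  qed
  also have "\<dots> \<le> ennreal (exp (s * psi P r + s\<^sup>2 * (2 * exp (5 * r * B\<^sup>2))))"
  proof (rule ennreal_leI)
    have "(\<integral>p. l p \<partial>(P \<Otimes>\<^sub>M \<gamma>)) \<le> psi P r"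
      unfolding l_def by (rule expectation_ln_channel_le_psi[OF r \<sigma>])
    then have "s * (\<integral>p. l p \<partial>(P \<Otimes>\<^sub>M \<gamma>)) \<le> s * psi P r" using s by (intro mult_left_mono) auto
    moreover have "(\<integral>p. 1 + s * l p + s\<^sup>2 * g (snd p) \<partial>(P \<Otimes>\<^sub>M \<gamma>)) = 1 + s * (\<integral>p. l p \<partial>(P \<Otimes>\<^sub>M \<gamma>)) + s\<^sup>2 * (2 * exp (5 * r * B\<^sup>2))"
      using il igp by (simp add: Egp PN.prob_space)
    ultimately show "(\<integral>p. 1 + s * l p + s\<^sup>2 * g (snd p) \<partial>(P \<Otimes>\<^sub>M \<gamma>)) \<le> exp (s * psi P r + s\<^sup>2 * (2 * exp (5 * r * B\<^sup>2)))"
      using exp_ge_add_one_self[of "s * psi P r + s\<^sup>2 * (2 * exp (5 * r * B\<^sup>2))"] by linarith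
  qed
  finally show ?thesis .
qed

end

section \<open>Restricted partition functions\<close>

lemma finite_upper_pairs [simp]: "finite (upper_pairs N)"
proof (rule finite_subset)
  show "upper_pairs N \<subseteq> {1..N} \<times> {1..N}" by (auto simp: upper_pairs_def)
qed simp

lemma upper_pairs_Suc:
  "upper_pairs (Suc N) = upper_pairs N \<union> (\<lambda>i. (i, Suc N)) ` {1..N}"
  by (auto simp: upper_pairs_def)

lemma sum_upper_pairs:
  fixes c :: "nat \<Rightarrow> real"
  shows "(\<Sum>e\<in>upper_pairs N. c (fst e) * c (snd e)) = ((\<Sum>i\<in>{1..N}. c i)\<^sup>2 - (\<Sum>i\<in>{1..N}. (c i)\<^sup>2)) / 2"
proof (induction N)
  case 0
  have "upper_pairs 0 = {}" by (auto simp: upper_pairs_def)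
  then show ?case by simp
next
  case (Suc N)
  have "(\<Sum>e\<in>upper_pairs (Suc N). c (fst e) * c (snd e))
     = (\<Sum>e\<in>upper_pairs N. c (fst e) * c (snd e)) + (\<Sum>e\<in>(\<lambda>i. (i, Suc N)) ` {1..N}. c (fst e) * c (snd e))"
    unfolding upper_pairs_Suc
  proof (rule sum.union_disjoint)
    show "upper_pairs N \<inter> (\<lambda>i. (i, Suc N)) ` {1..N} = {}" by (auto simp: upper_pairs_def)
  qed simp_all
  also have "(\<Sum>e\<in>(\<lambda>i. (i, Suc N)) ` {1..N}. c (fst e) * c (snd e)) = (\<Sum>i\<in>{1..N}. c i) * c (Suc N)"
    by (subst sum.reindex) (auto simp: inj_on_def sum_distrib_right)
  finally show ?case
    unfolding Suc.IH by (simp add: power2_sum field_simps)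
qed

section \<open>Spikes, features and overlaps\<close>

context bounded_prior
begin

definition prior :: "nat \<Rightarrow> (nat \<Rightarrow> real) measure" where
  "prior N = (\<Pi>\<^sub>M i\<in>{1..N}. P)"

definition feat :: "real \<Rightarrow> nat \<Rightarrow> (nat \<Rightarrow> real) \<Rightarrow> nat \<times> nat \<Rightarrow> real" where
  "feat l N x e = sqrt (l / real N) * x (fst e) * x (snd e)"

definition ov :: "nat \<Rightarrow> (nat \<Rightarrow> real) \<Rightarrow> (nat \<Rightarrow> real) \<Rightarrow> real" where
  "ov N x y = (\<Sum>i\<in>{1..N}. x i * y i) / real N"

definition corr :: "real \<Rightarrow> nat \<Rightarrow> (nat \<Rightarrow> real) \<Rightarrow> (nat \<Rightarrow> real) \<Rightarrow> real" where
  "corr l N x y = (\<Sum>e\<in>upper_pairs N. feat l N x e * feat l N y e)"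

text \<open>The event of full prior measure on which almost-sure bounds on the coordinates become
  pointwise ones.\<close>

definition cube :: "nat \<Rightarrow> (nat \<Rightarrow> real) set" where
  "cube N = {x \<in> space (prior N). \<forall>i\<in>{1..N}. \<bar>x i\<bar> \<le> B}"

lemma sets_prior [measurable_cong]: "sets (prior N) = sets (\<Pi>\<^sub>M i\<in>{1..N}. (borel :: real measure))"
  unfolding prior_def by (intro sets_PiM_cong) auto

lemma prob_space_prior: "prob_space (prior N)"
  unfolding prior_def by (intro prob_space_PiM prob_space_axioms)

lemma measurable_feat [measurable]: "e \<in> upper_pairs N \<Longrightarrow> (\<lambda>x. feat l N x e) \<in> borel_measurable (prior N)"
  unfolding feat_def by (auto simp: upper_pairs_def) measurable

lemma measurable_prior_component:
  assumes g: "g \<in> measurable M (prior N)" and i: "i \<in> {1..N}"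
  shows "(\<lambda>x. g x i) \<in> borel_measurable M"
proof -
  have "g \<in> measurable M (\<Pi>\<^sub>M i\<in>{1..N}. (borel :: real measure))"
    using g measurable_cong_sets[OF refl sets_prior[of N], of M] by simp
  then show ?thesis using i by measurable
qed

lemma measurable_ov [measurable]:
  assumes "f \<in> measurable M (prior N)" "g \<in> measurable M (prior N)"
  shows "(\<lambda>p. ov N (f p) (g p)) \<in> borel_measurable M"
  unfolding ov_def using measurable_prior_component[OF assms(1)] measurable_prior_component[OF assms(2)] by measurable

lemma measurable_corr [measurable]:
  assumes "f \<in> measurable M (prior N)" "g \<in> measurable M (prior N)"
  shows "(\<lambda>p. corr l N (f p) (g p)) \<in> borel_measurable M"
  unfolding corr_def using measurable_compose[OF assms(1) measurable_feat] measurable_compose[OF assms(2) measurable_feat]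
  by measurable

lemma measurable_feat_wick [measurable]:
  assumes "f \<in> measurable M (prior N)" "g \<in> measurable M (Gauss (upper_pairs N))"
  shows "(\<lambda>p. wick (upper_pairs N) (feat l N (f p)) (g p)) \<in> borel_measurable M"
  by (intro measurable_wick_pair measurable_compose[OF assms(1) measurable_feat] assms(2))

lemma cube_sets [measurable]: "cube N \<in> sets (prior N)"
  unfolding cube_def by measurable

lemma AE_cube: "AE x in prior N. x \<in> cube N"
proof -
  have "AE x in prior N. \<bar>x i\<bar> \<le> B" if "i \<in> {1..N}" for i
    unfolding prior_def by (rule AE_PiM_component) (use that bdd prob_space_axioms in auto)
  then have "AE x in prior N. \<forall>i\<in>{1..N}. \<bar>x i\<bar> \<le> B" by (subst AE_finite_all) auto
  then show ?thesis using AE_space by eventually_elim (auto simp: cube_def)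
qed

text \<open>The square of the overlap runs over all ordered pairs; halving it counts each pair
  \<open>i < j\<close> once and leaves half of the diagonal to be removed. That diagonal is the last
  sum, and for bounded spikes its contribution is bounded uniformly in \<open>N\<close>.\<close>

lemma corr_eq:
  assumes "0 \<le> l" "0 < N"
  shows "corr l N x y = l * real N * (ov N x y)\<^sup>2 / 2 - l / (2 * real N) * (\<Sum>i\<in>{1..N}. (x i * y i)\<^sup>2)"
proof -
  have "corr l N x y = (\<Sum>e\<in>upper_pairs N. l / real N * ((x (fst e) * y (fst e)) * (x (snd e) * y (snd e))))"
    unfolding corr_def feat_def
  proof (rule sum.cong[OF refl])
    fix e
    have "sqrt (l / real N) * sqrt (l / real N) = l / real N" using assms by simp
    then show "sqrt (l / real N) * x (fst e) * x (snd e) * (sqrt (l / real N) * y (fst e) * y (snd e)) = l / real N * ((x (fst e) * y (fst e)) * (x (snd e) * y (snd e)))"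
      by (simp add: mult_ac) (metis (no_types, lifting) mult.assoc mult.commute)
  qed
  also have "\<dots> = l / real N * (((\<Sum>i\<in>{1..N}. x i * y i)\<^sup>2 - (\<Sum>i\<in>{1..N}. (x i * y i)\<^sup>2)) / 2)"
    unfolding sum_distrib_left[symmetric] sum_upper_pairs[of "\<lambda>i. x i * y i"] ..
  also have "\<dots> = l * real N * (ov N x y)\<^sup>2 / 2 - l / (2 * real N) * (\<Sum>i\<in>{1..N}. (x i * y i)\<^sup>2)"
    unfolding ov_def using assms by (simp add: power_divide power2_eq_square field_simps)
  finally show ?thesis .
qed

lemma corr_le: "0 \<le> l \<Longrightarrow> 0 < N \<Longrightarrow> corr l N x y \<le> l * real N * (ov N x y)\<^sup>2 / 2"
  unfolding corr_eq by (simp add: sum_nonneg)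

lemma corr_ge:
  assumes l: "0 \<le> l" and N: "0 < N" and xy: "x \<in> cube N" "y \<in> cube N"
  shows "l * real N * (ov N x y)\<^sup>2 / 2 - l * B ^ 4 / 2 \<le> corr l N x y"
proof -
  have "(x i * y i)\<^sup>2 \<le> B ^ 4" if "i \<in> {1..N}" for i
  proof -
    have "\<bar>x i * y i\<bar> \<le> B * B" unfolding abs_mult using xy that by (intro mult_mono) (auto simp: cube_def)
    then have "\<bar>x i * y i\<bar>\<^sup>2 \<le> (B * B)\<^sup>2" by (intro power_mono) auto
    then show ?thesis by (simp add: power4_eq_xxxx power2_eq_square mult_ac)
  qed
  then have "(\<Sum>i\<in>{1..N}. (x i * y i)\<^sup>2) \<le> real N * B ^ 4"
    using sum_bounded_above[of "{1..N}" "\<lambda>i. (x i * y i)\<^sup>2" "B ^ 4"] by simp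
  then have "l / (2 * real N) * (\<Sum>i\<in>{1..N}. (x i * y i)\<^sup>2) \<le> l / (2 * real N) * (real N * B ^ 4)"
    using l by (intro mult_left_mono) auto
  then show ?thesis unfolding corr_eq[OF l N] using N by simp
qed

lemma abs_ov_le:
  assumes N: "0 < N" and xy: "x \<in> cube N" "y \<in> cube N"
  shows "\<bar>ov N x y\<bar> \<le> B\<^sup>2"
proof -
  have "\<bar>\<Sum>i\<in>{1..N}. x i * y i\<bar> \<le> (\<Sum>i\<in>{1..N}. \<bar>x i * y i\<bar>)" by (rule sum_abs)
  also have "\<dots> \<le> real N * B\<^sup>2"
  proof -
    have "\<bar>x i * y i\<bar> \<le> B\<^sup>2" if "i \<in> {1..N}" for i
      unfolding abs_mult power2_eq_square using xy that by (intro mult_mono) (auto simp: cube_def)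
    then show ?thesis using sum_bounded_above[of "{1..N}" "\<lambda>i. \<bar>x i * y i\<bar>" "B\<^sup>2"] by simp
  qed
  finally show ?thesis unfolding ov_def using N by (simp add: divide_le_eq mult.commute)
qed

section \<open>Partition functions restricted to an overlap window\<close>

definition ov_bin :: "nat \<Rightarrow> real \<Rightarrow> real \<Rightarrow> (nat \<Rightarrow> real) \<Rightarrow> (nat \<Rightarrow> real) set" where
  "ov_bin N m d y = {x \<in> cube N. \<bar>ov N x y - m\<bar> \<le> d}"

text \<open>Written in planted coordinates: \<open>y\<close> is the true spike and \<open>w\<close>
  the pure noise. Substituting the observation into the likelihood ratio of \<open>x\<close>
  produces the factor \<open>exp (corr l N x y)\<close>.\<close>

definition Zbin :: "real \<Rightarrow> nat \<Rightarrow> real \<Rightarrow> real \<Rightarrow> (nat \<Rightarrow> real) \<Rightarrow> (nat \<times> nat \<Rightarrow> real) \<Rightarrow> real" where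
  "Zbin l N m d y w = (\<integral>x. indicator (ov_bin N m d y) x * (exp (corr l N x y) * wick (upper_pairs N) (feat l N x) w) \<partial>prior N)"

lemma ov_bin_sets [measurable]: "y \<in> space (prior N) \<Longrightarrow> ov_bin N m d y \<in> sets (prior N)"
  unfolding ov_bin_def by measurable

lemma integrable_prod_prior:
  fixes f :: "nat \<Rightarrow> real \<Rightarrow> real"
  assumes "\<And>i. i \<in> {1..N} \<Longrightarrow> integrable P (f i)"
  shows "integrable (prior N) (\<lambda>x. \<Prod>i\<in>{1..N}. f i (x i))"
    and "(\<integral>x. (\<Prod>i\<in>{1..N}. f i (x i)) \<partial>prior N) = (\<Prod>i\<in>{1..N}. \<integral>x. f i x \<partial>P)"
proof -
  interpret product_sigma_finite "\<lambda>_::nat. P" by (rule product_sigma_finite.intro) (rule sigma_finite_measure_axioms)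
  show "integrable (prior N) (\<lambda>x. \<Prod>i\<in>{1..N}. f i (x i))"
    unfolding prior_def by (rule product_integrable_prod) (use assms in auto)
  show "(\<integral>x. (\<Prod>i\<in>{1..N}. f i (x i)) \<partial>prior N) = (\<Prod>i\<in>{1..N}. \<integral>x. f i x \<partial>P)"
    unfolding prior_def by (rule product_integral_prod) (use assms in auto)
qed

lemma nn_integral_prod_prior:
  assumes "\<And>i. i \<in> {1..N} \<Longrightarrow> f i \<in> borel_measurable P"
  shows "(\<integral>\<^sup>+x. (\<Prod>i\<in>{1..N}. f i (x i)) \<partial>prior N) = (\<Prod>i\<in>{1..N}. \<integral>\<^sup>+x. f i x \<partial>P)"
proof -
  interpret product_sigma_finite "\<lambda>_::nat. P" by (rule product_sigma_finite.intro) (rule sigma_finite_measure_axioms)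
  show ?thesis unfolding prior_def by (rule product_nn_integral_prod) (use assms in auto)
qed

lemma nn_integral_prod_Gauss:
  assumes "finite I" "\<And>i. i \<in> I \<Longrightarrow> f i \<in> borel_measurable borel"
  shows "(\<integral>\<^sup>+x. (\<Prod>i\<in>I. f i (x i)) \<partial>Gauss I) = (\<Prod>i\<in>I. \<integral>\<^sup>+x. f i x \<partial>\<gamma>)"
proof -
  interpret product_sigma_finite "\<lambda>_. \<gamma>" by (rule product_sigma_finite.intro) (rule N.sigma_finite_measure_axioms)
  show ?thesis unfolding Gauss_def by (rule product_nn_integral_prod) (use assms in auto)
qed

definition lin_feat :: "real \<Rightarrow> (nat \<Rightarrow> real) \<Rightarrow> nat \<Rightarrow> real" where
  "lin_feat r x i = sqrt r * x i"

lemma measurable_lin_feat [measurable]: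
  assumes "f \<in> measurable M (prior N)" "i \<in> {1..N}"
  shows "(\<lambda>p. lin_feat r (f p) i) \<in> borel_measurable M"
  unfolding lin_feat_def using measurable_prior_component[OF assms] by measurable

text \<open>Presents the restricted integrals as plain integrals over a finite measure, the prior
  tilted by the planted interaction. It is the base measure of the Gaussian comparison, which
  thereby leaves the interaction with \<open>y\<close> untouched.\<close>

lemma integral_ov_bin_density:
  assumes y: "y \<in> space (prior N)" and [measurable]: "f \<in> borel_measurable (prior N)"
  shows "(\<integral>x. f x \<partial>restrict_space (density (prior N) (\<lambda>x. ennreal (exp (corr l N x y)))) (ov_bin N m d y))
    = (\<integral>x. indicator (ov_bin N m d y) x * (exp (corr l N x y) * f x) \<partial>prior N)"
proof -
  note [measurable] = y
  have "(\<integral>x. f x \<partial>restrict_space (density (prior N) (\<lambda>x. ennreal (exp (corr l N x y)))) (ov_bin N m d y))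
     = (\<integral>x. indicator (ov_bin N m d y) x *\<^sub>R f x \<partial>density (prior N) (\<lambda>x. ennreal (exp (corr l N x y))))"
    using ov_bin_sets[OF y, of m d] by (intro integral_restrict_space) (auto simp: sets.Int_space_eq2)
  also have "\<dots> = (\<integral>x. exp (corr l N x y) *\<^sub>R (indicator (ov_bin N m d y) x *\<^sub>R f x) \<partial>prior N)"
    by (rule integral_density) auto
  finally show ?thesis by (simp add: mult_ac)
qed

text \<open>For two replicas with overlap \<open>R\<close> the scalar kernel is
  \<open>l |m| N R\<close> and the matrix kernel at least \<open>l N R^2 / 2 - l B^4 / 2\<close>.
  The inequality \<open>|m| R <= (R^2 + m^2) / 2\<close> makes the latter the larger one up to the
  constant \<open>\<kappa>\<close>; it is an equality where the replicas have mutual overlap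
  \<open>|m|\<close>.\<close>

lemma nn_integral_Zbin_le:
  assumes l: "0 < l" and N: "0 < N" and y: "y \<in> cube N" and s: "0 < s" "s < 1"
  shows "(\<integral>\<^sup>+w. ennreal (Zbin l N m d y w powr s) \<partial>Gauss (upper_pairs N))
    \<le> ennreal (exp (s * (1 - s) / 2 * (l * real N * m\<^sup>2 / 2 + l * B ^ 4 / 2))) *
      (\<integral>\<^sup>+g. ennreal ((\<integral>x. indicator (ov_bin N m d y) x * (exp (corr l N x y) * wick {1..N} (lin_feat (l * \<bar>m\<bar>) x) g) \<partial>prior N) powr s) \<partial>Gauss {1..N})"
proof -
  let ?D = "ov_bin N m d y" and ?E = "upper_pairs N"
  let ?Q = "density (prior N) (\<lambda>x. ennreal (exp (corr l N x y)))"
  let ?M = "restrict_space ?Q ?D"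
  have ysp [measurable]: "y \<in> space (prior N)" using y unfolding cube_def by auto
  have D: "?D \<in> sets (prior N)" by (rule ov_bin_sets[OF ysp])
  have sub: "?D \<subseteq> space (prior N)" using sets.sets_into_space[OF D] .
  have spM: "space ?M = ?D" using sub by (auto simp: space_restrict_space)
  have Dbox: "x \<in> cube N" if "x \<in> ?D" for x using that unfolding ov_bin_def by auto
  \<comment> \<open>Any common bound for the squared lengths of both features would do: it enters
    the speed of the interpolation and disappears in the limit.\<close>
  define A where "A = l * real N * B ^ 4 + l * \<bar>m\<bar> * (real N * B\<^sup>2)"
  define \<kappa> where "\<kappa> = l * real N * m\<^sup>2 / 2 + l * B ^ 4 / 2"
  have corrB: "\<bar>corr l N x z\<bar> \<le> l * real N * B ^ 4" if "x \<in> cube N" "z \<in> cube N" for x z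
  proof -
    have "\<bar>ov N x z\<bar>\<^sup>2 \<le> (B\<^sup>2)\<^sup>2" using abs_ov_le[OF N that] by (intro power_mono) auto
    then have "(ov N x z)\<^sup>2 \<le> B ^ 4" by simp
    then have 1: "l * real N * (ov N x z)\<^sup>2 / 2 \<le> l * real N * B ^ 4 / 2"
      using l by (intro divide_right_mono mult_left_mono) auto
    have "l * 1 * B ^ 4 \<le> l * real N * B ^ 4" using N l by (intro mult_right_mono mult_left_mono) auto
    moreover have "0 \<le> l * real N * (ov N x z)\<^sup>2" "0 \<le> l * real N * B ^ 4" using l B1 by auto
    ultimately show ?thesis using corr_le[of l N x z, OF less_imp_le[OF l] N] corr_ge[OF less_imp_le[OF l] N that] 1 unfolding abs_le_iff by linarith
  qed
  have fin: "finite_measure ?M"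
  proof (rule finite_measureI)
    have "emeasure ?M ?D = emeasure ?Q ?D"
      by (rule emeasure_restrict_space) (use D in \<open>auto simp: sets.Int_space_eq2\<close>)
    then have "emeasure ?M (space ?M) = emeasure ?Q ?D" by (simp only: spM)
    also have "\<dots> = (\<integral>\<^sup>+x. ennreal (exp (corr l N x y)) * indicator ?D x \<partial>prior N)"
      by (rule emeasure_density) (use D in auto)
    also have "\<dots> \<le> (\<integral>\<^sup>+x. ennreal (exp (l * real N * B ^ 4)) \<partial>prior N)"
    proof (rule nn_integral_mono)
      fix x
      show "ennreal (exp (corr l N x y)) * indicator ?D x \<le> ennreal (exp (l * real N * B ^ 4))"
        using corrB[OF Dbox y, of x] by (auto simp: indicator_def intro!: ennreal_leI)
    qed
    also have "\<dots> < \<top>" using prob_space.emeasure_space_1[OF prob_space_prior] by simp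
    finally show "emeasure ?M (space ?M) \<noteq> \<infinity>" by simp
  qed
  have lin_feat_sq: "(\<Sum>i\<in>{1..N}. lin_feat (l * \<bar>m\<bar>) x i * lin_feat (l * \<bar>m\<bar>) z i) = l * \<bar>m\<bar> * (real N * ov N x z)" for x z
  proof -
    have "lin_feat (l * \<bar>m\<bar>) x i * lin_feat (l * \<bar>m\<bar>) z i = l * \<bar>m\<bar> * (x i * z i)" for i
    proof -
      have "sqrt (l * \<bar>m\<bar>) * sqrt (l * \<bar>m\<bar>) = l * \<bar>m\<bar>" using l by simp
      then show ?thesis unfolding lin_feat_def by (metis (no_types, lifting) mult.assoc mult.left_commute)
    qed
    then show ?thesis unfolding ov_def using N by (simp add: sum_distrib_left[symmetric])
  qed
  interpret gc: gaussian_comparison ?M ?E "{1..N}" "feat l N" "lin_feat (l * \<bar>m\<bar>)" A \<kappa> s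
  proof (intro gaussian_comparison.intro gaussian_comparison_axioms.intro fin)
    show "(\<lambda>x. feat l N x e) \<in> borel_measurable ?M" if "e \<in> ?E" for e
      using measurable_feat[OF that] by (intro measurable_restrict_space1) simp
    show "(\<lambda>x. lin_feat (l * \<bar>m\<bar>) x i) \<in> borel_measurable ?M" if "i \<in> {1..N}" for i
      using measurable_lin_feat[OF measurable_ident that, of "l * \<bar>m\<bar>"] by (intro measurable_restrict_space1) simp
    show "(\<Sum>e\<in>?E. (feat l N x e)\<^sup>2) \<le> A" if "x \<in> space ?M" for x
    proof -
      have "(\<Sum>e\<in>?E. (feat l N x e)\<^sup>2) = corr l N x x" unfolding corr_def by (simp add: power2_eq_square)
      also have "\<dots> \<le> l * real N * B ^ 4" using corrB[of x x] Dbox[of x] that unfolding spM by auto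
      also have "\<dots> \<le> A" unfolding A_def using l by simp
      finally show ?thesis .
    qed
    show "(\<Sum>i\<in>{1..N}. (lin_feat (l * \<bar>m\<bar>) x i)\<^sup>2) \<le> A" if "x \<in> space ?M" for x
    proof -
      have "(\<Sum>i\<in>{1..N}. (lin_feat (l * \<bar>m\<bar>) x i)\<^sup>2) = l * \<bar>m\<bar> * (real N * ov N x x)"
        unfolding lin_feat_sq[symmetric] by (simp add: power2_eq_square)
      also have "\<dots> \<le> l * \<bar>m\<bar> * (real N * B\<^sup>2)"
        using abs_ov_le[OF N, of x x] Dbox[of x] that l unfolding spM by (intro mult_left_mono) auto
      also have "\<dots> \<le> A" unfolding A_def using l B1 by simp
      finally show ?thesis .
    qed
    show "0 \<le> A" unfolding A_def using l by simp
    show "0 \<le> \<kappa>" unfolding \<kappa>_def using l by simp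
    show "(\<Sum>i\<in>{1..N}. lin_feat (l * \<bar>m\<bar>) x i * lin_feat (l * \<bar>m\<bar>) z i) \<le> (\<Sum>i\<in>?E. feat l N x i * feat l N z i) + \<kappa>"
      if "x \<in> space ?M" "z \<in> space ?M" for x z
    proof -
      have xz: "x \<in> cube N" "z \<in> cube N" using that Dbox unfolding spM by auto
      define R where "R = ov N x z"
      have "\<bar>m\<bar> * R \<le> R\<^sup>2 / 2 + m\<^sup>2 / 2"
        using sum_squares_bound[of "\<bar>m\<bar>" R] by simp
      then have "l * real N * (\<bar>m\<bar> * R) \<le> l * real N * (R\<^sup>2 / 2 + m\<^sup>2 / 2)" using l by (intro mult_left_mono) auto
      then show ?thesis
        using corr_ge[OF _ N xz, of l] l unfolding lin_feat_sq corr_def[symmetric] \<kappa>_def R_def[symmetric]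
        by (simp add: algebra_simps)
    qed
  qed (use s in auto)
  have i1: "(\<integral>x. wick ?E (feat l N x) w \<partial>?M) = Zbin l N m d y w" if [measurable]: "w \<in> space (Gauss ?E)" for w
    unfolding Zbin_def by (rule integral_ov_bin_density[OF ysp]) measurable
  have i2: "(\<integral>x. wick {1..N} (lin_feat (l * \<bar>m\<bar>) x) g \<partial>?M) = (\<integral>x. indicator ?D x * (exp (corr l N x y) * wick {1..N} (lin_feat (l * \<bar>m\<bar>) x) g) \<partial>prior N)"
    if g: "g \<in> space (Gauss {1..N})" for g
  proof (rule integral_ov_bin_density[OF ysp])
    show "(\<lambda>x. wick {1..N} (lin_feat (l * \<bar>m\<bar>) x) g) \<in> borel_measurable (prior N)"
      using g by (intro measurable_wick_pair measurable_lin_feat) auto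
  qed
  show ?thesis
  proof -
    have "(\<integral>\<^sup>+w. ennreal ((\<integral>x. wick ?E (feat l N x) w \<partial>?M) powr s) \<partial>Gauss ?E) = (\<integral>\<^sup>+w. ennreal (Zbin l N m d y w powr s) \<partial>Gauss ?E)"
      by (rule nn_integral_cong) (simp only: i1)
    moreover have "(\<integral>\<^sup>+g. ennreal ((\<integral>x. wick {1..N} (lin_feat (l * \<bar>m\<bar>) x) g \<partial>?M) powr s) \<partial>Gauss {1..N})
      = (\<integral>\<^sup>+g. ennreal ((\<integral>x. indicator ?D x * (exp (corr l N x y) * wick {1..N} (lin_feat (l * \<bar>m\<bar>) x) g) \<partial>prior N) powr s) \<partial>Gauss {1..N})"
      by (rule nn_integral_cong) (simp only: i2)
    ultimately show ?thesis
      using gc.gaussian_comparison_powr unfolding \<kappa>_def by (simp only:)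
  qed
qed

text \<open>Inside the window \<open>R^2 = (R - m)^2 + 2 m R - m^2\<close> is at most
  \<open>d^2 + 2 m R - m^2\<close>. The planted interaction thus becomes linear in \<open>R\<close>,
  and after extension to the whole prior the integral factorises into scalar channels with signal
  sign \<open>sgn m\<close>.\<close>

lemma decoupled_le:
  assumes l: "0 < l" and N: "0 < N" and y: "y \<in> cube N"
  shows "(\<integral>x. indicator (ov_bin N m d y) x * (exp (corr l N x y) * wick {1..N} (lin_feat (l * \<bar>m\<bar>) x) g) \<partial>prior N)
    \<le> exp (real N * (l * d\<^sup>2 / 2 - l * m\<^sup>2 / 2)) *
      (\<Prod>i\<in>{1..N}. channel (l * \<bar>m\<bar>) (sgn m * (sqrt (l * \<bar>m\<bar>) * y i) + g i))"
proof -
  define r where "r = l * \<bar>m\<bar>"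
  have r: "0 \<le> r" unfolding r_def using l by simp
  have rm: "r * sgn m = l * m" unfolding r_def by (simp add: sgn_if abs_if)
  let ?f = "\<lambda>i t. exp (sqrt r * (sgn m * (sqrt r * y i) + g i) * t - r / 2 * t\<^sup>2)"
  have ysp: "y \<in> space (prior N)" using y unfolding cube_def by auto
  have int: "integrable (prior N) (\<lambda>x. \<Prod>i\<in>{1..N}. ?f i (x i))" and eq: "(\<integral>x. (\<Prod>i\<in>{1..N}. ?f i (x i)) \<partial>prior N) = (\<Prod>i\<in>{1..N}. channel r (sgn m * (sqrt r * y i) + g i))"
    using integrable_prod_prior[of N ?f] integrable_channel[OF r] unfolding channel_def by auto
  have prod: "(\<Prod>i\<in>{1..N}. ?f i (x i)) = exp (l * m * (real N * ov N x y)) * wick {1..N} (lin_feat r x) g" for x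
  proof -
    have e: "sqrt r * (sgn m * (sqrt r * y i) + g i) * t - r / 2 * t\<^sup>2 = l * m * (t * y i) + (sqrt r * t * g i - (sqrt r * t)\<^sup>2 / 2)" for i t
    proof -
      have "sqrt r * (sgn m * (sqrt r * y i) + g i) * t = (sqrt r * sqrt r) * sgn m * (t * y i) + sqrt r * t * g i"
        by (simp add: algebra_simps)
      then show ?thesis using r rm by (simp add: power_mult_distrib)
    qed
    show ?thesis
      unfolding e exp_sum[OF finite_atLeastAtMost, symmetric] wick_def lin_feat_def exp_add[symmetric] ov_def
      using N by (simp add: sum.distrib sum_subtractf sum_divide_distrib sum_distrib_left)
  qed
  have pt: "indicator (ov_bin N m d y) x * (exp (corr l N x y) * wick {1..N} (lin_feat r x) g)
     \<le> exp (real N * (l * d\<^sup>2 / 2 - l * m\<^sup>2 / 2)) * (\<Prod>i\<in>{1..N}. ?f i (x i))" for x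
  proof (cases "x \<in> ov_bin N m d y")
    case True
    define R where "R = ov N x y"
    have "\<bar>R - m\<bar>\<^sup>2 \<le> d\<^sup>2" using True unfolding ov_bin_def R_def by (intro power_mono) auto
    then have "l * real N / 2 * (R - m)\<^sup>2 \<le> l * real N / 2 * d\<^sup>2" using l by (intro mult_left_mono) auto
    moreover have "l * real N * R\<^sup>2 / 2 = l * real N / 2 * (R - m)\<^sup>2 + l * m * (real N * R) - real N * (l * m\<^sup>2 / 2)"
      by (simp add: power2_diff field_simps power2_eq_square)
    moreover have "corr l N x y \<le> l * real N * R\<^sup>2 / 2" unfolding R_def by (rule corr_le) (use l N in auto)
    ultimately have "corr l N x y \<le> real N * (l * d\<^sup>2 / 2 - l * m\<^sup>2 / 2) + l * m * (real N * R)"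
      by (simp add: algebra_simps)
    then have "exp (corr l N x y) \<le> exp (real N * (l * d\<^sup>2 / 2 - l * m\<^sup>2 / 2)) * exp (l * m * (real N * R))"
      unfolding exp_add[symmetric] by simp
    then have "exp (corr l N x y) * wick {1..N} (lin_feat r x) g \<le> exp (real N * (l * d\<^sup>2 / 2 - l * m\<^sup>2 / 2)) * exp (l * m * (real N * R)) * wick {1..N} (lin_feat r x) g"
      by (intro mult_right_mono) auto
    then show ?thesis using True unfolding prod R_def by (simp add: mult_ac)
  qed (auto intro!: mult_nonneg_nonneg prod_nonneg)
  have "(\<integral>x. indicator (ov_bin N m d y) x * (exp (corr l N x y) * wick {1..N} (lin_feat r x) g) \<partial>prior N)
     \<le> (\<integral>x. exp (real N * (l * d\<^sup>2 / 2 - l * m\<^sup>2 / 2)) * (\<Prod>i\<in>{1..N}. ?f i (x i)) \<partial>prior N)"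
    by (rule integral_mono_AE') (use int pt in \<open>auto intro!: AE_I2 mult_nonneg_nonneg prod_nonneg\<close>)
  then show ?thesis unfolding eq[symmetric] r_def[symmetric] using int by simp
qed

text \<open>Comparison, decoupling and the scalar moment combined. To first order in
  \<open>s\<close> and up to the window width, the exponent per coordinate is
  \<open>s (l m^2 / 4 - l m^2 / 2 + psi (l |m|))\<close>, that is,
  \<open>s * RS_potential P l |m|\<close>.\<close>

lemma Zbin_moment:
  assumes l: "0 < l" and N: "0 < N" and m: "m \<noteq> 0" and s: "0 < s" "s < 1"
  shows "(\<integral>\<^sup>+y. (\<integral>\<^sup>+w. ennreal (Zbin l N m d y w powr s) \<partial>Gauss (upper_pairs N)) \<partial>prior N)
    \<le> ennreal (exp (s * (1 - s) / 2 * (l * real N * m\<^sup>2 / 2 + l * B ^ 4 / 2)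
        + s * (real N * (l * d\<^sup>2 / 2 - l * m\<^sup>2 / 2))
        + real N * (s * psi P (l * \<bar>m\<bar>) + s\<^sup>2 * (2 * exp (5 * (l * \<bar>m\<bar>) * B\<^sup>2)))))"
proof -
  define r where "r = l * \<bar>m\<bar>"
  have r: "0 \<le> r" unfolding r_def using l by simp
  define k where "k = s * (1 - s) / 2 * (l * real N * m\<^sup>2 / 2 + l * B ^ 4 / 2)"
  define h where "h = real N * (l * d\<^sup>2 / 2 - l * m\<^sup>2 / 2)"
  define c where "c t z = channel r (sgn m * (sqrt r * t) + z)" for t z
  have cpos: "0 < c t z" for t z unfolding c_def by (rule channel_pos[OF r])
  have [measurable]: "(\<lambda>p. c (f p) (g p)) \<in> borel_measurable M" if [measurable]: "f \<in> borel_measurable M" "g \<in> borel_measurable M" for f g and M :: "'m measure"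
    unfolding c_def by measurable
  have inner: "(\<integral>\<^sup>+w. ennreal (Zbin l N m d y w powr s) \<partial>Gauss (upper_pairs N))
     \<le> ennreal (exp (k + s * h)) * (\<Prod>i\<in>{1..N}. \<integral>\<^sup>+z. ennreal (c (y i) z powr s) \<partial>\<gamma>)" if y: "y \<in> cube N" for y
  proof -
    have "(\<integral>\<^sup>+w. ennreal (Zbin l N m d y w powr s) \<partial>Gauss (upper_pairs N))
      \<le> ennreal (exp k) * (\<integral>\<^sup>+g. ennreal ((\<integral>x. indicator (ov_bin N m d y) x * (exp (corr l N x y) * wick {1..N} (lin_feat r x) g) \<partial>prior N) powr s) \<partial>Gauss {1..N})"
      unfolding k_def r_def by (rule nn_integral_Zbin_le[OF l N y s])
    also have "\<dots> \<le> ennreal (exp k) * (\<integral>\<^sup>+g. ennreal (exp (s * h)) * (\<Prod>i\<in>{1..N}. ennreal (c (y i) (g i) powr s)) \<partial>Gauss {1..N})"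
    proof (intro mult_left_mono nn_integral_mono)
      fix g
      have "(\<integral>x. indicator (ov_bin N m d y) x * (exp (corr l N x y) * wick {1..N} (lin_feat r x) g) \<partial>prior N) powr s
        \<le> (exp h * (\<Prod>i\<in>{1..N}. c (y i) (g i))) powr s"
      proof (rule powr_mono2)
        show "0 \<le> (\<integral>x. indicator (ov_bin N m d y) x * (exp (corr l N x y) * wick {1..N} (lin_feat r x) g) \<partial>prior N)"
          by (intro integral_nonneg_AE) auto
        show "(\<integral>x. indicator (ov_bin N m d y) x * (exp (corr l N x y) * wick {1..N} (lin_feat r x) g) \<partial>prior N) \<le> exp h * (\<Prod>i\<in>{1..N}. c (y i) (g i))"
          using decoupled_le[OF l N y, of m d g] unfolding r_def h_def c_def .
      qed (use s in auto)
      also have "\<dots> = exp (s * h) * (\<Prod>i\<in>{1..N}. c (y i) (g i) powr s)"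
        using cpos by (simp add: powr_mult prod_nonneg less_imp_le prod_powr_distrib exp_powr_real mult.commute)
      finally have "ennreal ((\<integral>x. indicator (ov_bin N m d y) x * (exp (corr l N x y) * wick {1..N} (lin_feat r x) g) \<partial>prior N) powr s)
        \<le> ennreal (exp (s * h) * (\<Prod>i\<in>{1..N}. c (y i) (g i) powr s))" by (rule ennreal_leI)
      also have "\<dots> = ennreal (exp (s * h)) * (\<Prod>i\<in>{1..N}. ennreal (c (y i) (g i) powr s))"
        by (simp add: ennreal_mult prod_nonneg prod_ennreal)
      finally show "ennreal ((\<integral>x. indicator (ov_bin N m d y) x * (exp (corr l N x y) * wick {1..N} (lin_feat r x) g) \<partial>prior N) powr s)
        \<le> \<dots>" .
    qed simp
    also have "\<dots> = ennreal (exp k) * (ennreal (exp (s * h)) * (\<integral>\<^sup>+g. (\<Prod>i\<in>{1..N}. ennreal (c (y i) (g i) powr s)) \<partial>Gauss {1..N}))"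
    proof (intro arg_cong2[where f = "(*)"] refl nn_integral_cmult)
      show "(\<lambda>g. \<Prod>i\<in>{1..N}. ennreal (c (y i) (g i) powr s)) \<in> borel_measurable (Gauss {1..N})" by measurable
    qed
    also have "(\<integral>\<^sup>+g. (\<Prod>i\<in>{1..N}. ennreal (c (y i) (g i) powr s)) \<partial>Gauss {1..N}) = (\<Prod>i\<in>{1..N}. \<integral>\<^sup>+z. ennreal (c (y i) z powr s) \<partial>\<gamma>)"
      by (rule nn_integral_prod_Gauss) auto
    finally show ?thesis by (simp add: exp_add ennreal_mult mult_ac)
  qed
  have "(\<integral>\<^sup>+y. (\<integral>\<^sup>+w. ennreal (Zbin l N m d y w powr s) \<partial>Gauss (upper_pairs N)) \<partial>prior N)
     \<le> (\<integral>\<^sup>+y. ennreal (exp (k + s * h)) * (\<Prod>i\<in>{1..N}. \<integral>\<^sup>+z. ennreal (c (y i) z powr s) \<partial>\<gamma>) \<partial>prior N)"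
    by (intro nn_integral_mono_AE eventually_mono[OF AE_cube] inner)
  also have "\<dots> = ennreal (exp (k + s * h)) * (\<integral>\<^sup>+y. (\<Prod>i\<in>{1..N}. \<integral>\<^sup>+z. ennreal (c (y i) z powr s) \<partial>\<gamma>) \<partial>prior N)"
  proof (rule nn_integral_cmult)
    have "(\<lambda>y. \<integral>\<^sup>+z. ennreal (c (y i) z powr s) \<partial>\<gamma>) \<in> borel_measurable (prior N)" if "i \<in> {1..N}" for i
    proof -
      have [measurable]: "(\<lambda>y. y i) \<in> borel_measurable (prior N)" using measurable_prior_component[OF measurable_ident that] by simp
      show ?thesis by measurable
    qed
    then show "(\<lambda>y. \<Prod>i\<in>{1..N}. \<integral>\<^sup>+z. ennreal (c (y i) z powr s) \<partial>\<gamma>) \<in> borel_measurable (prior N)"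
      by (intro borel_measurable_prod_ennreal)
  qed
  also have "(\<integral>\<^sup>+y. (\<Prod>i\<in>{1..N}. \<integral>\<^sup>+z. ennreal (c (y i) z powr s) \<partial>\<gamma>) \<partial>prior N)
     = (\<Prod>i\<in>{1..N}. \<integral>\<^sup>+t. (\<integral>\<^sup>+z. ennreal (c t z powr s) \<partial>\<gamma>) \<partial>P)"
    by (rule nn_integral_prod_prior) measurable
  also have "\<dots> \<le> (\<Prod>i\<in>{1..N}. ennreal (exp (s * psi P r + s\<^sup>2 * (2 * exp (5 * r * B\<^sup>2)))))"
    unfolding c_def by (intro prod_mono_ennreal nn_integral_channel_powr r) (use s m in \<open>auto simp: sgn_if\<close>)
  also have "\<dots> = ennreal (exp (real N * (s * psi P r + s\<^sup>2 * (2 * exp (5 * r * B\<^sup>2)))))"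
    by (simp add: ennreal_power exp_of_nat_mult)
  finally have "(\<integral>\<^sup>+y. (\<integral>\<^sup>+w. ennreal (Zbin l N m d y w powr s) \<partial>Gauss (upper_pairs N)) \<partial>prior N)
    \<le> ennreal (exp (k + s * h)) * ennreal (exp (real N * (s * psi P r + s\<^sup>2 * (2 * exp (5 * r * B\<^sup>2)))))"
    by (simp add: mult_left_mono)
  also have "\<dots> = ennreal (exp (k + s * h + real N * (s * psi P r + s\<^sup>2 * (2 * exp (5 * r * B\<^sup>2)))))"
    by (simp add: exp_add[symmetric] ennreal_mult[symmetric])
  finally show ?thesis unfolding k_def h_def r_def .
qed

end

section \<open>Large overlaps\<close>

text \<open>Subadditivity of \<open>u powr s\<close> follows from \<open>u <= u powr s\<close> on
  the unit interval, applied to the proportions of two summands. It carries a cover by finitely many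
  windows through the fractional moment.\<close>

lemma sum_powr_le:
  fixes z :: "'k \<Rightarrow> real"
  assumes "finite F" "\<And>k. k \<in> F \<Longrightarrow> 0 \<le> z k" "0 < s" "s \<le> 1"
  shows "(\<Sum>k\<in>F. z k) powr s \<le> (\<Sum>k\<in>F. z k powr s)"
  using assms(1,2)
proof (induction F rule: finite_induct)
  case (insert k F)
  have two: "(x + y) powr s \<le> x powr s + y powr s" if "0 \<le> x" "0 \<le> y" for x y :: real
  proof (cases "x + y = 0")
    case False
    then have t: "0 < x + y" using that by simp
    have le: "u \<le> u powr s" if "0 \<le> u" "u \<le> 1" for u :: real
    proof (cases "u = 0")
      case False
      then have "u powr 1 \<le> u powr s" using that assms(4) by (intro powr_mono') auto
      then show ?thesis using that False by simp
    qed simp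
    have "1 = x / (x + y) + y / (x + y)" using t by (simp add: add_divide_distrib[symmetric])
    also have "\<dots> \<le> (x / (x + y)) powr s + (y / (x + y)) powr s"
      using that t by (intro add_mono le) auto
    also have "\<dots> = (x powr s + y powr s) / (x + y) powr s"
      using that t by (simp add: powr_divide add_divide_distrib)
    finally show ?thesis using t by (simp add: le_divide_eq)
  qed (use that in simp)
  have "(\<Sum>k\<in>insert k F. z k) powr s \<le> z k powr s + (\<Sum>k\<in>F. z k) powr s"
    using insert by (simp add: two sum_nonneg)
  also have "\<dots> \<le> z k powr s + (\<Sum>k\<in>F. z k powr s)" using insert by simp
  finally show ?case using insert by simp
qed simp

lemma nn_integral_linear_iterated:
  fixes c :: ennreal
  assumes F: "(\<lambda>p. F (fst p) (snd p)) \<in> borel_measurable (M \<Otimes>\<^sub>M N)"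
    and G: "(\<lambda>p. G (fst p) (snd p)) \<in> borel_measurable (M \<Otimes>\<^sub>M N)" and N: "sigma_finite_measure N"
  shows "(\<integral>\<^sup>+x. (\<integral>\<^sup>+y. c * F x y + G x y \<partial>N) \<partial>M) = c * (\<integral>\<^sup>+x. (\<integral>\<^sup>+y. F x y \<partial>N) \<partial>M) + (\<integral>\<^sup>+x. (\<integral>\<^sup>+y. G x y \<partial>N) \<partial>M)"
proof -
  interpret sigma_finite_measure N by (rule N)
  note [measurable] = measurable_split_compose[OF F] measurable_split_compose[OF G]
  have "(\<integral>\<^sup>+x. (\<integral>\<^sup>+y. c * F x y + G x y \<partial>N) \<partial>M) = (\<integral>\<^sup>+x. c * (\<integral>\<^sup>+y. F x y \<partial>N) + (\<integral>\<^sup>+y. G x y \<partial>N) \<partial>M)"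
    by (intro nn_integral_cong) (simp add: nn_integral_add nn_integral_cmult)
  also have "\<dots> = c * (\<integral>\<^sup>+x. (\<integral>\<^sup>+y. F x y \<partial>N) \<partial>M) + (\<integral>\<^sup>+x. (\<integral>\<^sup>+y. G x y \<partial>N) \<partial>M)"
    by (simp add: nn_integral_add nn_integral_cmult)
  finally show ?thesis .
qed

section \<open>Likelihood ratio and posterior mass of overlap events\<close>

context bounded_prior
begin

text \<open>With the unspiked law as reference, \<open>LR\<close> is the likelihood ratio for a
  known spike and its prior average \<open>Lik\<close> the one for the model;
  \<open>LR / Lik\<close> is the posterior density.\<close>

definition LR :: "real \<Rightarrow> nat \<Rightarrow> (nat \<Rightarrow> real) \<Rightarrow> (nat \<times> nat \<Rightarrow> real) \<Rightarrow> real" where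
  "LR l N x w = wick (upper_pairs N) (feat l N x) w"

definition Lik :: "real \<Rightarrow> nat \<Rightarrow> (nat \<times> nat \<Rightarrow> real) \<Rightarrow> real" where
  "Lik l N w = (\<integral>x. LR l N x w \<partial>prior N)"

abbreviation "GE N \<equiv> Gauss (upper_pairs N)"

lemma LR_pos [simp]: "0 < LR l N x w" "0 \<le> LR l N x w"
  unfolding LR_def by simp_all

lemma measurable_LR [measurable]:
  "f \<in> measurable M (prior N) \<Longrightarrow> g \<in> measurable M (GE N) \<Longrightarrow> (\<lambda>p. LR l N (f p) (g p)) \<in> borel_measurable M"
  unfolding LR_def by (rule measurable_feat_wick)

lemma feat_bound: "x \<in> cube N \<Longrightarrow> e \<in> upper_pairs N \<Longrightarrow> \<bar>feat l N x e\<bar> \<le> sqrt \<bar>l / real N\<bar> * B\<^sup>2"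
proof -
  assume x: "x \<in> cube N" and e: "e \<in> upper_pairs N"
  have "\<bar>x (fst e) * x (snd e)\<bar> \<le> B\<^sup>2"
    unfolding abs_mult power2_eq_square using x e B1 by (intro mult_mono) (auto simp: cube_def upper_pairs_def)
  then have "sqrt \<bar>l / real N\<bar> * \<bar>x (fst e) * x (snd e)\<bar> \<le> sqrt \<bar>l / real N\<bar> * B\<^sup>2"
    by (intro mult_left_mono) auto
  then show ?thesis unfolding feat_def abs_mult by (simp add: real_sqrt_abs' abs_mult real_sqrt_divide mult.assoc)
qed

lemma LR_bound:
  assumes x: "x \<in> cube N"
  shows "LR l N x w \<le> exp (\<Sum>e\<in>upper_pairs N. sqrt \<bar>l / real N\<bar> * B\<^sup>2 * \<bar>w e\<bar>)"
proof -
  have "(\<Sum>e\<in>upper_pairs N. feat l N x e * w e) \<le> (\<Sum>e\<in>upper_pairs N. sqrt \<bar>l / real N\<bar> * B\<^sup>2 * \<bar>w e\<bar>)"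
  proof (rule sum_mono)
    fix e assume e: "e \<in> upper_pairs N"
    have "\<bar>feat l N x e * w e\<bar> \<le> sqrt \<bar>l / real N\<bar> * B\<^sup>2 * \<bar>w e\<bar>"
      unfolding abs_mult[of "feat l N x e"] by (intro mult_right_mono feat_bound x e) simp
    then show "feat l N x e * w e \<le> sqrt \<bar>l / real N\<bar> * B\<^sup>2 * \<bar>w e\<bar>" by linarith
  qed
  then show ?thesis
    unfolding LR_def wick_def using sum_nonneg[of "upper_pairs N" "\<lambda>e. (feat l N x e)\<^sup>2"] by simp
qed

text \<open>The source of integrability for all posterior averages: on the cube the likelihood ratio
  is bounded for each fixed observation.\<close>

lemma integrable_LR_times:
  fixes k :: "(nat \<Rightarrow> real) \<Rightarrow> real"
  assumes [measurable]: "w \<in> space (GE N)" "k \<in> borel_measurable (prior N)" and k: "\<And>x. x \<in> cube N \<Longrightarrow> \<bar>k x\<bar> \<le> C"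
  shows "integrable (prior N) (\<lambda>x. k x * LR l N x w)"
proof -
  interpret pr: prob_space "prior N" by (rule prob_space_prior)
  let ?c = "exp (\<Sum>e\<in>upper_pairs N. sqrt \<bar>l / real N\<bar> * B\<^sup>2 * \<bar>w e\<bar>)"
  show ?thesis
  proof (rule pr.integrable_const_bound)
    show "AE x in prior N. norm (k x * LR l N x w) \<le> C * ?c"
      using AE_cube
    proof eventually_elim
      case (elim x)
      have "\<bar>k x\<bar> * LR l N x w \<le> C * ?c"
        using k[OF elim] LR_bound[OF elim, of l w] by (intro mult_mono) auto
      then show ?case by (simp add: abs_mult)
    qed
  qed measurable
qed

lemma integrable_LR: "w \<in> space (GE N) \<Longrightarrow> integrable (prior N) (\<lambda>x. LR l N x w)"
  using integrable_LR_times[of w N "\<lambda>_. 1" 1 l] by simp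

lemma Lik_eq_nn: "w \<in> space (GE N) \<Longrightarrow> ennreal (Lik l N w) = (\<integral>\<^sup>+x. ennreal (LR l N x w) \<partial>prior N)"
  unfolding Lik_def by (rule nn_integral_eq_integral[symmetric]) (auto intro: integrable_LR)

lemma Lik_measurable [measurable]: "Lik l N \<in> borel_measurable (GE N)"
proof -
  interpret pr: prob_space "prior N" by (rule prob_space_prior)
  show ?thesis unfolding Lik_def[abs_def] by measurable
qed

lemma Lik_pos:
  assumes w: "w \<in> space (GE N)"
  shows "0 < Lik l N w"
proof -
  interpret pr: prob_space "prior N" by (rule prob_space_prior)
  have "Lik l N w \<noteq> 0"
  proof
    assume "Lik l N w = 0"
    then have "AE x in prior N. LR l N x w = 0"
      using integral_nonneg_eq_0_iff_AE[OF integrable_LR[OF w]] unfolding Lik_def by auto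
    then have "AE x in prior N. False"
    proof eventually_elim
      case (elim x)
      then show ?case using LR_pos(1)[of l N x w] by simp
    qed
    then show False by simp
  qed
  moreover have "0 \<le> Lik l N w" unfolding Lik_def by (intro integral_nonneg_AE) auto
  ultimately show ?thesis by simp
qed

text \<open>Fubini in Bayesian form: drawing the spike and then the observation gives an observation
  with density \<open>Lik\<close> under the unspiked law.\<close>

lemma nn_integral_LR_prior:
  assumes [measurable]: "F \<in> borel_measurable (GE N)"
  shows "(\<integral>\<^sup>+x. (\<integral>\<^sup>+w. ennreal (LR l N x w) * F w \<partial>GE N) \<partial>prior N) = (\<integral>\<^sup>+w. ennreal (Lik l N w) * F w \<partial>GE N)"
proof -
  interpret pr: prob_space "prior N" by (rule prob_space_prior)
  interpret G: prob_space "GE N" by (rule prob_space_Gauss)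
  interpret pG: pair_sigma_finite "prior N" "GE N" ..
  have "(\<integral>\<^sup>+x. (\<integral>\<^sup>+w. ennreal (LR l N x w) * F w \<partial>GE N) \<partial>prior N) = (\<integral>\<^sup>+w. (\<integral>\<^sup>+x. ennreal (LR l N x w) * F w \<partial>prior N) \<partial>GE N)"
    by (rule pG.Fubini'[symmetric]) measurable
  also have "\<dots> = (\<integral>\<^sup>+w. ennreal (Lik l N w) * F w \<partial>GE N)"
    by (intro nn_integral_cong) (simp add: nn_integral_multc Lik_eq_nn)
  finally show ?thesis .
qed

lemma nn_integral_LR_shift:
  assumes "F \<in> borel_measurable (GE N)"
  shows "(\<integral>\<^sup>+w. ennreal (LR l N y w) * F w \<partial>GE N) = (\<integral>\<^sup>+w. F (\<lambda>e\<in>upper_pairs N. feat l N y e + w e) \<partial>GE N)"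
  using nn_integral_Gauss_shift[OF finite_upper_pairs assms, of "feat l N y"] unfolding LR_def by (simp add: mult.commute)

lemma nn_integral_Lik: "(\<integral>\<^sup>+w. ennreal (Lik l N w) \<partial>GE N) = 1"
proof -
  have "(\<integral>\<^sup>+x. (\<integral>\<^sup>+w. ennreal (LR l N x w) * 1 \<partial>GE N) \<partial>prior N) = 1"
    unfolding LR_def using prob_space.emeasure_space_1[OF prob_space_prior, of N] by (simp add: nn_integral_wick)
  then show ?thesis using nn_integral_LR_prior[of "\<lambda>_. 1" N l] by simp
qed

lemma LR_shift: "LR l N x (\<lambda>e\<in>upper_pairs N. feat l N y e + w e) = exp (corr l N x y) * LR l N x w"
proof -
  have "LR l N x (\<lambda>e\<in>upper_pairs N. feat l N y e + w e) = wick (upper_pairs N) (feat l N x) (\<lambda>e. feat l N y e + w e)"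
    unfolding LR_def by (rule wick_cong) auto
  then show ?thesis unfolding wick_add LR_def corr_def by simp
qed

text \<open>An unnormalised posterior mass; division by \<open>Lik\<close> turns it into the
  posterior probability of a large overlap with \<open>y\<close>.\<close>

definition Zbad :: "real \<Rightarrow> nat \<Rightarrow> real \<Rightarrow> (nat \<Rightarrow> real) \<Rightarrow> (nat \<times> nat \<Rightarrow> real) \<Rightarrow> real" where
  "Zbad l N e y w = (\<integral>x. indicator {x. e < \<bar>ov N x y\<bar>} x * LR l N x w \<partial>prior N)"

lemma ind_measurable [measurable]:
  assumes [measurable]: "f \<in> measurable M (prior N)" "g \<in> measurable M (prior N)"
  shows "(\<lambda>p. indicator {x. e < \<bar>ov N x (g p)\<bar>} (f p) :: real) \<in> borel_measurable M"
  unfolding indicator_def by simp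

lemma Zbad_measurable [measurable]:
  assumes [measurable]: "f \<in> measurable M (prior N)" "g \<in> measurable M (GE N)"
  shows "(\<lambda>p. Zbad l N e (f p) (g p)) \<in> borel_measurable M"
proof -
  interpret pr: prob_space "prior N" by (rule prob_space_prior)
  show ?thesis unfolding Zbad_def by measurable
qed

lemma Zbad_nonneg [simp]: "0 \<le> Zbad l N e y w"
  unfolding Zbad_def by (intro integral_nonneg_AE) auto

lemma Zbad_le_Lik:
  assumes [measurable]: "w \<in> space (GE N)" "y \<in> space (prior N)"
  shows "Zbad l N e y w \<le> Lik l N w"
  unfolding Zbad_def Lik_def
proof (rule integral_mono)
  show "integrable (prior N) (\<lambda>x. indicator {x. e < \<bar>ov N x y\<bar>} x * LR l N x w)"
    using assms by (intro integrable_LR_times[where C = 1]) (auto simp: indicator_def)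
qed (auto intro: integrable_LR assms simp: indicator_def)

lemma Zbad_shift_le:
  assumes N: "0 < N" and y: "y \<in> cube N" and w: "w \<in> space (GE N)"
    and F: "finite F" "\<And>R. e < \<bar>R\<bar> \<Longrightarrow> \<bar>R\<bar> \<le> B\<^sup>2 \<Longrightarrow> \<exists>m\<in>F. \<bar>R - m\<bar> \<le> d"
  shows "Zbad l N e y (\<lambda>e\<in>upper_pairs N. feat l N y e + w e) \<le> (\<Sum>m\<in>F. Zbin l N m d y w)"
proof -
  have ysp [measurable]: "y \<in> space (prior N)" using y by (auto simp: cube_def)
  interpret pr: prob_space "prior N" by (rule prob_space_prior)
  note [measurable] = w
  have cb: "\<exists>C. \<forall>x\<in>cube N. \<bar>exp (corr l N x y)\<bar> \<le> C"
  proof (intro exI ballI)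
    fix x assume "x \<in> cube N"
    have "corr l N x y \<le> (\<Sum>e\<in>upper_pairs N. \<bar>feat l N x e * feat l N y e\<bar>)" unfolding corr_def by (rule sum_mono) simp
    also have "\<dots> \<le> (\<Sum>e\<in>upper_pairs N. sqrt \<bar>l / real N\<bar> * B\<^sup>2 * (sqrt \<bar>l / real N\<bar> * B\<^sup>2))"
    proof (rule sum_mono)
      fix e assume e: "e \<in> upper_pairs N"
      show "\<bar>feat l N x e * feat l N y e\<bar> \<le> sqrt \<bar>l / real N\<bar> * B\<^sup>2 * (sqrt \<bar>l / real N\<bar> * B\<^sup>2)"
        unfolding abs_mult using y \<open>x \<in> cube N\<close> e by (intro mult_mono feat_bound) auto
    qed
    finally show "\<bar>exp (corr l N x y)\<bar> \<le> exp (\<Sum>e\<in>upper_pairs N. sqrt \<bar>l / real N\<bar> * B\<^sup>2 * (sqrt \<bar>l / real N\<bar> * B\<^sup>2))" by simp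
  qed
  then obtain C where C: "\<And>x. x \<in> cube N \<Longrightarrow> \<bar>exp (corr l N x y)\<bar> \<le> C" by blast
  have int: "integrable (prior N) (\<lambda>x. indicator (ov_bin N m d y) x * (exp (corr l N x y) * LR l N x w))" for m
  proof -
    have "integrable (prior N) (\<lambda>x. (indicator (ov_bin N m d y) x * exp (corr l N x y)) * LR l N x w)"
      using C by (intro integrable_LR_times[where C = C] w) (auto simp: indicator_def intro: order_trans[OF abs_ge_zero C])
    then show ?thesis by (simp add: mult.assoc)
  qed
  have "Zbad l N e y (\<lambda>e\<in>upper_pairs N. feat l N y e + w e)
     = (\<integral>x. indicator {x. e < \<bar>ov N x y\<bar>} x * (exp (corr l N x y) * LR l N x w) \<partial>prior N)"
    unfolding Zbad_def LR_shift ..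
  also have "\<dots> \<le> (\<integral>x. (\<Sum>m\<in>F. indicator (ov_bin N m d y) x * (exp (corr l N x y) * LR l N x w)) \<partial>prior N)"
  proof (rule integral_mono_AE')
    show "integrable (prior N) (\<lambda>x. \<Sum>m\<in>F. indicator (ov_bin N m d y) x * (exp (corr l N x y) * LR l N x w))"
      by (intro Bochner_Integration.integrable_sum int)
    show "AE x in prior N. indicator {x. e < \<bar>ov N x y\<bar>} x * (exp (corr l N x y) * LR l N x w)
       \<le> (\<Sum>m\<in>F. indicator (ov_bin N m d y) x * (exp (corr l N x y) * LR l N x w))"
      using AE_cube
    proof eventually_elim
      case (elim x)
      show ?case
      proof (cases "e < \<bar>ov N x y\<bar>")
        case True
        then obtain m where m: "m \<in> F" "\<bar>ov N x y - m\<bar> \<le> d" using F(2) abs_ov_le[OF N elim y] by blast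
        have "indicator {x. e < \<bar>ov N x y\<bar>} x * (exp (corr l N x y) * LR l N x w) = indicator (ov_bin N m d y) x * (exp (corr l N x y) * LR l N x w)"
          using True m elim by (simp add: ov_bin_def)
        also have "\<dots> \<le> (\<Sum>m\<in>F. indicator (ov_bin N m d y) x * (exp (corr l N x y) * LR l N x w))"
          by (rule member_le_sum[OF m(1)]) (use F(1) in auto)
        finally show ?thesis .
      qed (auto intro!: sum_nonneg)
    qed
  qed (auto intro!: AE_I2 sum_nonneg)
  also have "\<dots> = (\<Sum>m\<in>F. Zbin l N m d y w)"
    unfolding Zbin_def LR_def[symmetric] by (rule Bochner_Integration.integral_sum) (rule int)
  finally show ?thesis .
qed

lemma finite_grid:
  assumes d: "0 < d" and e: "0 < e" "2 * d \<le> e"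
  obtains F :: "real set" where "finite F" "\<And>m. m \<in> F \<Longrightarrow> e / 2 \<le> \<bar>m\<bar> \<and> \<bar>m\<bar> \<le> b + d"
    "\<And>R. e < \<bar>R\<bar> \<Longrightarrow> \<bar>R\<bar> \<le> b \<Longrightarrow> \<exists>m\<in>F. \<bar>R - m\<bar> \<le> d"
proof
  define F where "F = {m \<in> (\<lambda>k::int. real_of_int k * d) ` {- \<lceil>b / d\<rceil> - 1..\<lceil>b / d\<rceil> + 1}. e / 2 \<le> \<bar>m\<bar> \<and> \<bar>m\<bar> \<le> b + d}"
  show "finite F" unfolding F_def by simp
  show "e / 2 \<le> \<bar>m\<bar> \<and> \<bar>m\<bar> \<le> b + d" if "m \<in> F" for m using that unfolding F_def by auto
  fix R :: real assume R: "e < \<bar>R\<bar>" "\<bar>R\<bar> \<le> b"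
  define k where "k = \<lfloor>R / d\<rfloor>"
  have "\<bar>R / d - real_of_int k\<bar> \<le> 1" unfolding k_def by linarith
  then have "\<bar>(R - real_of_int k * d) / d\<bar> \<le> 1" using d by (simp add: diff_divide_distrib)
  then have k: "\<bar>R - real_of_int k * d\<bar> \<le> d" using d by (simp add: divide_le_eq)
  have "(- b) / d \<le> R / d" by (rule divide_right_mono) (use R d in linarith)+
  moreover have "R / d \<le> b / d" by (rule divide_right_mono) (use R d in linarith)+
  ultimately have "- (b / d) \<le> R / d" "R / d \<le> b / d" by simp_all
  then have "k \<in> {- \<lceil>b / d\<rceil> - 1..\<lceil>b / d\<rceil> + 1}" unfolding k_def by (simp, linarith)
  moreover have "e / 2 \<le> \<bar>real_of_int k * d\<bar>" "\<bar>real_of_int k * d\<bar> \<le> b + d" using k R e by linarith+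
  ultimately have "real_of_int k * d \<in> F" unfolding F_def by blast
  with k show "\<exists>m\<in>F. \<bar>R - m\<bar> \<le> d" by blast
qed

text \<open>Strictness of \<open>l < l'\<close> puts the potential at \<open>|m|\<close> below
  \<open>- a m^2\<close> with \<open>a = l (1 - l / l') / 4\<close>. The window width
  \<open>d\<close> and the exponent \<open>s\<close> are so small that each consumes at most a
  quarter of the least gap \<open>a e^2 / 4\<close>; half of it survives as exponential
  decay.\<close>

lemma Zbad_moment:
  assumes l: "0 < l" "l < l'" and psi: "\<And>r. 0 \<le> r \<Longrightarrow> psi P r \<le> r\<^sup>2 / (4 * l')" and e: "0 < e"
  obtains C b s where "0 < b" "0 < s" "s < 1" "0 \<le> C"
    "\<And>N. 0 < N \<Longrightarrow> (\<integral>\<^sup>+y. (\<integral>\<^sup>+w. ennreal (LR l N y w) * ennreal (Zbad l N e y w powr s) \<partial>GE N) \<partial>prior N)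
       \<le> ennreal (C * exp (- (b * real N)))"
proof -
  define a where "a = l / 4 * (1 - l / l')"
  have a: "0 < a" unfolding a_def using l by simp
  define d where "d = min (e / 2) (min 1 (a * e\<^sup>2 / (8 * l)))"
  have d: "0 < d" "2 * d \<le> e" "d \<le> 1" "d \<le> a * e\<^sup>2 / (8 * l)" unfolding d_def using e a l by auto
  have ld: "l * d\<^sup>2 / 2 \<le> a * e\<^sup>2 / 16"
  proof -
    have "d\<^sup>2 \<le> d * 1" unfolding power2_eq_square using d by (intro mult_left_mono) auto
    then have "l * d\<^sup>2 \<le> l * (a * e\<^sup>2 / (8 * l))" using d(4) l by (intro mult_left_mono) auto
    then show ?thesis using l by simp
  qed
  define Cm where "Cm = 2 * exp (5 * (l * (B\<^sup>2 + 1)) * B\<^sup>2)"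
  have Cm: "0 < Cm" unfolding Cm_def by simp
  define s where "s = min (1 / 2) (a * e\<^sup>2 / (16 * Cm))"
  have s: "0 < s" "s < 1" "s * Cm \<le> a * e\<^sup>2 / 16"
  proof -
    show "0 < s" "s < 1" unfolding s_def using a e Cm by auto
    have "s * Cm \<le> a * e\<^sup>2 / (16 * Cm) * Cm" unfolding s_def using Cm by (intro mult_right_mono) auto
    then show "s * Cm \<le> a * e\<^sup>2 / 16" using Cm by simp
  qed
  define b where "b = s * (a * e\<^sup>2 / 8)"
  have b: "0 < b" unfolding b_def using s a e by simp
  obtain F :: "real set" where F: "finite F" "\<And>m. m \<in> F \<Longrightarrow> e / 2 \<le> \<bar>m\<bar> \<and> \<bar>m\<bar> \<le> B\<^sup>2 + d"
    "\<And>R. e < \<bar>R\<bar> \<Longrightarrow> \<bar>R\<bar> \<le> B\<^sup>2 \<Longrightarrow> \<exists>m\<in>F. \<bar>R - m\<bar> \<le> d"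
    using finite_grid[OF d(1) e d(2), of "B\<^sup>2"] by metis
  \<comment> \<open>Absorbs the diagonal term of the comparison, which does not grow with
    \<open>N\<close>.\<close>
  define K where "K = exp (l * B ^ 4 / 4)"
  have bin: "(\<integral>\<^sup>+y. (\<integral>\<^sup>+w. ennreal (Zbin l N m d y w powr s) \<partial>GE N) \<partial>prior N) \<le> ennreal (K * exp (- (b * real N)))"
    if m: "m \<in> F" and N: "0 < N" for m N
  proof -
    have m1: "e / 2 \<le> \<bar>m\<bar>" "\<bar>m\<bar> \<le> B\<^sup>2 + 1" using F(2)[OF m] d by auto
    then have "m \<noteq> 0" using e by auto
    have m2: "e\<^sup>2 / 4 \<le> m\<^sup>2"
    proof -
      have "(e / 2)\<^sup>2 \<le> \<bar>m\<bar>\<^sup>2" using m1 e by (intro power_mono) auto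
      then show ?thesis by (simp add: power_divide)
    qed
    have psim: "psi P (l * \<bar>m\<bar>) \<le> (l * m\<^sup>2 / 4) * (l / l')"
      using psi[of "l * \<bar>m\<bar>"] l by (simp add: power_mult_distrib power2_eq_square mult_ac)
    have Cmm: "2 * exp (5 * (l * \<bar>m\<bar>) * B\<^sup>2) \<le> Cm"
      unfolding Cm_def using m1 l by (auto intro!: mult_right_mono mult_left_mono)
    let ?A = "l * real N * m\<^sup>2 / 2 + l * B ^ 4 / 2"
    have "s * (1 - s) / 2 * ?A \<le> s / 2 * ?A"
      using s l by (intro mult_right_mono add_nonneg_nonneg) auto
    also have "\<dots> \<le> s * (real N * (l * m\<^sup>2 / 4)) + l * B ^ 4 / 4"
    proof -
      have "s * (l * B ^ 4 / 4) \<le> 1 * (l * B ^ 4 / 4)" using s l by (intro mult_right_mono) auto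
      then show ?thesis by (simp add: algebra_simps)
    qed
    finally have 1: "s * (1 - s) / 2 * ?A \<le> s * (real N * (l * m\<^sup>2 / 4)) + l * B ^ 4 / 4" .
    have 2: "s * psi P (l * \<bar>m\<bar>) + s\<^sup>2 * (2 * exp (5 * (l * \<bar>m\<bar>) * B\<^sup>2)) \<le> s * ((l * m\<^sup>2 / 4) * (l / l') + s * Cm)"
    proof -
      have "s * s * (2 * exp (5 * (l * \<bar>m\<bar>) * B\<^sup>2)) \<le> s * s * Cm" using Cmm s by (intro mult_left_mono) auto
      moreover have "s * psi P (l * \<bar>m\<bar>) \<le> s * ((l * m\<^sup>2 / 4) * (l / l'))" using psim s by (intro mult_left_mono) auto
      ultimately show ?thesis by (simp add: power2_eq_square distrib_left mult.assoc)
    qed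
    have 3: "l * m\<^sup>2 / 4 + (l * d\<^sup>2 / 2 - l * m\<^sup>2 / 2) + ((l * m\<^sup>2 / 4) * (l / l') + s * Cm) \<le> - (a * e\<^sup>2 / 8)"
    proof -
      have "a * (e\<^sup>2 / 4) \<le> a * m\<^sup>2" using m2 a by (intro mult_left_mono) auto
      moreover have "a * m\<^sup>2 = l * m\<^sup>2 / 4 - (l * m\<^sup>2 / 4) * (l / l')"
      proof -
        have "l / 4 * (1 - t) * m\<^sup>2 = l * m\<^sup>2 / 4 - (l * m\<^sup>2 / 4) * t" for t by (simp add: field_simps)
        then show ?thesis unfolding a_def .
      qed
      ultimately show ?thesis using ld s(3) by (simp add: field_simps)
    qed
    have "s * (1 - s) / 2 * ?A + s * (real N * (l * d\<^sup>2 / 2 - l * m\<^sup>2 / 2))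
        + real N * (s * psi P (l * \<bar>m\<bar>) + s\<^sup>2 * (2 * exp (5 * (l * \<bar>m\<bar>) * B\<^sup>2)))
      \<le> (s * (real N * (l * m\<^sup>2 / 4)) + l * B ^ 4 / 4) + s * (real N * (l * d\<^sup>2 / 2 - l * m\<^sup>2 / 2))
        + real N * (s * ((l * m\<^sup>2 / 4) * (l / l') + s * Cm))"
      by (intro add_mono 1 order_refl mult_left_mono 2) simp
    also have "\<dots> = l * B ^ 4 / 4 + s * real N * (l * m\<^sup>2 / 4 + (l * d\<^sup>2 / 2 - l * m\<^sup>2 / 2) + ((l * m\<^sup>2 / 4) * (l / l') + s * Cm))"
      unfolding distrib_left by (simp only: mult_ac add_ac)
    also have "\<dots> \<le> l * B ^ 4 / 4 + s * real N * (- (a * e\<^sup>2 / 8))"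
      using 3 s by (intro add_left_mono mult_left_mono) auto
    also have "\<dots> = l * B ^ 4 / 4 + - (b * real N)" unfolding b_def by (simp add: mult_ac)
    finally have "exp (s * (1 - s) / 2 * ?A + s * (real N * (l * d\<^sup>2 / 2 - l * m\<^sup>2 / 2))
        + real N * (s * psi P (l * \<bar>m\<bar>) + s\<^sup>2 * (2 * exp (5 * (l * \<bar>m\<bar>) * B\<^sup>2)))) \<le> K * exp (- (b * real N))"
      unfolding K_def exp_add[symmetric] by simp
    then show ?thesis
      using Zbin_moment[OF l(1) N \<open>m \<noteq> 0\<close> s(1,2), of d] by (meson ennreal_leI order_trans)
  qed
  have K: "0 < K" unfolding K_def by simp
  show ?thesis
  proof (rule that[OF b s(1,2), of "real (card F) * K"])
    fix N :: nat assume N: "0 < N"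
    interpret pr: prob_space "prior N" by (rule prob_space_prior)
    interpret G: prob_space "GE N" by (rule prob_space_Gauss)
    have Zm: "(\<lambda>p. Zbin l N m d (fst p) (snd p)) \<in> borel_measurable (prior N \<Otimes>\<^sub>M GE N)" for m
      unfolding Zbin_def LR_def[symmetric] ov_bin_def indicator_def mem_Collect_eq by measurable
    note [measurable] = measurable_split_compose[OF Zm]
    have "(\<integral>\<^sup>+y. (\<integral>\<^sup>+w. ennreal (LR l N y w) * ennreal (Zbad l N e y w powr s) \<partial>GE N) \<partial>prior N)
      \<le> (\<integral>\<^sup>+y. (\<integral>\<^sup>+w. (\<Sum>m\<in>F. ennreal (Zbin l N m d y w powr s)) \<partial>GE N) \<partial>prior N)"
    proof (rule nn_integral_mono_AE, rule eventually_mono[OF AE_cube])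
      fix y assume y: "y \<in> cube N"
      then have [measurable]: "y \<in> space (prior N)" by (auto simp: cube_def)
      have "(\<integral>\<^sup>+w. ennreal (LR l N y w) * ennreal (Zbad l N e y w powr s) \<partial>GE N)
        = (\<integral>\<^sup>+w. ennreal (Zbad l N e y (\<lambda>e\<in>upper_pairs N. feat l N y e + w e) powr s) \<partial>GE N)"
        by (rule nn_integral_LR_shift) measurable
      also have "\<dots> \<le> (\<integral>\<^sup>+w. (\<Sum>m\<in>F. ennreal (Zbin l N m d y w powr s)) \<partial>GE N)"
      proof (rule nn_integral_mono)
        fix w assume w: "w \<in> space (GE N)"
        have "Zbad l N e y (\<lambda>e\<in>upper_pairs N. feat l N y e + w e) powr s \<le> (\<Sum>m\<in>F. Zbin l N m d y w) powr s"
          using Zbad_shift_le[OF N y w F(1,3)] s by (intro powr_mono2) auto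
        also have "\<dots> \<le> (\<Sum>m\<in>F. Zbin l N m d y w powr s)"
          unfolding Zbin_def by (intro sum_powr_le F integral_nonneg_AE) (use s in auto)
        finally show "ennreal (Zbad l N e y (\<lambda>e\<in>upper_pairs N. feat l N y e + w e) powr s) \<le> (\<Sum>m\<in>F. ennreal (Zbin l N m d y w powr s))"
          by (simp add: ennreal_leI)
      qed
      finally show "(\<integral>\<^sup>+w. ennreal (LR l N y w) * ennreal (Zbad l N e y w powr s) \<partial>GE N)
        \<le> (\<integral>\<^sup>+w. (\<Sum>m\<in>F. ennreal (Zbin l N m d y w powr s)) \<partial>GE N)" .
    qed
    also have "\<dots> = (\<integral>\<^sup>+y. (\<Sum>m\<in>F. \<integral>\<^sup>+w. ennreal (Zbin l N m d y w powr s) \<partial>GE N) \<partial>prior N)"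
      by (intro nn_integral_cong nn_integral_sum) measurable
    also have "\<dots> = (\<Sum>m\<in>F. \<integral>\<^sup>+y. (\<integral>\<^sup>+w. ennreal (Zbin l N m d y w powr s) \<partial>GE N) \<partial>prior N)"
      by (intro nn_integral_sum) measurable
    also have "\<dots> \<le> (\<Sum>m\<in>F. ennreal (K * exp (- (b * real N))))" by (intro sum_mono bin N)
    also have "\<dots> = ennreal (\<Sum>m\<in>F. K * exp (- (b * real N)))" by (rule sum_ennreal) (use K in auto)
    finally show "(\<integral>\<^sup>+y. (\<integral>\<^sup>+w. ennreal (LR l N y w) * ennreal (Zbad l N e y w powr s) \<partial>GE N) \<partial>prior N)
       \<le> ennreal (real (card F) * K * exp (- (b * real N)))" by (simp add: mult.assoc)
  qed (use K in auto)
qed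

text \<open>A small moment of the numerator does not control the ratio \<open>z / L\<close> where
  \<open>L\<close> is small. But always \<open>z / L <= 1\<close>, and under the spiked law the
  event \<open>L < q\<close> has probability at most \<open>q\<close>, because \<open>L\<close> is
  the density of that law.\<close>

theorem large_overlap:
  assumes l: "0 < l" "l < l'" and psi: "\<And>r. 0 \<le> r \<Longrightarrow> psi P r \<le> r\<^sup>2 / (4 * l')" and e: "0 < e"
  obtains C c where "0 < c" "0 \<le> C"
    "\<And>N. 0 < N \<Longrightarrow> (\<integral>\<^sup>+y. (\<integral>\<^sup>+w. ennreal (LR l N y w) * ennreal (Zbad l N e y w / Lik l N w) \<partial>GE N) \<partial>prior N)
       \<le> ennreal (C * exp (- (c * real N)))"
proof -
  obtain C b s where b: "0 < b" and s: "0 < s" "s < 1" and C: "0 \<le> C"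
    and Z: "\<And>N. 0 < N \<Longrightarrow> (\<integral>\<^sup>+y. (\<integral>\<^sup>+w. ennreal (LR l N y w) * ennreal (Zbad l N e y w powr s) \<partial>GE N) \<partial>prior N)
       \<le> ennreal (C * exp (- (b * real N)))"
    by (rule Zbad_moment[OF l psi e]) (assumption, rule that)
  show ?thesis
  proof (rule that[of "b / 4" "C + 2"])
    fix N :: nat assume N: "0 < N"
    interpret pr: prob_space "prior N" by (rule prob_space_prior)
    interpret G: prob_space "GE N" by (rule prob_space_Gauss)
    \<comment> \<open>\<open>q\<close> is the threshold for \<open>L\<close> and
      \<open>\<eta> = q^2\<close> that for the numerator. The exponent is chosen so that
      \<open>\<eta> powr (- s) = exp (b N / 2)\<close> spends half of the available decay, while
      \<open>\<eta> / q = q\<close> is still exponentially small.\<close>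
    define q where "q = exp (- (b * real N / (4 * s)))"
    define \<eta> where "\<eta> = q\<^sup>2"
    have q: "0 < q" unfolding q_def by simp
    have \<eta>: "0 < \<eta>" unfolding \<eta>_def using q by simp
    have \<eta>s: "\<eta> powr (- s) = exp (b * real N / 2)"
    proof -
      have "\<eta> = exp (- (b * real N / (2 * s)))" unfolding \<eta>_def q_def power2_eq_square exp_add[symmetric] by simp
      then show ?thesis using s by (simp add: exp_powr_real)
    qed
    let ?I = "\<lambda>w. indicator {w. Lik l N w < q} w :: real"
    have [measurable]: "?I \<in> borel_measurable (GE N)" unfolding indicator_def by simp
    have pt: "Zbad l N e y w / Lik l N w \<le> Zbad l N e y w powr s * \<eta> powr (- s) + q + ?I w"
      if w: "w \<in> space (GE N)" and y: "y \<in> space (prior N)" for y w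
    proof -
      define z where "z = Zbad l N e y w"
      define L where "L = Lik l N w"
      have L: "0 < L" "z \<le> L" "0 \<le> z" unfolding z_def L_def using Lik_pos[OF w] Zbad_le_Lik[OF w y] by auto
      have 1: "z / L \<le> 1" using L by simp
      consider "\<eta> < z" | "z \<le> \<eta>" "L < q" | "z \<le> \<eta>" "q \<le> L" by linarith
      then show ?thesis
      proof cases
        case 1
        have "1 \<le> (z / \<eta>) powr s" using 1 \<eta> s by (intro ge_one_powr_ge_zero) auto
        also have "\<dots> = z powr s * \<eta> powr (- s)" using 1 \<eta> L by (simp add: powr_divide powr_minus_divide)
        finally show ?thesis using \<open>z / L \<le> 1\<close> q unfolding z_def L_def by (auto simp: indicator_def)
      next
        case 2
        then have "?I w = 1" unfolding L_def by simp
        moreover have "0 \<le> z powr s * \<eta> powr (- s)" by simp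
        ultimately show ?thesis using \<open>z / L \<le> 1\<close> q unfolding z_def L_def by linarith
      next
        case 3
        have "z / L \<le> \<eta> / q" using 3 q \<eta> L by (intro frac_le) auto
        also have "\<dots> = q" unfolding \<eta>_def using q by (simp add: power2_eq_square)
        finally have "z / L \<le> q" .
        moreover have "0 \<le> z powr s * \<eta> powr (- s)" "0 \<le> ?I w" by simp_all
        ultimately show ?thesis unfolding z_def L_def by linarith
      qed
    qed
    have cmb: "ennreal (Zbad l N e y w / Lik l N w) \<le> ennreal (\<eta> powr (- s)) * ennreal (Zbad l N e y w powr s) + (ennreal q + ennreal (?I w))"
      if "w \<in> space (GE N)" "y \<in> space (prior N)" for y w
    proof -
      have "ennreal (Zbad l N e y w / Lik l N w) \<le> ennreal (\<eta> powr (- s) * (Zbad l N e y w powr s) + (q + ?I w))"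
        using pt[OF that] by (intro ennreal_leI) (simp add: mult.commute add.assoc)
      also have "\<dots> = ennreal (\<eta> powr (- s)) * ennreal (Zbad l N e y w powr s) + (ennreal q + ennreal (?I w))"
        using q by (simp add: ennreal_mult)
      finally show ?thesis .
    qed
    have "(\<integral>\<^sup>+y. (\<integral>\<^sup>+w. ennreal (LR l N y w) * ennreal (Zbad l N e y w / Lik l N w) \<partial>GE N) \<partial>prior N)
      \<le> (\<integral>\<^sup>+y. (\<integral>\<^sup>+w. ennreal (\<eta> powr (- s)) * (ennreal (LR l N y w) * ennreal (Zbad l N e y w powr s))
            + ennreal (LR l N y w) * (ennreal q + ennreal (?I w)) \<partial>GE N) \<partial>prior N)"
    proof (intro nn_integral_mono)
      fix y w assume "y \<in> space (prior N)" "w \<in> space (GE N)"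
      from mult_left_mono[OF cmb[OF this(2,1)], of "ennreal (LR l N y w)"]
      show "ennreal (LR l N y w) * ennreal (Zbad l N e y w / Lik l N w) \<le> ennreal (\<eta> powr (- s)) * (ennreal (LR l N y w) * ennreal (Zbad l N e y w powr s))
            + ennreal (LR l N y w) * (ennreal q + ennreal (?I w))"
        by (simp add: distrib_left mult_ac)
    qed
    also have "\<dots> = ennreal (\<eta> powr (- s)) * (\<integral>\<^sup>+y. (\<integral>\<^sup>+w. ennreal (LR l N y w) * ennreal (Zbad l N e y w powr s) \<partial>GE N) \<partial>prior N)
       + (\<integral>\<^sup>+y. (\<integral>\<^sup>+w. ennreal (LR l N y w) * (ennreal q + ennreal (?I w)) \<partial>GE N) \<partial>prior N)"
      by (rule nn_integral_linear_iterated) (measurable, rule prob_space_imp_sigma_finite, rule prob_space_Gauss)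
    also have "(\<integral>\<^sup>+y. (\<integral>\<^sup>+w. ennreal (LR l N y w) * (ennreal q + ennreal (?I w)) \<partial>GE N) \<partial>prior N)
       = (\<integral>\<^sup>+w. ennreal (Lik l N w) * (ennreal q + ennreal (?I w)) \<partial>GE N)"
      by (rule nn_integral_LR_prior) measurable
    also have "\<dots> \<le> (\<integral>\<^sup>+w. ennreal q * ennreal (Lik l N w) + ennreal q \<partial>GE N)"
    proof (rule nn_integral_mono)
      fix w assume w: "w \<in> space (GE N)"
      have "ennreal (Lik l N w) * ennreal (?I w) \<le> ennreal q" by (auto simp: indicator_def intro!: ennreal_leI)
      then show "ennreal (Lik l N w) * (ennreal q + ennreal (?I w)) \<le> ennreal q * ennreal (Lik l N w) + ennreal q"
        by (simp add: distrib_left mult.commute add_left_mono)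
    qed
    also have "\<dots> = ennreal q + ennreal q"
      by (simp add: nn_integral_add nn_integral_cmult nn_integral_Lik G.emeasure_space_1)
    also have "ennreal (\<eta> powr (- s)) * (\<integral>\<^sup>+y. (\<integral>\<^sup>+w. ennreal (LR l N y w) * ennreal (Zbad l N e y w powr s) \<partial>GE N) \<partial>prior N)
       \<le> ennreal (\<eta> powr (- s)) * ennreal (C * exp (- (b * real N)))"
      by (intro mult_left_mono Z N) simp
    finally have "(\<integral>\<^sup>+y. (\<integral>\<^sup>+w. ennreal (LR l N y w) * ennreal (Zbad l N e y w / Lik l N w) \<partial>GE N) \<partial>prior N)
       \<le> ennreal (\<eta> powr (- s)) * ennreal (C * exp (- (b * real N))) + (ennreal q + ennreal q)"
      by (simp add: add_mono)
    also have "\<dots> = ennreal (C * exp (- (b * real N / 2)) + 2 * q)"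
    proof -
      have "\<eta> powr (- s) * (C * exp (- (b * real N))) = C * exp (- (b * real N / 2))"
        unfolding \<eta>s by (simp add: exp_add[symmetric] mult.left_commute)
      moreover have "ennreal q + ennreal q = ennreal (2 * q)"
        using q by (simp add: ennreal_plus[symmetric] del: ennreal_plus)
      ultimately show ?thesis using C q by (simp add: ennreal_mult[symmetric])
    qed
    also have "\<dots> \<le> ennreal ((C + 2) * exp (- (b / 4 * real N)))"
    proof (rule ennreal_leI)
      have "b * real N / 4 \<le> b * real N / (4 * s)" using b s by (intro divide_left_mono) auto
      then have "q \<le> exp (- (b / 4 * real N))" unfolding q_def by simp
      moreover have "C * exp (- (b * real N / 2)) \<le> C * exp (- (b / 4 * real N))"
        using C b by (intro mult_left_mono) auto
      ultimately show "C * exp (- (b * real N / 2)) + 2 * q \<le> (C + 2) * exp (- (b / 4 * real N))"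
        by (simp add: distrib_right)
    qed
    finally show "(\<integral>\<^sup>+y. (\<integral>\<^sup>+w. ennreal (LR l N y w) * ennreal (Zbad l N e y w / Lik l N w) \<partial>GE N) \<partial>prior N)
       \<le> ennreal ((C + 2) * exp (- (b / 4 * real N)))" .
  qed (use b C in auto)
qed

end

section \<open>Small overlaps\<close>

text \<open>Hubbard-Stratonovich linearisation, truncated so that only tilts for which the moment
  generating function of the overlap is nearly Gaussian occur.\<close>

lemma exp_square_le_window:
  fixes c c0 :: real
  assumes c: "\<bar>c\<bar> \<le> c0"
  shows "ennreal (exp (c\<^sup>2 / 2)) * emeasure std_normal_distribution {- 1..1}
    \<le> (\<integral>\<^sup>+g. indicator {- (c0 + 1)..c0 + 1} g * ennreal (exp (c * g)) \<partial>std_normal_distribution)"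
proof -
  let ?I = "indicator {- (c0 + 1)..c0 + 1} :: real \<Rightarrow> ennreal"
  have "ennreal (exp (c\<^sup>2 / 2)) * emeasure std_normal_distribution {- 1..1}
     = ennreal (exp (c\<^sup>2 / 2)) * (\<integral>\<^sup>+g. indicator {- 1..1} g \<partial>std_normal_distribution)"
    by simp
  \<comment> \<open>For \<open>|c| <= c0\<close> a point of \<open>{- 1..1}\<close> translated by
    \<open>c\<close> stays in the window, so truncation costs only the constant factor given by the
    mass of \<open>{- 1..1}\<close>.\<close>
  also have "\<dots> \<le> ennreal (exp (c\<^sup>2 / 2)) * (\<integral>\<^sup>+g. ?I (c + g) \<partial>std_normal_distribution)"
    using c by (intro mult_left_mono nn_integral_mono) (auto simp: indicator_def)
  also have "(\<integral>\<^sup>+g. ?I (c + g) \<partial>std_normal_distribution) = (\<integral>\<^sup>+g. ?I g * ennreal (exp (c * g - c\<^sup>2 / 2)) \<partial>std_normal_distribution)"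
    by (rule nn_integral_std_normal_shift) measurable
  also have "ennreal (exp (c\<^sup>2 / 2)) * \<dots> = (\<integral>\<^sup>+g. ennreal (exp (c\<^sup>2 / 2)) * (?I g * ennreal (exp (c * g - c\<^sup>2 / 2))) \<partial>std_normal_distribution)"
    by (rule nn_integral_cmult[symmetric]) measurable
  also have "\<dots> = (\<integral>\<^sup>+g. ?I g * ennreal (exp (c * g)) \<partial>std_normal_distribution)"
  proof (rule nn_integral_cong)
    fix g
    have "ennreal (exp (c\<^sup>2 / 2)) * ennreal (exp (c * g - c\<^sup>2 / 2)) = ennreal (exp (c * g))"
      by (simp add: ennreal_mult[symmetric] exp_add[symmetric])
    then show "ennreal (exp (c\<^sup>2 / 2)) * (?I g * ennreal (exp (c * g - c\<^sup>2 / 2))) = ?I g * ennreal (exp (c * g))"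
      by (metis mult.left_commute)
  qed
  finally show ?thesis .
qed

lemma emeasure_std_normal_window:
  obtains p :: real where "0 < p" "emeasure std_normal_distribution {- 1..1} = ennreal p"
proof -
  interpret prob_space std_normal_distribution by (rule prob_space_std_normal)
  have "emeasure std_normal_distribution {- 1..1} \<noteq> 0"
  proof
    assume "emeasure std_normal_distribution {- 1..1 :: real} = 0"
    then have "(\<integral>\<^sup>+x. ennreal (std_normal_density x) * indicator {- 1..1} x \<partial>lborel) = 0"
      by (subst (asm) emeasure_density) auto
    then have "AE x in lborel. ennreal (std_normal_density x) * indicator {- 1..1 :: real} x = 0"
      by (subst (asm) nn_integral_0_iff_AE) auto
    then have "AE x in lborel. x \<notin> {- 1..1 :: real}"
    proof eventually_elim
      case (elim x)
      have "0 < std_normal_density x" by (rule normal_density_pos) simp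
      then show ?case using elim by (auto simp: indicator_def split: if_splits)
    qed
    then have "{- 1..1 :: real} \<in> null_sets lborel" by (subst AE_iff_null_sets) auto
    then have "emeasure lborel {- 1..1 :: real} = 0" by (rule null_setsD1)
    then show False by simp
  qed
  then have "0 < measure std_normal_distribution {- 1..1}"
    by (simp add: emeasure_eq_measure zero_less_measure_iff)
  then show ?thesis using that emeasure_eq_measure by blast
qed

context bounded_prior
begin

text \<open>Zero mean removes the linear term, and unit variance makes the quadratic coefficient
  \<open>t^2 / 2\<close>. The correction \<open>exp (|t| B^2)\<close> is close to \<open>1\<close>
  only for small \<open>t\<close>, which is why this estimate is reserved for small
  overlaps.\<close>

lemma nn_integral_exp_product_le:
  "(\<integral>\<^sup>+x. (\<integral>\<^sup>+y. ennreal (exp (t * (x * y))) \<partial>P) \<partial>P) \<le> ennreal (exp (t\<^sup>2 / 2 * exp (\<bar>t\<bar> * B\<^sup>2)))"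
proof -
  define K where "K = t\<^sup>2 / 2 * exp (\<bar>t\<bar> * B\<^sup>2)"
  have K: "0 \<le> K" unfolding K_def by simp
  have pt: "exp (t * (x * y)) \<le> 1 + t * x * y + K * x\<^sup>2 * y\<^sup>2" if "\<bar>x\<bar> \<le> B" "\<bar>y\<bar> \<le> B" for x y
  proof -
    have "\<bar>x * y\<bar> \<le> B\<^sup>2" unfolding abs_mult power2_eq_square using that by (intro mult_mono) auto
    then have "\<bar>t * (x * y)\<bar> \<le> \<bar>t\<bar> * B\<^sup>2" unfolding abs_mult[of t] by (intro mult_left_mono) auto
    then have "(t * (x * y))\<^sup>2 / 2 * exp \<bar>t * (x * y)\<bar> \<le> (t * (x * y))\<^sup>2 / 2 * exp (\<bar>t\<bar> * B\<^sup>2)"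
      by (intro mult_left_mono) auto
    then have "exp (t * (x * y)) \<le> 1 + t * (x * y) + (t * (x * y))\<^sup>2 / 2 * exp (\<bar>t\<bar> * B\<^sup>2)"
      using exp_minus_linear_le[of "t * (x * y)"] by linarith
    then show ?thesis unfolding K_def by (simp add: power_mult_distrib mult_ac)
  qed
  have inner: "(\<integral>\<^sup>+y. ennreal (exp (t * (x * y))) \<partial>P) \<le> ennreal (1 + K * x\<^sup>2)" if x: "\<bar>x\<bar> \<le> B" for x
  proof -
    have "(\<integral>\<^sup>+y. ennreal (exp (t * (x * y))) \<partial>P) \<le> (\<integral>\<^sup>+y. ennreal (1 + t * x * y + K * x\<^sup>2 * y\<^sup>2) \<partial>P)"
      by (intro nn_integral_mono_AE eventually_mono[OF bdd] ennreal_leI pt x)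
    also have "\<dots> = ennreal (\<integral>y. 1 + t * x * y + K * x\<^sup>2 * y\<^sup>2 \<partial>P)"
    proof (rule nn_integral_eq_integral)
      show "integrable P (\<lambda>y. 1 + t * x * y + K * x\<^sup>2 * y\<^sup>2)" using integrable_id by auto
      show "AE y in P. 0 \<le> 1 + t * x * y + K * x\<^sup>2 * y\<^sup>2"
        by (rule eventually_mono[OF bdd]) (meson exp_ge_zero order_trans pt x)
    qed
    also have "(\<integral>y. 1 + t * x * y + K * x\<^sup>2 * y\<^sup>2 \<partial>P) = 1 + K * x\<^sup>2"
      using integrable_id mean0 var1 by (simp add: prob_UNIV)
    finally show ?thesis .
  qed
  have "(\<integral>\<^sup>+x. (\<integral>\<^sup>+y. ennreal (exp (t * (x * y))) \<partial>P) \<partial>P) \<le> (\<integral>\<^sup>+x. ennreal (1 + K * x\<^sup>2) \<partial>P)"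
    by (rule nn_integral_mono_AE, rule eventually_mono[OF bdd], rule inner)
  also have "\<dots> = ennreal (\<integral>x. 1 + K * x\<^sup>2 \<partial>P)"
    using integrable_id K by (intro nn_integral_eq_integral) auto
  also have "(\<integral>x. 1 + K * x\<^sup>2 \<partial>P) = 1 + K" using integrable_id var1 by (simp add: prob_UNIV)
  also have "ennreal (1 + K) \<le> ennreal (exp K)" by (intro ennreal_leI) simp
  finally show ?thesis unfolding K_def .
qed

lemma nn_integral_exp_overlap_le:
  "(\<integral>\<^sup>+x. (\<integral>\<^sup>+y. ennreal (exp (t * (\<Sum>i\<in>{1..N}. x i * y i))) \<partial>prior N) \<partial>prior N)
    \<le> ennreal (exp (real N * (t\<^sup>2 / 2 * exp (\<bar>t\<bar> * B\<^sup>2))))"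
proof -
  have e: "ennreal (exp (t * (\<Sum>i\<in>{1..N}. x i * y i))) = (\<Prod>i\<in>{1..N}. ennreal (exp (t * (x i * y i))))" for x y :: "nat \<Rightarrow> real"
    by (subst prod_ennreal) (auto simp: sum_distrib_left exp_sum)
  have "(\<integral>\<^sup>+x. (\<integral>\<^sup>+y. ennreal (exp (t * (\<Sum>i\<in>{1..N}. x i * y i))) \<partial>prior N) \<partial>prior N)
    = (\<integral>\<^sup>+x. (\<Prod>i\<in>{1..N}. \<integral>\<^sup>+y. ennreal (exp (t * (x i * y))) \<partial>P) \<partial>prior N)"
    unfolding e by (intro nn_integral_cong nn_integral_prod_prior) measurable
  also have "\<dots> = (\<Prod>i\<in>{1..N}. \<integral>\<^sup>+x. (\<integral>\<^sup>+y. ennreal (exp (t * (x * y))) \<partial>P) \<partial>P)"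
    by (rule nn_integral_prod_prior) measurable
  also have "\<dots> \<le> (\<Prod>i\<in>{1..N}. ennreal (exp (t\<^sup>2 / 2 * exp (\<bar>t\<bar> * B\<^sup>2))))"
    by (intro prod_mono_ennreal nn_integral_exp_product_le)
  also have "\<dots> = ennreal (exp (real N * (t\<^sup>2 / 2 * exp (\<bar>t\<bar> * B\<^sup>2))))"
    by (simp add: ennreal_power exp_of_nat_mult[symmetric])
  finally show ?thesis .
qed

lemma measurable_sum_prior [measurable]:
  assumes "f \<in> measurable M (prior N)" "g \<in> measurable M (prior N)"
  shows "(\<lambda>p. \<Sum>i\<in>{1..N}. f p i * g p i) \<in> borel_measurable M"
  using measurable_prior_component[OF assms(1)] measurable_prior_component[OF assms(2)] by measurable

text \<open>With \<open>a\<close> between \<open>l\<close> and \<open>1\<close>,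
  \<open>exp (a N R^2 / 2)\<close> is dominated by a Gaussian mixture of
  \<open>exp (g r N R)\<close> with \<open>r = sqrt (a / N)\<close>; averaging over the replicas
  leaves at most \<open>exp (\<tau> g^2 / 2)\<close> with \<open>\<tau> < 1\<close>, which is
  integrable. The room between \<open>l\<close> and \<open>a\<close> pays for the weight
  \<open>1 + N R^2\<close>, through which \<open>N <R^2>\<close> is controlled too.\<close>

theorem small_overlap:
  assumes l: "0 < l" "l < 1"
  obtains e C :: real and N0 :: nat where "0 < e" "0 \<le> C" "0 < N0"
    "\<And>N. N0 \<le> N \<Longrightarrow> (\<integral>\<^sup>+x. (\<integral>\<^sup>+y. ennreal (indicator {y. \<bar>ov N x y\<bar> \<le> e} y * (1 + real N * (ov N x y)\<^sup>2) * exp (corr l N x y)) \<partial>prior N) \<partial>prior N)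
       \<le> ennreal C"
proof -
  define a where "a = (1 + l) / 2"
  have a: "l < a" "a < 1" "0 < a" unfolding a_def using l by auto
  define \<tau> where "\<tau> = (1 + a) / 2"
  have \<tau>: "a < \<tau>" "\<tau> < 1" unfolding \<tau>_def using a by auto
  \<comment> \<open>The largest tilt at which the correction \<open>exp (|t| B^2)\<close> raises the
    Gaussian exponent only from \<open>a\<close> to \<open>\<tau>\<close>.\<close>
  define t0 where "t0 = ln (\<tau> / a) / B\<^sup>2"
  have t0: "0 < t0" unfolding t0_def using \<tau> a B1 by (intro divide_pos_pos ln_gt_zero) auto
  have expt0: "a * exp (\<bar>t\<bar> * B\<^sup>2) \<le> \<tau>" if "\<bar>t\<bar> \<le> t0" for t
  proof -
    have "exp (\<bar>t\<bar> * B\<^sup>2) \<le> exp (t0 * B\<^sup>2)" using that by (simp add: mult_right_mono)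
    also have "\<dots> = \<tau> / a" unfolding t0_def using \<tau> a B1 by simp
    finally show ?thesis using a by (simp add: le_divide_eq mult.commute)
  qed
  \<comment> \<open>Together with \<open>r <= t0 / 2\<close>, which \<open>N0\<close> ensures, this
    bounds every tilt in the window: \<open>(c0 + 1) r = a e + r <= t0\<close>.\<close>
  define e where "e = t0 / (2 * a)"
  have e: "0 < e" unfolding e_def using t0 a by simp
  obtain N1 :: nat where N1: "4 * a / t0\<^sup>2 \<le> real N1" using real_arch_simple by blast
  define N0 where "N0 = Suc N1"
  \<comment> \<open>Chosen so that \<open>\<beta> + l / 2 = a / 2\<close>; the weight is absorbed by
    \<open>1 + u <= exp (\<beta> u) / \<beta>\<close>.\<close>
  define \<beta> where "\<beta> = (a - l) / 2"
  have \<beta>: "0 < \<beta>" "\<beta> < 1" unfolding \<beta>_def using a l by auto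
  obtain p where p: "0 < p" "emeasure std_normal_distribution {- 1..1} = ennreal p" by (rule emeasure_std_normal_window)
  define C where "C = 1 / \<beta> * (1 / p) * (1 / sqrt (1 - \<tau>))"
  show ?thesis
  proof (rule that[of e C N0])
    show "0 < e" by (rule e)
    show "0 \<le> C" unfolding C_def using \<beta> p \<tau> by simp
    show "0 < N0" unfolding N0_def by simp
    fix N assume NN: "N0 \<le> N"
    then have N: "0 < N" unfolding N0_def by simp
    interpret pr: prob_space "prior N" by (rule prob_space_prior)
    interpret pp: pair_sigma_finite "prior N" "prior N" ..
    interpret pg: pair_sigma_finite "prior N" \<gamma> ..
    define r where "r = sqrt (a / real N)"
    have r: "0 < r" "r\<^sup>2 = a / real N" "r \<le> t0 / 2"
    proof -
      show "0 < r" "r\<^sup>2 = a / real N" unfolding r_def using a N by auto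
      have "4 * a / t0\<^sup>2 \<le> real N" using N1 NN unfolding N0_def by linarith
      then have "a / real N \<le> (t0 / 2)\<^sup>2" using t0 N by (simp add: field_simps power2_eq_square)
      then show "r \<le> t0 / 2" unfolding r_def using t0 by (intro real_le_lsqrt) auto
    qed
    define c0 where "c0 = r * real N * e"
    let ?J = "indicator {- (c0 + 1)..c0 + 1} :: real \<Rightarrow> ennreal"
    let ?s = "\<lambda>x y. \<Sum>i\<in>{1..N}. x i * (y i :: real)"
    have pt: "ennreal (indicator {y. \<bar>ov N x y\<bar> \<le> e} y * (1 + real N * (ov N x y)\<^sup>2) * exp (corr l N x y))
       \<le> ennreal (1 / \<beta> * (1 / p)) * (\<integral>\<^sup>+g. ?J g * ennreal (exp ((g * r) * ?s x y)) \<partial>\<gamma>)" for x y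
    proof (cases "\<bar>ov N x y\<bar> \<le> e")
      case True
      define R where "R = ov N x y"
      define c where "c = r * real N * R"
      have s: "?s x y = real N * R" unfolding R_def ov_def using N by simp
      have c0: "\<bar>c\<bar> \<le> c0" unfolding c_def c0_def abs_mult using True r N by (auto simp: R_def intro!: mult_left_mono)
      have c2: "c\<^sup>2 = a * (real N * R\<^sup>2)" unfolding c_def power_mult_distrib r(2) using N by (simp add: power2_eq_square)
      have "(1 + real N * R\<^sup>2) * exp (corr l N x y) \<le> (1 / \<beta> * exp (\<beta> * (real N * R\<^sup>2))) * exp (l * real N * R\<^sup>2 / 2)"
      proof (intro mult_mono)
        have "\<beta> * (1 + real N * R\<^sup>2) \<le> 1 + \<beta> * (real N * R\<^sup>2)" using \<beta> by (simp add: distrib_left)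
        also have "\<dots> \<le> exp (\<beta> * (real N * R\<^sup>2))" by simp
        finally show "1 + real N * R\<^sup>2 \<le> 1 / \<beta> * exp (\<beta> * (real N * R\<^sup>2))" using \<beta> by (simp add: field_simps)
        show "exp (corr l N x y) \<le> exp (l * real N * R\<^sup>2 / 2)" unfolding R_def using corr_le[of l N x y] l N by simp
      qed (use \<beta> in auto)
      also have "\<dots> = 1 / \<beta> * exp (c\<^sup>2 / 2)"
      proof -
        have "\<beta> * (real N * R\<^sup>2) + l * real N * R\<^sup>2 / 2 = c\<^sup>2 / 2" unfolding c2 \<beta>_def by (simp add: field_simps)
        then show ?thesis by (simp add: exp_add[symmetric] mult.assoc)
      qed
      finally have "ennreal (indicator {y. \<bar>ov N x y\<bar> \<le> e} y * (1 + real N * (ov N x y)\<^sup>2) * exp (corr l N x y)) \<le> ennreal (1 / \<beta> * exp (c\<^sup>2 / 2))"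
        using True unfolding R_def by (simp add: ennreal_leI)
      also have "\<dots> = ennreal (1 / \<beta> * (1 / p)) * (ennreal (exp (c\<^sup>2 / 2)) * ennreal p)"
        using \<beta> p by (simp add: ennreal_mult[symmetric])
      also have "\<dots> \<le> ennreal (1 / \<beta> * (1 / p)) * (\<integral>\<^sup>+g. ?J g * ennreal (exp (c * g)) \<partial>\<gamma>)"
        using exp_square_le_window[OF c0] unfolding p(2) by (intro mult_left_mono) auto
      also have "(\<lambda>g. c * g) = (\<lambda>g. (g * r) * ?s x y)" unfolding s c_def by (simp add: mult_ac)
      finally show ?thesis unfolding fun_eq_iff by simp
    qed simp
    have "(\<integral>\<^sup>+x. (\<integral>\<^sup>+y. ennreal (indicator {y. \<bar>ov N x y\<bar> \<le> e} y * (1 + real N * (ov N x y)\<^sup>2) * exp (corr l N x y)) \<partial>prior N) \<partial>prior N)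
      \<le> (\<integral>\<^sup>+x. (\<integral>\<^sup>+y. ennreal (1 / \<beta> * (1 / p)) * (\<integral>\<^sup>+g. ?J g * ennreal (exp ((g * r) * ?s x y)) \<partial>\<gamma>) \<partial>prior N) \<partial>prior N)"
      by (intro nn_integral_mono pt)
    also have "\<dots> = ennreal (1 / \<beta> * (1 / p)) * (\<integral>\<^sup>+x. (\<integral>\<^sup>+y. (\<integral>\<^sup>+g. ?J g * ennreal (exp ((g * r) * ?s x y)) \<partial>\<gamma>) \<partial>prior N) \<partial>prior N)"
      using nn_integral_linear_iterated[of "\<lambda>x y. \<integral>\<^sup>+g. ?J g * ennreal (exp ((g * r) * ?s x y)) \<partial>\<gamma>" "prior N" "prior N" "\<lambda>_ _. 0" "ennreal (1 / \<beta> * (1 / p))"]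
        pr.sigma_finite_measure_axioms by simp
    also have "(\<integral>\<^sup>+x. (\<integral>\<^sup>+y. (\<integral>\<^sup>+g. ?J g * ennreal (exp ((g * r) * ?s x y)) \<partial>\<gamma>) \<partial>prior N) \<partial>prior N)
      = (\<integral>\<^sup>+x. (\<integral>\<^sup>+g. (\<integral>\<^sup>+y. ?J g * ennreal (exp ((g * r) * ?s x y)) \<partial>prior N) \<partial>\<gamma>) \<partial>prior N)"
    proof (rule nn_integral_cong)
      fix x assume [measurable]: "x \<in> space (prior N)"
      show "(\<integral>\<^sup>+y. (\<integral>\<^sup>+g. ?J g * ennreal (exp ((g * r) * ?s x y)) \<partial>\<gamma>) \<partial>prior N) = (\<integral>\<^sup>+g. (\<integral>\<^sup>+y. ?J g * ennreal (exp ((g * r) * ?s x y)) \<partial>prior N) \<partial>\<gamma>)"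
        by (rule pg.Fubini'[symmetric]) measurable
    qed
    also have "\<dots> = (\<integral>\<^sup>+g. (\<integral>\<^sup>+x. (\<integral>\<^sup>+y. ?J g * ennreal (exp ((g * r) * ?s x y)) \<partial>prior N) \<partial>prior N) \<partial>\<gamma>)"
      by (rule pg.Fubini'[symmetric]) measurable
    also have "\<dots> \<le> (\<integral>\<^sup>+g. ennreal (exp (\<tau> * g\<^sup>2 / 2)) \<partial>\<gamma>)"
    proof (rule nn_integral_mono)
      fix g :: real
      show "(\<integral>\<^sup>+x. (\<integral>\<^sup>+y. ?J g * ennreal (exp ((g * r) * ?s x y)) \<partial>prior N) \<partial>prior N) \<le> ennreal (exp (\<tau> * g\<^sup>2 / 2))"
      proof (cases "g \<in> {- (c0 + 1)..c0 + 1}")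
        case True
        have "\<bar>g * r\<bar> \<le> (c0 + 1) * r" unfolding abs_mult using True r by (intro mult_mono) auto
        also have "\<dots> = r\<^sup>2 * real N * e + r" unfolding c0_def by (simp add: algebra_simps power2_eq_square)
        also have "\<dots> \<le> t0 / 2 + t0 / 2"
          unfolding r(2) e_def using a N r(3) by simp
        finally have t: "\<bar>g * r\<bar> \<le> t0" by simp
        have "(\<integral>\<^sup>+x. (\<integral>\<^sup>+y. ?J g * ennreal (exp ((g * r) * ?s x y)) \<partial>prior N) \<partial>prior N)
          = (\<integral>\<^sup>+x. (\<integral>\<^sup>+y. ennreal (exp ((g * r) * ?s x y)) \<partial>prior N) \<partial>prior N)" using True by simp
        also have "\<dots> \<le> ennreal (exp (real N * ((g * r)\<^sup>2 / 2 * exp (\<bar>g * r\<bar> * B\<^sup>2))))"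
          by (rule nn_integral_exp_overlap_le)
        also have "\<dots> \<le> ennreal (exp (\<tau> * g\<^sup>2 / 2))"
        proof (rule ennreal_leI, subst exp_le_cancel_iff)
          have "real N * ((g * r)\<^sup>2 / 2 * exp (\<bar>g * r\<bar> * B\<^sup>2)) = g\<^sup>2 / 2 * (a * exp (\<bar>g * r\<bar> * B\<^sup>2))"
            unfolding power_mult_distrib r(2) using N by simp
          also have "\<dots> \<le> g\<^sup>2 / 2 * \<tau>" using expt0[OF t] by (intro mult_left_mono) auto
          finally show "real N * ((g * r)\<^sup>2 / 2 * exp (\<bar>g * r\<bar> * B\<^sup>2)) \<le> \<tau> * g\<^sup>2 / 2" by (simp add: mult.commute)
        qed
        finally show ?thesis .
      qed simp
    qed
    also have "\<dots> = ennreal (1 / sqrt (1 - \<tau>))" by (rule nn_integral_exp_square[OF \<tau>(2)])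
    finally have "(\<integral>\<^sup>+x. (\<integral>\<^sup>+y. ennreal (indicator {y. \<bar>ov N x y\<bar> \<le> e} y * (1 + real N * (ov N x y)\<^sup>2) * exp (corr l N x y)) \<partial>prior N) \<partial>prior N)
       \<le> ennreal (1 / \<beta> * (1 / p)) * ennreal (1 / sqrt (1 - \<tau>))" by (simp add: mult_left_mono)
    also have "\<dots> = ennreal C" unfolding C_def using \<beta> p \<tau> by (intro ennreal_mult[symmetric]) auto
    finally show "(\<integral>\<^sup>+x. (\<integral>\<^sup>+y. ennreal (indicator {y. \<bar>ov N x y\<bar> \<le> e} y * (1 + real N * (ov N x y)\<^sup>2) * exp (corr l N x y)) \<partial>prior N) \<partial>prior N)
       \<le> ennreal C" .
  qed
qed

end

section \<open>The likelihood ratio\<close>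

context bounded_prior
begin

lemma ov_commute: "ov N x y = ov N y x"
  unfolding ov_def by (simp add: mult.commute)

lemma corr_commute: "corr l N x y = corr l N y x"
  unfolding corr_def by (simp add: mult.commute)

lemma nn_integral_LR_LR: "(\<integral>\<^sup>+w. ennreal (LR l N x w) * ennreal (LR l N y w) \<partial>GE N) = ennreal (exp (corr l N x y))"
  if [measurable]: "x \<in> space (prior N)" "y \<in> space (prior N)"
proof -
  have "(\<integral>\<^sup>+w. ennreal (LR l N x w) * ennreal (LR l N y w) \<partial>GE N) = (\<integral>\<^sup>+w. ennreal (LR l N y (\<lambda>e\<in>upper_pairs N. feat l N x e + w e)) \<partial>GE N)"
    by (rule nn_integral_LR_shift) measurable
  also have "\<dots> = (\<integral>\<^sup>+w. ennreal (exp (corr l N y x)) * ennreal (LR l N y w) \<partial>GE N)"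
    unfolding LR_shift by (simp add: ennreal_mult)
  also have "\<dots> = ennreal (exp (corr l N y x)) * (\<integral>\<^sup>+w. ennreal (LR l N y w) \<partial>GE N)"
    by (rule nn_integral_cmult) measurable
  also have "\<dots> = ennreal (exp (corr l N x y))"
    unfolding LR_def by (simp add: nn_integral_wick corr_commute)
  finally show ?thesis .
qed

text \<open>The small-overlap part of the two-replica integral, not normalised. The weight lets one
  quantity dominate both the square of \<open>Lik\<close> and, up to normalisation, the posterior
  mean of \<open>N R^2\<close>.\<close>

definition Sm :: "real \<Rightarrow> nat \<Rightarrow> real \<Rightarrow> (nat \<times> nat \<Rightarrow> real) \<Rightarrow> ennreal" where
  "Sm l N e w = (\<integral>\<^sup>+x. (\<integral>\<^sup>+y. ennreal (indicator {y. \<bar>ov N x y\<bar> \<le> e} y * (1 + real N * (ov N x y)\<^sup>2)) * (ennreal (LR l N x w) * ennreal (LR l N y w)) \<partial>prior N) \<partial>prior N)"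

text \<open>\<open>Lik\<close> times the posterior probability that two replicas have a large
  overlap, so that its unspiked mean is the spiked mean of that probability.\<close>

definition Bg :: "real \<Rightarrow> nat \<Rightarrow> real \<Rightarrow> (nat \<times> nat \<Rightarrow> real) \<Rightarrow> ennreal" where
  "Bg l N e w = (\<integral>\<^sup>+y. ennreal (LR l N y w) * ennreal (Zbad l N e y w / Lik l N w) \<partial>prior N)"

lemma ind_le_measurable [measurable]:
  assumes [measurable]: "f \<in> measurable M (prior N)" "g \<in> measurable M (prior N)"
  shows "(\<lambda>p. indicator {y. \<bar>ov N (g p) y\<bar> \<le> e} (f p) :: real) \<in> borel_measurable M"
  unfolding indicator_def by simp

lemma sigma_finite_prior: "sigma_finite_measure (prior N)"
  using prob_space_prior by (rule prob_space_imp_sigma_finite)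

lemma Lik_measurable' [measurable]: "f \<in> measurable M (GE N) \<Longrightarrow> (\<lambda>p. Lik l N (f p)) \<in> borel_measurable M"
  by (rule measurable_compose[OF _ Lik_measurable])

lemma Sm_measurable [measurable]: "Sm l N e \<in> borel_measurable (GE N)"
proof -
  interpret pr: sigma_finite_measure "prior N" by (rule sigma_finite_prior)
  show ?thesis unfolding Sm_def[abs_def] by measurable
qed

lemma Bg_measurable [measurable]: "Bg l N e \<in> borel_measurable (GE N)"
proof -
  interpret pr: sigma_finite_measure "prior N" by (rule sigma_finite_prior)
  show ?thesis unfolding Bg_def[abs_def] by measurable
qed

lemma nn_integral_Bg:
  "(\<integral>\<^sup>+w. Bg l N e w \<partial>GE N) = (\<integral>\<^sup>+y. (\<integral>\<^sup>+w. ennreal (LR l N y w) * ennreal (Zbad l N e y w / Lik l N w) \<partial>GE N) \<partial>prior N)"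
proof -
  interpret pr: sigma_finite_measure "prior N" by (rule sigma_finite_prior)
  interpret G: sigma_finite_measure "GE N" by (rule sigma_finite_Gauss)
  interpret pG: pair_sigma_finite "prior N" "GE N" ..
  show ?thesis unfolding Bg_def by (rule pG.Fubini') measurable
qed

lemma nn_integral_Sm:
  "(\<integral>\<^sup>+w. Sm l N e w \<partial>GE N) = (\<integral>\<^sup>+x. (\<integral>\<^sup>+y. ennreal (indicator {y. \<bar>ov N x y\<bar> \<le> e} y * (1 + real N * (ov N x y)\<^sup>2) * exp (corr l N x y)) \<partial>prior N) \<partial>prior N)"
proof -
  interpret pr: sigma_finite_measure "prior N" by (rule sigma_finite_prior)
  interpret G: sigma_finite_measure "GE N" by (rule sigma_finite_Gauss)
  interpret pG: pair_sigma_finite "prior N" "GE N" ..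
  let ?c = "\<lambda>x y. ennreal (indicator {y. \<bar>ov N x y\<bar> \<le> e} y * (1 + real N * (ov N x y)\<^sup>2))"
  have "(\<integral>\<^sup>+w. Sm l N e w \<partial>GE N) = (\<integral>\<^sup>+x. (\<integral>\<^sup>+w. (\<integral>\<^sup>+y. ?c x y * (ennreal (LR l N x w) * ennreal (LR l N y w)) \<partial>prior N) \<partial>GE N) \<partial>prior N)"
    unfolding Sm_def by (rule pG.Fubini') measurable
  also have "\<dots> = (\<integral>\<^sup>+x. (\<integral>\<^sup>+y. (\<integral>\<^sup>+w. ?c x y * (ennreal (LR l N x w) * ennreal (LR l N y w)) \<partial>GE N) \<partial>prior N) \<partial>prior N)"
  proof (rule nn_integral_cong)
    fix x assume [measurable]: "x \<in> space (prior N)"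
    show "(\<integral>\<^sup>+w. (\<integral>\<^sup>+y. ?c x y * (ennreal (LR l N x w) * ennreal (LR l N y w)) \<partial>prior N) \<partial>GE N) = (\<integral>\<^sup>+y. (\<integral>\<^sup>+w. ?c x y * (ennreal (LR l N x w) * ennreal (LR l N y w)) \<partial>GE N) \<partial>prior N)"
      by (rule pG.Fubini') measurable
  qed
  also have "\<dots> = (\<integral>\<^sup>+x. (\<integral>\<^sup>+y. ?c x y * ennreal (exp (corr l N x y)) \<partial>prior N) \<partial>prior N)"
  proof (intro nn_integral_cong)
    fix x y assume xy [measurable]: "x \<in> space (prior N)" "y \<in> space (prior N)"
    have "(\<integral>\<^sup>+w. ?c x y * (ennreal (LR l N x w) * ennreal (LR l N y w)) \<partial>GE N) = ?c x y * (\<integral>\<^sup>+w. ennreal (LR l N x w) * ennreal (LR l N y w) \<partial>GE N)"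
      by (rule nn_integral_cmult) measurable
    then show "(\<integral>\<^sup>+w. ?c x y * (ennreal (LR l N x w) * ennreal (LR l N y w)) \<partial>GE N) = ?c x y * ennreal (exp (corr l N x y))"
      by (simp only: nn_integral_LR_LR[OF xy])
  qed
  also have "\<dots> = (\<integral>\<^sup>+x. (\<integral>\<^sup>+y. ennreal (indicator {y. \<bar>ov N x y\<bar> \<le> e} y * (1 + real N * (ov N x y)\<^sup>2) * exp (corr l N x y)) \<partial>prior N) \<partial>prior N)"
    by (intro nn_integral_cong ennreal_mult[symmetric]) auto
  finally show ?thesis .
qed

lemma Zbad_eq_nn:
  assumes [measurable]: "w \<in> space (GE N)" "y \<in> space (prior N)"
  shows "ennreal (Zbad l N e y w) = (\<integral>\<^sup>+x. ennreal (indicator {x. e < \<bar>ov N x y\<bar>} x * LR l N x w) \<partial>prior N)"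
  unfolding Zbad_def
proof (rule nn_integral_eq_integral[symmetric])
  show "integrable (prior N) (\<lambda>x. indicator {x. e < \<bar>ov N x y\<bar>} x * LR l N x w)"
    using assms by (intro integrable_LR_times[where C = 1]) (auto simp: indicator_def)
qed auto

text \<open>Each pair of replicas is charged either to the small-overlap part or, with the crude
  bound \<open>D\<close>, to the large-overlap part. \<open>D\<close> may grow with
  \<open>N\<close>, since the latter is exponentially small on average.\<close>

lemma iterated_split_le:
  assumes w [measurable]: "w \<in> space (GE N)" and h [measurable]: "(\<lambda>p. h (fst p) (snd p)) \<in> borel_measurable (prior N \<Otimes>\<^sub>M prior N)"
    and hs: "\<And>x y. \<bar>ov N x y\<bar> \<le> e \<Longrightarrow> h x y \<le> 1 + real N * (ov N x y)\<^sup>2"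
    and hb: "\<And>x y. x \<in> cube N \<Longrightarrow> y \<in> cube N \<Longrightarrow> h x y \<le> D" and D: "0 \<le> D"
  shows "(\<integral>\<^sup>+x. (\<integral>\<^sup>+y. ennreal (h x y) * (ennreal (LR l N x w) * ennreal (LR l N y w)) \<partial>prior N) \<partial>prior N)
    \<le> Sm l N e w + ennreal D * ennreal (Lik l N w) * Bg l N e w"
proof -
  interpret pr: prob_space "prior N" by (rule prob_space_prior)
  note [measurable] = measurable_split_compose[OF h]
  let ?s = "\<lambda>x y. ennreal (indicator {y. \<bar>ov N x y\<bar> \<le> e} y * (1 + real N * (ov N x y)\<^sup>2)) * (ennreal (LR l N x w) * ennreal (LR l N y w))"
  let ?b = "\<lambda>x y. ennreal (LR l N x w) * ennreal (indicator {y. e < \<bar>ov N y x\<bar>} y * LR l N y w)"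
  have "(\<integral>\<^sup>+x. (\<integral>\<^sup>+y. ennreal (h x y) * (ennreal (LR l N x w) * ennreal (LR l N y w)) \<partial>prior N) \<partial>prior N)
     \<le> (\<integral>\<^sup>+x. (\<integral>\<^sup>+y. ennreal D * ?b x y + ?s x y \<partial>prior N) \<partial>prior N)"
  proof (rule nn_integral_mono_AE, rule eventually_mono[OF AE_cube], rule nn_integral_mono_AE, rule eventually_mono[OF AE_cube])
    fix x y assume xy: "x \<in> cube N" "y \<in> cube N"
    show "ennreal (h x y) * (ennreal (LR l N x w) * ennreal (LR l N y w)) \<le> ennreal D * ?b x y + ?s x y"
    proof (cases "\<bar>ov N x y\<bar> \<le> e")
      case True
      then have "ennreal (h x y) * (ennreal (LR l N x w) * ennreal (LR l N y w)) \<le> ?s x y"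
        using hs[of x y] by (intro mult_right_mono ennreal_leI) auto
      then show ?thesis by (rule order_trans) simp
    next
      case False
      then have "ennreal (h x y) * (ennreal (LR l N x w) * ennreal (LR l N y w)) \<le> ennreal D * ?b x y"
        using hb[OF xy] by (intro mult_mono) (auto intro!: ennreal_leI simp: ov_commute[of N x y])
      then show ?thesis by (rule order_trans) simp
    qed
  qed
  also have "\<dots> = ennreal D * (\<integral>\<^sup>+x. (\<integral>\<^sup>+y. ?b x y \<partial>prior N) \<partial>prior N) + (\<integral>\<^sup>+x. (\<integral>\<^sup>+y. ?s x y \<partial>prior N) \<partial>prior N)"
    by (rule nn_integral_linear_iterated) (measurable, rule sigma_finite_prior)
  also have "(\<integral>\<^sup>+x. (\<integral>\<^sup>+y. ?s x y \<partial>prior N) \<partial>prior N) = Sm l N e w" unfolding Sm_def ..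
  also have "(\<integral>\<^sup>+x. (\<integral>\<^sup>+y. ?b x y \<partial>prior N) \<partial>prior N) = ennreal (Lik l N w) * Bg l N e w"
  proof -
    have "(\<integral>\<^sup>+x. (\<integral>\<^sup>+y. ?b x y \<partial>prior N) \<partial>prior N) = (\<integral>\<^sup>+x. ennreal (Lik l N w) * (ennreal (LR l N x w) * ennreal (Zbad l N e x w / Lik l N w)) \<partial>prior N)"
    proof (rule nn_integral_cong)
      fix x assume x [measurable]: "x \<in> space (prior N)"
      have "(\<integral>\<^sup>+y. ?b x y \<partial>prior N) = ennreal (LR l N x w) * ennreal (Zbad l N e x w)"
        unfolding Zbad_eq_nn[OF w x] by (rule nn_integral_cmult) measurable
      also have "ennreal (Zbad l N e x w) = ennreal (Lik l N w) * ennreal (Zbad l N e x w / Lik l N w)"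
        using Lik_pos[OF w, of l] by (simp add: ennreal_mult[symmetric])
      finally show "(\<integral>\<^sup>+y. ?b x y \<partial>prior N) = ennreal (Lik l N w) * (ennreal (LR l N x w) * ennreal (Zbad l N e x w / Lik l N w))"
        by (simp only: mult.left_commute)
    qed
    also have "\<dots> = ennreal (Lik l N w) * Bg l N e w"
      unfolding Bg_def by (rule nn_integral_cmult) measurable
    finally show ?thesis .
  qed
  finally show ?thesis by (simp add: add.commute mult.assoc)
qed

lemma Lik_square_le:
  assumes w [measurable]: "w \<in> space (GE N)"
  shows "ennreal (Lik l N w * Lik l N w) \<le> Sm l N e w + ennreal (Lik l N w) * Bg l N e w"
proof -
  have "ennreal (Lik l N w * Lik l N w) = ennreal (Lik l N w) * ennreal (Lik l N w)"
    using Lik_pos[OF w, of l] by (simp add: ennreal_mult)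
  also have "\<dots> = (\<integral>\<^sup>+x. ennreal (LR l N x w) * (\<integral>\<^sup>+y. ennreal (LR l N y w) \<partial>prior N) \<partial>prior N)"
    unfolding Lik_eq_nn[OF w] by (rule nn_integral_multc[symmetric]) measurable
  also have "\<dots> = (\<integral>\<^sup>+x. (\<integral>\<^sup>+y. ennreal 1 * (ennreal (LR l N x w) * ennreal (LR l N y w)) \<partial>prior N) \<partial>prior N)"
    by (intro nn_integral_cong) (simp add: nn_integral_cmult)
  also have "\<dots> \<le> Sm l N e w + ennreal 1 * ennreal (Lik l N w) * Bg l N e w"
    by (rule iterated_split_le[OF w]) auto
  finally show ?thesis by simp
qed

section \<open>The gradient of the log-likelihood ratio\<close>

definition slope :: "real \<Rightarrow> nat \<Rightarrow> (nat \<times> nat \<Rightarrow> real) \<Rightarrow> nat \<times> nat \<Rightarrow> real" where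
  "slope l N v e = (\<integral>x. feat l N x e * LR l N x v \<partial>prior N) / Lik l N v"

lemma integrable_feat_LR:
  "w \<in> space (GE N) \<Longrightarrow> e \<in> upper_pairs N \<Longrightarrow> integrable (prior N) (\<lambda>x. feat l N x e * LR l N x w)"
  by (rule integrable_LR_times) (auto intro: feat_bound measurable_feat)

lemma LR_change:
  "LR l N x w = LR l N x v * exp (\<Sum>e\<in>upper_pairs N. feat l N x e * (w e - v e))"
  unfolding LR_def wick_def exp_add[symmetric] by (simp add: algebra_simps sum_subtractf)

text \<open>\<open>slope\<close> is the gradient of the logarithm of \<open>Lik\<close>, the
  posterior mean of the features. The tangent inequality is Jensen's: with \<open>m\<close> the
  posterior mean of the exponent \<open>h\<close>, one has
  \<open>exp h >= exp m * (1 + h - m)\<close>, and integration against the posterior removes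
  \<open>h - m\<close>.\<close>

lemma ln_Lik_tangent:
  assumes v: "v \<in> space (GE N)" and w: "w \<in> space (GE N)"
  shows "ln (Lik l N v) + (\<Sum>e\<in>upper_pairs N. slope l N v e * (w e - v e)) \<le> ln (Lik l N w)"
proof -
  define m where "m = (\<Sum>e\<in>upper_pairs N. slope l N v e * (w e - v e))"
  let ?h = "\<lambda>x. \<Sum>e\<in>upper_pairs N. feat l N x e * (w e - v e)"
  have Lv: "0 < Lik l N v" by (rule Lik_pos[OF v])
  have int_h: "integrable (prior N) (\<lambda>x. ?h x * LR l N x v)" and eq_h: "(\<integral>x. ?h x * LR l N x v \<partial>prior N) = Lik l N v * m"
  proof -
    have e: "?h x * LR l N x v = (\<Sum>e\<in>upper_pairs N. (w e - v e) * (feat l N x e * LR l N x v))" for x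
      unfolding sum_distrib_right by (simp add: mult_ac)
    show "integrable (prior N) (\<lambda>x. ?h x * LR l N x v)"
      unfolding e using integrable_feat_LR[OF v] by (intro Bochner_Integration.integrable_sum) auto
    have "(\<integral>x. ?h x * LR l N x v \<partial>prior N) = (\<Sum>e\<in>upper_pairs N. (w e - v e) * (\<integral>x. feat l N x e * LR l N x v \<partial>prior N))"
      unfolding e using integrable_feat_LR[OF v] by (subst Bochner_Integration.integral_sum) auto
    also have "\<dots> = Lik l N v * m"
      unfolding m_def slope_def sum_distrib_left using Lv by (intro sum.cong) auto
    finally show "(\<integral>x. ?h x * LR l N x v \<partial>prior N) = Lik l N v * m" .
  qed
  have "Lik l N v * exp m = (\<integral>x. exp m * (1 - m) * LR l N x v + exp m * (?h x * LR l N x v) \<partial>prior N)"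
  proof -
    have "(\<integral>x. c * LR l N x v + d * H x \<partial>prior N) = c * Lik l N v + d * (Lik l N v * m)"
      if "integrable (prior N) H" "(\<integral>x. H x \<partial>prior N) = Lik l N v * m" for c d and H :: "(nat \<Rightarrow> real) \<Rightarrow> real"
      using that integrable_LR[OF v] by (simp add: Lik_def)
    from this[OF int_h eq_h] show ?thesis by (simp only:) (simp add: algebra_simps)
  qed
  also have "\<dots> \<le> (\<integral>x. LR l N x w \<partial>prior N)"
  proof (rule integral_mono)
    show "integrable (prior N) (\<lambda>x. exp m * (1 - m) * LR l N x v + exp m * (?h x * LR l N x v))"
      using int_h integrable_LR[OF v] by auto
    show "integrable (prior N) (\<lambda>x. LR l N x w)" by (rule integrable_LR[OF w])
    fix x
    have "exp m * (1 + (?h x - m)) \<le> exp m * exp (?h x - m)" by (intro mult_left_mono) auto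
    then have "exp m * (1 + (?h x - m)) * LR l N x v \<le> exp (?h x) * LR l N x v"
      by (intro mult_right_mono) (auto simp: exp_add[symmetric])
    then show "exp m * (1 - m) * LR l N x v + exp m * (?h x * LR l N x v) \<le> LR l N x w"
      unfolding LR_change[of l N x w v] by (simp add: algebra_simps)
  qed
  finally have "ln (Lik l N v * exp m) \<le> ln (Lik l N w)"
    using Lv unfolding Lik_def[symmetric] by (subst ln_le_cancel_iff) (auto intro: Lik_pos w)
  then show ?thesis using Lv unfolding m_def[symmetric] by (simp add: ln_mult)
qed

text \<open>The squared length of a posterior mean is the two-replica average of the inner product
  \<open>corr\<close>, which is at most \<open>l N R^2 / 2\<close>. Multiplication by the square of
  \<open>Lik\<close> clears the denominators, and the large-overlap part is charged with
  \<open>N R^2 <= N B^4\<close>.\<close>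

lemma slope_square_le:
  assumes l: "0 < l" and N: "0 < N" and w [measurable]: "w \<in> space (GE N)"
  shows "ennreal ((Lik l N w)\<^sup>2 * (\<Sum>e\<in>upper_pairs N. (slope l N w e)\<^sup>2))
    \<le> ennreal (l / 2) * (Sm l N e w + ennreal (real N * B ^ 4) * ennreal (Lik l N w) * Bg l N e w)"
proof -
  interpret pr: prob_space "prior N" by (rule prob_space_prior)
  define f where "f e = (\<integral>y. feat l N y e * LR l N y w \<partial>prior N)" for e
  define g where "g x = (\<Sum>e\<in>upper_pairs N. feat l N x e * f e)" for x
  define h where "h x = (\<integral>y. (ov N x y)\<^sup>2 * LR l N y w \<partial>prior N)" for x
  have L: "0 < Lik l N w" by (rule Lik_pos[OF w])
  have ov2: "(ov N x y)\<^sup>2 \<le> B ^ 4" if "x \<in> cube N" "y \<in> cube N" for x y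
  proof -
    have "\<bar>ov N x y\<bar>\<^sup>2 \<le> (B\<^sup>2)\<^sup>2" using abs_ov_le[OF N that] by (intro power_mono) auto
    then show ?thesis by simp
  qed
  have h_int: "integrable (prior N) (\<lambda>y. (ov N x y)\<^sup>2 * LR l N y w)" if x: "x \<in> cube N" for x
  proof -
    have [measurable]: "x \<in> space (prior N)" using x by (auto simp: cube_def)
    show ?thesis by (rule integrable_LR_times[where C = "B ^ 4"]) (use ov2[OF x] w in auto)
  qed
  have h_meas [measurable]: "h \<in> borel_measurable (prior N)" unfolding h_def by measurable
  have h0: "0 \<le> h x" for x unfolding h_def by (intro integral_nonneg_AE) auto
  have hB: "h x \<le> B ^ 4 * Lik l N w" if x: "x \<in> cube N" for x
  proof -
    have "h x \<le> (\<integral>y. B ^ 4 * LR l N y w \<partial>prior N)"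
      unfolding h_def
    proof (rule integral_mono_AE[OF h_int[OF x]])
      show "integrable (prior N) (\<lambda>y. B ^ 4 * LR l N y w)" using integrable_LR[OF w] by auto
      show "AE y in prior N. (ov N x y)\<^sup>2 * LR l N y w \<le> B ^ 4 * LR l N y w"
        by (rule eventually_mono[OF AE_cube]) (intro mult_right_mono ov2 x LR_pos)
    qed
    then show ?thesis unfolding Lik_def by simp
  qed
  have hi: "integrable (prior N) (\<lambda>x. l * real N / 2 * h x * LR l N x w)"
  proof (rule integrable_LR_times[OF w])
    show "(\<lambda>x. l * real N / 2 * h x) \<in> borel_measurable (prior N)" by measurable
    show "\<bar>l * real N / 2 * h x\<bar> \<le> l * real N / 2 * (B ^ 4 * Lik l N w)" if "x \<in> cube N" for x
      using hB[OF that] h0[of x] l by (simp add: abs_mult mult_left_mono)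
  qed
  have gh: "g x \<le> l * real N / 2 * h x" if x: "x \<in> cube N" for x
  proof -
    have g_eq: "g x = (\<integral>y. corr l N x y * LR l N y w \<partial>prior N)" and g_int: "integrable (prior N) (\<lambda>y. corr l N x y * LR l N y w)"
    proof -
      have e: "corr l N x y * LR l N y w = (\<Sum>e\<in>upper_pairs N. feat l N x e * (feat l N y e * LR l N y w))" for y
        unfolding corr_def by (simp add: sum_distrib_right mult.assoc)
      show "integrable (prior N) (\<lambda>y. corr l N x y * LR l N y w)"
        unfolding e using integrable_feat_LR[OF w] by (intro Bochner_Integration.integrable_sum) auto
      show "g x = (\<integral>y. corr l N x y * LR l N y w \<partial>prior N)"
        unfolding e g_def f_def using integrable_feat_LR[OF w] by (subst Bochner_Integration.integral_sum) auto
    qed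
    have "g x \<le> (\<integral>y. l * real N / 2 * ((ov N x y)\<^sup>2 * LR l N y w) \<partial>prior N)"
      unfolding g_eq
    proof (rule integral_mono[OF g_int])
      show "integrable (prior N) (\<lambda>y. l * real N / 2 * ((ov N x y)\<^sup>2 * LR l N y w))" using h_int[OF x] by auto
      fix y
      have "corr l N x y * LR l N y w \<le> l * real N * (ov N x y)\<^sup>2 / 2 * LR l N y w"
        using corr_le[of l N x y] l N by (intro mult_right_mono) auto
      then show "corr l N x y * LR l N y w \<le> l * real N / 2 * ((ov N x y)\<^sup>2 * LR l N y w)" by (simp add: mult_ac)
    qed
    then show ?thesis unfolding h_def by simp
  qed
  have "(Lik l N w)\<^sup>2 * (\<Sum>e\<in>upper_pairs N. (slope l N w e)\<^sup>2) = (\<Sum>e\<in>upper_pairs N. f e * f e)"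
    unfolding sum_distrib_left slope_def f_def using L by (intro sum.cong) (auto simp: power_divide power2_eq_square)
  also have "\<dots> = (\<integral>x. g x * LR l N x w \<partial>prior N)"
  proof -
    have "g x * LR l N x w = (\<Sum>e\<in>upper_pairs N. f e * (feat l N x e * LR l N x w))" for x
      unfolding g_def sum_distrib_right by (simp add: mult_ac)
    then show ?thesis using integrable_feat_LR[OF w] by (simp add: Bochner_Integration.integral_sum f_def)
  qed
  also have "\<dots> \<le> (\<integral>x. l * real N / 2 * h x * LR l N x w \<partial>prior N)"
  proof (rule integral_mono_AE'[OF hi])
    show "AE x in prior N. g x * LR l N x w \<le> l * real N / 2 * h x * LR l N x w"
      by (rule eventually_mono[OF AE_cube]) (intro mult_right_mono gh LR_pos)
    show "AE x in prior N. 0 \<le> l * real N / 2 * h x * LR l N x w"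
      using l h0 by (intro AE_I2 mult_nonneg_nonneg LR_pos) auto
  qed
  finally have "ennreal ((Lik l N w)\<^sup>2 * (\<Sum>e\<in>upper_pairs N. (slope l N w e)\<^sup>2)) \<le> ennreal (\<integral>x. l * real N / 2 * h x * LR l N x w \<partial>prior N)"
    by (rule ennreal_leI)
  also have "\<dots> = (\<integral>\<^sup>+x. ennreal (l * real N / 2 * h x * LR l N x w) \<partial>prior N)"
    using hi l h0 by (intro nn_integral_eq_integral[symmetric]) auto
  also have "\<dots> = (\<integral>\<^sup>+x. ennreal (l / 2) * (\<integral>\<^sup>+y. ennreal (real N * (ov N x y)\<^sup>2) * (ennreal (LR l N x w) * ennreal (LR l N y w)) \<partial>prior N) \<partial>prior N)"
  proof (rule nn_integral_cong_AE, rule eventually_mono[OF AE_cube])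
    fix x assume x: "x \<in> cube N"
    then have [measurable]: "x \<in> space (prior N)" by (auto simp: cube_def)
    have "(\<integral>\<^sup>+y. ennreal (real N * (ov N x y)\<^sup>2) * (ennreal (LR l N x w) * ennreal (LR l N y w)) \<partial>prior N)
      = (\<integral>\<^sup>+y. ennreal (real N * LR l N x w) * ennreal ((ov N x y)\<^sup>2 * LR l N y w) \<partial>prior N)"
      by (intro nn_integral_cong) (simp add: ennreal_mult mult_ac)
    also have "\<dots> = ennreal (real N * LR l N x w) * (\<integral>\<^sup>+y. ennreal ((ov N x y)\<^sup>2 * LR l N y w) \<partial>prior N)"
      by (rule nn_integral_cmult) measurable
    also have "(\<integral>\<^sup>+y. ennreal ((ov N x y)\<^sup>2 * LR l N y w) \<partial>prior N) = ennreal (h x)"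
      unfolding h_def by (rule nn_integral_eq_integral[OF h_int[OF x]]) auto
    finally have "ennreal (l / 2) * (\<integral>\<^sup>+y. ennreal (real N * (ov N x y)\<^sup>2) * (ennreal (LR l N x w) * ennreal (LR l N y w)) \<partial>prior N)
      = ennreal (l / 2 * (real N * LR l N x w * h x))"
      using l h0[of x] by (simp only: ennreal_mult[symmetric] LR_pos mult_nonneg_nonneg of_nat_0_le_iff divide_nonneg_pos less_imp_le zero_less_numeral)
    then show "ennreal (l * real N / 2 * h x * LR l N x w) = ennreal (l / 2) * (\<integral>\<^sup>+y. ennreal (real N * (ov N x y)\<^sup>2) * (ennreal (LR l N x w) * ennreal (LR l N y w)) \<partial>prior N)"
      by (simp add: mult_ac)
  qed
  also have "\<dots> = ennreal (l / 2) * (\<integral>\<^sup>+x. (\<integral>\<^sup>+y. ennreal (real N * (ov N x y)\<^sup>2) * (ennreal (LR l N x w) * ennreal (LR l N y w)) \<partial>prior N) \<partial>prior N)"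
    by (rule nn_integral_cmult) measurable
  also have "\<dots> \<le> ennreal (l / 2) * (Sm l N e w + ennreal (real N * B ^ 4) * ennreal (Lik l N w) * Bg l N e w)"
    by (intro mult_left_mono iterated_split_le w) (auto intro!: mult_left_mono ov2)
  finally show ?thesis .
qed

end

section \<open>Contiguity\<close>

context bounded_prior
begin

text \<open>Division of \<open>L^2 <= Sm + L * Bg\<close> by \<open>L >= K\<close>. Large values of
  \<open>L\<close> are thus paid for by \<open>Sm / K\<close>, whose mean is small for large
  \<open>K\<close>, and by \<open>Bg\<close>.\<close>

lemma Lik_le_Sm_Bg:
  assumes w: "w \<in> space (GE N)" and K: "0 < K" "K \<le> Lik l N w"
  shows "ennreal (Lik l N w) \<le> ennreal (1 / K) * Sm l N e w + Bg l N e w"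
proof -
  let ?L = "Lik l N w"
  have L: "0 < ?L" using K by simp
  have inv: "ennreal (1 / ?L) * (ennreal ?L * X) = X" for X
  proof -
    have "ennreal (1 / ?L) * ennreal ?L = 1" using L by (simp add: ennreal_mult[symmetric])
    then show ?thesis by (simp add: mult.assoc[symmetric])
  qed
  have "ennreal ?L = ennreal (1 / ?L) * ennreal (?L * ?L)"
    using L by (simp add: ennreal_mult[symmetric])
  also have "\<dots> \<le> ennreal (1 / ?L) * (Sm l N e w + ennreal ?L * Bg l N e w)"
    by (intro mult_left_mono Lik_square_le w) simp
  also have "\<dots> = ennreal (1 / ?L) * Sm l N e w + Bg l N e w"
    unfolding distrib_left inv ..
  also have "\<dots> \<le> ennreal (1 / K) * Sm l N e w + Bg l N e w"
    using K by (intro add_mono mult_right_mono ennreal_leI frac_le) auto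
  finally show ?thesis .
qed

text \<open>Brings both overlap estimates to the same \<open>e\<close>: the small-overlap estimate
  dictates it, and the large-overlap one is available for every positive value. \<open>E\<close>
  beats every linear factor, which later pays for the crude bound on \<open>N R^2\<close>.\<close>

lemma overlap_integrals:
  assumes l: "0 < l" "l < l'" and psi: "\<And>r. 0 \<le> r \<Longrightarrow> psi P r \<le> r\<^sup>2 / (4 * l')"
  obtains e C :: real and N0 :: nat and E :: "nat \<Rightarrow> real" where "0 < N0" "0 \<le> C" "\<And>N. 0 \<le> E N"
    "\<And>N. N0 \<le> N \<Longrightarrow> (\<integral>\<^sup>+w. Sm l N e w \<partial>GE N) \<le> ennreal C"
    "\<And>N. N0 \<le> N \<Longrightarrow> (\<integral>\<^sup>+w. Bg l N e w \<partial>GE N) \<le> ennreal (E N)"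
    "\<And>k. (\<lambda>N. (1 + k * real N) * E N) \<longlonglongrightarrow> 0"
proof -
  have "l' \<le> 1" by (rule threshold_le_one[of l']) (use l psi in auto)
  then have l1: "l < 1" using l by simp
  obtain e C :: real and N0 :: nat where e: "0 < e" and C: "0 \<le> C" and N0: "0 < N0"
    and small: "\<And>N. N0 \<le> N \<Longrightarrow> (\<integral>\<^sup>+x. (\<integral>\<^sup>+y. ennreal (indicator {y. \<bar>ov N x y\<bar> \<le> e} y * (1 + real N * (ov N x y)\<^sup>2) * exp (corr l N x y)) \<partial>prior N) \<partial>prior N) \<le> ennreal C"
    by (rule small_overlap[OF l(1) l1]) (rule that)
  obtain C2 c :: real where c: "0 < c" and C2: "0 \<le> C2"
    and big: "\<And>N. 0 < N \<Longrightarrow> (\<integral>\<^sup>+y. (\<integral>\<^sup>+w. ennreal (LR l N y w) * ennreal (Zbad l N e y w / Lik l N w) \<partial>GE N) \<partial>prior N) \<le> ennreal (C2 * exp (- (c * real N)))"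
    by (rule large_overlap[OF l psi e]) (assumption, rule that)
  show ?thesis
  proof (rule that[of N0 C "\<lambda>N. C2 * exp (- (c * real N))" e])
    show "(\<integral>\<^sup>+w. Sm l N e w \<partial>GE N) \<le> ennreal C" if "N0 \<le> N" for N
      unfolding nn_integral_Sm by (rule small[OF that])
    show "(\<integral>\<^sup>+w. Bg l N e w \<partial>GE N) \<le> ennreal (C2 * exp (- (c * real N)))" if "N0 \<le> N" for N
      unfolding nn_integral_Bg by (rule big) (use that N0 in simp)
    show "(\<lambda>N. (1 + k * real N) * (C2 * exp (- (c * real N)))) \<longlonglongrightarrow> 0" for k
    proof -
      have "((\<lambda>x::real. (1 + k * x) * (C2 * exp (- (c * x)))) \<longlongrightarrow> 0) at_top"
        using c by real_asymp
      then show ?thesis by (rule filterlim_compose) (rule filterlim_real_sequentially)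
    qed
  qed (use N0 C C2 in auto)
qed

text \<open>Tightness of \<open>L\<close> under the spiked law, written with the density under the
  unspiked one. The choice of \<open>K\<close> makes the small-overlap part at most
  \<open>d / 2\<close>, large \<open>N\<close> does the same for the other part.\<close>

lemma Lik_upper_tight:
  assumes l: "0 < l" "l < l'" and psi: "\<And>r. 0 \<le> r \<Longrightarrow> psi P r \<le> r\<^sup>2 / (4 * l')" and d: "0 < d"
  obtains K :: real and N0 :: nat where "0 < K"
    "\<And>N. N0 \<le> N \<Longrightarrow> (\<integral>\<^sup>+w. ennreal (Lik l N w) * indicator {w. K < Lik l N w} w \<partial>GE N) \<le> ennreal d"
proof -
  obtain e C :: real and N0 :: nat and E :: "nat \<Rightarrow> real" where N0: "0 < N0" and C: "0 \<le> C" and E: "\<And>N. 0 \<le> E N"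
    and Sm: "\<And>N. N0 \<le> N \<Longrightarrow> (\<integral>\<^sup>+w. Sm l N e w \<partial>GE N) \<le> ennreal C"
    and Bg: "\<And>N. N0 \<le> N \<Longrightarrow> (\<integral>\<^sup>+w. Bg l N e w \<partial>GE N) \<le> ennreal (E N)"
    and lim: "\<And>k. (\<lambda>N. (1 + k * real N) * E N) \<longlonglongrightarrow> 0"
    by (rule overlap_integrals[OF l psi]) (assumption, rule that)
  define K where "K = 2 * (C + 1) / d"
  have K: "0 < K" unfolding K_def using C d by simp
  have "\<forall>\<^sub>F N in sequentially. (1 + 0 * real N) * E N < d / 2"
    by (rule order_tendstoD(2)[OF lim]) (use d in simp)
  then obtain N1 where N1: "\<And>N. N1 \<le> N \<Longrightarrow> E N < d / 2" unfolding eventually_sequentially by auto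
  show ?thesis
  proof (rule that[OF K, of "max N0 N1"])
    fix N assume N: "max N0 N1 \<le> N"
    have "(\<integral>\<^sup>+w. ennreal (Lik l N w) * indicator {w. K < Lik l N w} w \<partial>GE N)
      \<le> (\<integral>\<^sup>+w. ennreal (1 / K) * Sm l N e w + Bg l N e w \<partial>GE N)"
    proof (rule nn_integral_mono)
      fix w assume w: "w \<in> space (GE N)"
      show "ennreal (Lik l N w) * indicator {w. K < Lik l N w} w \<le> ennreal (1 / K) * Sm l N e w + Bg l N e w"
        using Lik_le_Sm_Bg[OF w K, of l e] by (auto simp: indicator_def)
    qed
    also have "\<dots> = ennreal (1 / K) * (\<integral>\<^sup>+w. Sm l N e w \<partial>GE N) + (\<integral>\<^sup>+w. Bg l N e w \<partial>GE N)"
      by (simp add: nn_integral_add nn_integral_cmult)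
    also have "\<dots> \<le> ennreal (1 / K) * ennreal C + ennreal (E N)"
      using N by (intro add_mono mult_left_mono Sm Bg) auto
    also have "\<dots> = ennreal (1 / K * C + E N)"
      using K C E by (simp add: ennreal_mult[symmetric])
    also have "\<dots> \<le> ennreal d"
    proof (rule ennreal_leI)
      have "1 / K * C \<le> d / 2"
        unfolding K_def using C d by (simp add: field_simps)
      then show "1 / K * C + E N \<le> d" using N1[of N] N by linarith
    qed
    finally show "(\<integral>\<^sup>+w. ennreal (Lik l N w) * indicator {w. K < Lik l N w} w \<partial>GE N) \<le> ennreal d" .
  qed
qed

text \<open>\<open>L\<close> has mean one, and little of this mass can sit where
  \<open>L < 1 / 4\<close>, where \<open>L\<close> exceeds \<open>K\<close>, or where
  \<open>Sm\<close> or \<open>N * Bg\<close> is large. So at least \<open>1 / 2\<close> remains on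
  the good set, and as \<open>L <= K\<close> there, that set has unspiked probability at least
  \<open>1 / (2 K)\<close>.\<close>

lemma good_set:
  assumes l: "0 < l" "l < l'" and psi: "\<And>r. 0 \<le> r \<Longrightarrow> psi P r \<le> r\<^sup>2 / (4 * l')"
  obtains p K :: real and N0 :: nat and A :: "nat \<Rightarrow> (nat \<times> nat \<Rightarrow> real) set" where "0 < p" "0 < K"
    "\<And>N. A N \<in> sets (GE N)" "\<And>N. N0 \<le> N \<Longrightarrow> p \<le> measure (GE N) (A N)"
    "\<And>N v. v \<in> A N \<Longrightarrow> 1 / 4 \<le> Lik l N v"
    "\<And>N v. N0 \<le> N \<Longrightarrow> v \<in> A N \<Longrightarrow> (\<Sum>i\<in>upper_pairs N. (slope l N v i)\<^sup>2) \<le> K\<^sup>2"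
proof -
  obtain e C :: real and N0 :: nat and E :: "nat \<Rightarrow> real" where N0: "0 < N0" and C: "0 \<le> C" and E: "\<And>N. 0 \<le> E N"
    and Sm: "\<And>N. N0 \<le> N \<Longrightarrow> (\<integral>\<^sup>+w. Sm l N e w \<partial>GE N) \<le> ennreal C"
    and Bg: "\<And>N. N0 \<le> N \<Longrightarrow> (\<integral>\<^sup>+w. Bg l N e w \<partial>GE N) \<le> ennreal (E N)"
    and lim: "\<And>k. (\<lambda>N. (1 + k * real N) * E N) \<longlonglongrightarrow> 0"
    by (rule overlap_integrals[OF l psi]) (assumption, rule that)
  \<comment> \<open>Makes both \<open>C / K\<close> and \<open>C K / K1\<close> at most
    \<open>1 / 16\<close>; with the loss \<open>1 / 4\<close> from small \<open>L\<close> and the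
    last error \<open>1 / 16\<close>, the total loss stays below \<open>1 / 2\<close>.\<close>
  define K where "K = 16 * (C + 1)"
  define K1 where "K1 = K * K"
  have K: "1 \<le> K" unfolding K_def using C by auto
  then have K: "1 \<le> K" "0 < K1" unfolding K1_def by auto
  have "\<forall>\<^sub>F N in sequentially. (1 + K * real N) * E N < 1 / 16"
    by (rule order_tendstoD(2)[OF lim]) simp
  then obtain N1 where N1: "\<And>N. N1 \<le> N \<Longrightarrow> (1 + K * real N) * E N < 1 / 16" unfolding eventually_sequentially by auto
  \<comment> \<open>The condition on \<open>Bg\<close> carries the factor \<open>N\<close> because
    large overlaps enter the slope bound with \<open>N R^2\<close>, which is of order
    \<open>N\<close> there.\<close>
  define A where "A N = {w \<in> space (GE N). 1 / 4 \<le> Lik l N w \<and> Lik l N w \<le> K \<and> Sm l N e w \<le> ennreal K1 \<and> ennreal (real N) * Bg l N e w \<le> 1}" for N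
  have A_sets: "A N \<in> sets (GE N)" for N unfolding A_def by measurable
  \<comment> \<open>\<open>L >= 1 / 4\<close> turns the bound with prefactor \<open>l / 2\<close> on
    \<open>L^2\<close> times the squared slope into one with prefactor
    \<open>16 * l / 2 = 8 l\<close>.\<close>
  define S where "S = 8 * l * (K1 + B ^ 4 * K)"
  have S: "0 < S" unfolding S_def using l K by (intro mult_pos_pos add_pos_nonneg) auto
  show ?thesis
  proof (rule that[of "1 / (2 * K)" "sqrt S" A "max N0 N1"])
    show "A N \<in> sets (GE N)" for N by (rule A_sets)
    show "1 / 4 \<le> Lik l N v" if "v \<in> A N" for N v using that unfolding A_def by simp
    show "1 / (2 * K) \<le> measure (GE N) (A N)" if N: "max N0 N1 \<le> N" for N
    proof -
      interpret G: prob_space "GE N" by (rule prob_space_Gauss)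
      note [measurable] = A_sets[of N]
      \<comment> \<open>Markov's inequality in pointwise form: outside \<open>A N\<close>, whichever
        constraint fails yields a bound on \<open>L\<close>, and all bounds are added up so that a
        single integration suffices.\<close>
      have pt: "ennreal (Lik l N w) \<le> (ennreal K * indicator (A N) w + ennreal (1 / 4)) + (ennreal (1 / K + K / K1) * Sm l N e w + ennreal (1 + K * real N) * Bg l N e w)"
        (is "_ \<le> ?X + (?Y1 + ?Y2)") if w: "w \<in> space (GE N)" for w
      proof -
        have Kn: "ennreal (1 / K + K / K1) = ennreal (1 / K) + ennreal (K / K1)" using K by simp
        have Kb: "ennreal (1 + K * real N) = 1 + ennreal K * ennreal (real N)" using K by (simp add: ennreal_mult)
        consider "w \<in> A N" | "Lik l N w < 1 / 4" | "K \<le> Lik l N w" | "Lik l N w \<le> K" "ennreal K1 < Sm l N e w"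
          | "Lik l N w \<le> K" "1 < ennreal (real N) * Bg l N e w"
          using w unfolding A_def by fastforce
        then show ?thesis
        proof cases
          case 1
          then have "ennreal (Lik l N w) \<le> ennreal K * indicator (A N) w" by (auto simp: A_def intro!: ennreal_leI)
          also have "\<dots> \<le> ?X + (?Y1 + ?Y2)" by (simp add: add.assoc)
          finally show ?thesis .
        next
          case 2
          then have "ennreal (Lik l N w) \<le> ennreal (1 / 4)" by (intro ennreal_leI) simp
          also have "\<dots> \<le> ?X + (?Y1 + ?Y2)" by (simp add: add.assoc add_increasing)
          finally show ?thesis .
        next
          case 3
          have "ennreal (Lik l N w) \<le> ennreal (1 / K) * Sm l N e w + Bg l N e w"
            by (rule Lik_le_Sm_Bg[OF w]) (use K 3 in auto)
          also have "\<dots> \<le> ?Y1 + ?Y2"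
            unfolding Kn Kb distrib_right by (intro add_mono) (auto simp: add_increasing2)
          also have "\<dots> \<le> ?X + (?Y1 + ?Y2)" by (simp add: add_increasing)
          finally show ?thesis .
        next
          case 4
          have "ennreal (Lik l N w) \<le> ennreal K" using 4 by (intro ennreal_leI)
          also have "\<dots> = ennreal (K / K1) * ennreal K1" using K by (simp add: ennreal_mult[symmetric])
          also have "\<dots> \<le> ennreal (K / K1) * Sm l N e w" using 4 by (intro mult_left_mono) auto
          also have "\<dots> \<le> ?Y1" unfolding Kn distrib_right by (simp add: add_increasing)
          also have "\<dots> \<le> ?X + (?Y1 + ?Y2)" by (simp add: add_increasing add_increasing2)
          finally show ?thesis .
        next
          case 5
          have "ennreal (Lik l N w) \<le> ennreal K * 1" using 5 by (simp add: ennreal_leI)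
          also have "\<dots> \<le> ennreal K * (ennreal (real N) * Bg l N e w)" using 5 by (intro mult_left_mono) auto
          also have "\<dots> \<le> ?Y2" unfolding Kb distrib_right by (simp add: add_increasing mult.assoc)
          also have "\<dots> \<le> ?X + (?Y1 + ?Y2)" by (simp add: add_increasing)
          finally show ?thesis .
        qed
      qed
      have "1 = (\<integral>\<^sup>+w. ennreal (Lik l N w) \<partial>GE N)" by (simp add: nn_integral_Lik)
      also have "\<dots> \<le> (\<integral>\<^sup>+w. (ennreal K * indicator (A N) w + ennreal (1 / 4)) + (ennreal (1 / K + K / K1) * Sm l N e w + ennreal (1 + K * real N) * Bg l N e w) \<partial>GE N)"
        by (rule nn_integral_mono) (rule pt)
      also have "\<dots> = (ennreal K * emeasure (GE N) (A N) + ennreal (1 / 4)) + (ennreal (1 / K + K / K1) * (\<integral>\<^sup>+w. Sm l N e w \<partial>GE N) + ennreal (1 + K * real N) * (\<integral>\<^sup>+w. Bg l N e w \<partial>GE N))"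
        by (simp add: nn_integral_add nn_integral_cmult G.emeasure_space_1 del: ennreal_plus)
      also have "\<dots> \<le> (ennreal K * ennreal (measure (GE N) (A N)) + ennreal (1 / 4)) + (ennreal (1 / K + K / K1) * ennreal C + ennreal (1 + K * real N) * ennreal (E N))"
        using N by (intro add_mono mult_left_mono order_refl Sm Bg) (auto simp: G.emeasure_eq_measure)
      also have "\<dots> = ennreal ((K * measure (GE N) (A N) + 1 / 4) + ((1 / K + K / K1) * C + (1 + K * real N) * E N))"
      proof -
        have join: "(ennreal a1 * ennreal b1 + ennreal c1) + (ennreal a2 * ennreal b2 + ennreal a3 * ennreal b3) = ennreal ((a1 * b1 + c1) + (a2 * b2 + a3 * b3))"
          if "0 \<le> a1" "0 \<le> b1" "0 \<le> c1" "0 \<le> a2" "0 \<le> b2" "0 \<le> a3" "0 \<le> b3" for a1 b1 c1 a2 b2 a3 b3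
          using that by (simp add: ennreal_mult)
        show ?thesis by (rule join) (use K C E in auto)
      qed
      finally have "1 \<le> (K * measure (GE N) (A N) + 1 / 4) + ((1 / K + K / K1) * C + (1 + K * real N) * E N)"
        by (subst (asm) ennreal_1[symmetric], subst (asm) ennreal_le_iff) (use K C E in \<open>auto intro!: add_nonneg_nonneg mult_nonneg_nonneg\<close>)
      moreover have "(1 / K + K / K1) * C \<le> 1 / 8"
      proof -
        have KC: "1 / K * C \<le> 1 / 16" unfolding K_def using C by (simp add: field_simps)
        moreover have "K / K1 * C \<le> 1 / 16" using KC K unfolding K1_def by simp
        ultimately show ?thesis unfolding distrib_right by linarith
      qed
      moreover have "(1 + K * real N) * E N \<le> 1 / 16" using N1[of N] N by simp
      ultimately have "1 / 2 \<le> K * measure (GE N) (A N)" by linarith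
      then show ?thesis using K by (simp add: field_simps)
    qed
    show "(\<Sum>i\<in>upper_pairs N. (slope l N v i)\<^sup>2) \<le> (sqrt S)\<^sup>2" if N: "max N0 N1 \<le> N" and v: "v \<in> A N" for N v
    proof -
      define T where "T = (\<Sum>i\<in>upper_pairs N. (slope l N v i)\<^sup>2)"
      have T: "0 \<le> T" unfolding T_def by (intro sum_nonneg) auto
      have vs: "v \<in> space (GE N)" and L: "1 / 4 \<le> Lik l N v" "Lik l N v \<le> K" and SmB: "Sm l N e v \<le> ennreal K1" and BgB: "ennreal (real N) * Bg l N e v \<le> 1"
        using v unfolding A_def by auto
      have "ennreal ((Lik l N v)\<^sup>2 * T) \<le> ennreal (l / 2) * (Sm l N e v + ennreal (real N * B ^ 4) * ennreal (Lik l N v) * Bg l N e v)"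
        unfolding T_def by (rule slope_square_le) (use l N N0 vs in auto)
      also have "ennreal (real N * B ^ 4) * ennreal (Lik l N v) * Bg l N e v = ennreal (B ^ 4) * ennreal (Lik l N v) * (ennreal (real N) * Bg l N e v)"
        using B1 by (simp add: ennreal_mult mult_ac)
      also have "ennreal (l / 2) * (Sm l N e v + ennreal (B ^ 4) * ennreal (Lik l N v) * (ennreal (real N) * Bg l N e v))
         \<le> ennreal (l / 2) * (ennreal K1 + ennreal (B ^ 4) * ennreal K * 1)"
        by (intro mult_left_mono add_mono mult_mono SmB BgB ennreal_leI L order_refl) auto
      also have "\<dots> = ennreal (l / 2 * (K1 + B ^ 4 * K))"
      proof -
        have "ennreal a * (ennreal b + ennreal c * ennreal d * 1) = ennreal (a * (b + c * d))"
          if "0 \<le> a" "0 \<le> b" "0 \<le> c" "0 \<le> d" for a b c d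
          using that by (simp add: ennreal_mult)
        then show ?thesis using l K B1 by simp
      qed
      finally have "(Lik l N v)\<^sup>2 * T \<le> l / 2 * (K1 + B ^ 4 * K)"
        using l K B1 by (subst (asm) ennreal_le_iff) auto
      moreover have "(1 / 4)\<^sup>2 * T \<le> (Lik l N v)\<^sup>2 * T" using L T by (intro mult_right_mono power_mono) auto
      ultimately have "T \<le> S" unfolding S_def by (simp add: power_divide field_simps)
      then show ?thesis unfolding T_def using S by simp
    qed
  qed (use K S in auto)
qed

text \<open>On the good set \<open>ln L\<close> is at least \<open>- ln 4\<close> and its tangent
  planes have slope at most \<open>K\<close>, as the Gaussian lower tail estimate requires. The drop
  \<open>m\<close> solves \<open>128 K^2 / (p m^2) = d\<close>.\<close>

lemma Lik_lower_tight:
  assumes l: "0 < l" "l < l'" and psi: "\<And>r. 0 \<le> r \<Longrightarrow> psi P r \<le> r\<^sup>2 / (4 * l')" and d: "0 < d"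
  obtains h :: real and N0 :: nat where "0 < h"
    "\<And>N. N0 \<le> N \<Longrightarrow> measure (GE N) {w \<in> space (GE N). Lik l N w \<le> h} \<le> d"
proof -
  obtain p K :: real and N0 :: nat and A :: "nat \<Rightarrow> (nat \<times> nat \<Rightarrow> real) set" where p: "0 < p" and K: "0 < K"
    and A: "\<And>N. A N \<in> sets (GE N)" "\<And>N. N0 \<le> N \<Longrightarrow> p \<le> measure (GE N) (A N)"
    and L: "\<And>N v. v \<in> A N \<Longrightarrow> 1 / 4 \<le> Lik l N v"
    and sl: "\<And>N v. N0 \<le> N \<Longrightarrow> v \<in> A N \<Longrightarrow> (\<Sum>i\<in>upper_pairs N. (slope l N v i)\<^sup>2) \<le> K\<^sup>2"
    by (rule good_set[OF l psi]) (assumption, rule that)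
  define m where "m = sqrt (128 * K\<^sup>2 / (p * d))"
  have m: "0 < m" "m\<^sup>2 = 128 * K\<^sup>2 / (p * d)" unfolding m_def using p K d by auto
  show ?thesis
  proof (rule that[of "exp (- ln 4 - 1 - m)" N0])
    fix N assume N: "N0 \<le> N"
    have "measure (GE N) {w \<in> space (GE N). ln (Lik l N w) \<le> - ln 4 - 1 - m} * p * m\<^sup>2 \<le> 128 * K\<^sup>2"
    proof (rule gauss_lower_tail[OF finite_upper_pairs A(1)])
      show "- ln 4 + (\<Sum>i\<in>upper_pairs N. slope l N v i * (w i - v i)) \<le> ln (Lik l N w)"
        if v: "v \<in> A N" and w: "w \<in> space (GE N)" for v w
      proof -
        have "ln (1 / 4) \<le> ln (Lik l N v)" using L[OF v] by (subst ln_le_cancel_iff) auto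
        then have "- ln 4 \<le> ln (Lik l N v)" by (simp add: ln_div)
        moreover have "v \<in> space (GE N)" using v sets.sets_into_space[OF A(1)] by auto
        ultimately show ?thesis using ln_Lik_tangent[of v N w l] w by simp
      qed
    qed (use N A sl p K m in auto)
    then have "measure (GE N) {w \<in> space (GE N). ln (Lik l N w) \<le> - ln 4 - 1 - m} \<le> d"
      unfolding m(2) using p d K by (simp add: field_simps)
    moreover have "{w \<in> space (GE N). ln (Lik l N w) \<le> - ln 4 - 1 - m} = {w \<in> space (GE N). Lik l N w \<le> exp (- ln 4 - 1 - m)}"
    proof (rule Collect_cong, rule conj_cong[OF refl])
      fix w assume w: "w \<in> space (GE N)"
      have "Lik l N w \<le> exp t \<longleftrightarrow> ln (Lik l N w) \<le> t" for t
        using exp_le_cancel_iff[of "ln (Lik l N w)" t] Lik_pos[OF w] by simp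
      then show "ln (Lik l N w) \<le> - ln 4 - 1 - m \<longleftrightarrow> Lik l N w \<le> exp (- ln 4 - 1 - m)" by simp
    qed
    ultimately show "measure (GE N) {w \<in> space (GE N). Lik l N w \<le> exp (- ln 4 - 1 - m)} \<le> d" by simp
  qed simp
qed

section \<open>The spiked law and its density\<close>

lemma sets_spiked_wigner_law [simp]: "sets (spiked_wigner_law P l N) = sets (GE N)"
  unfolding spiked_wigner_law_def by (simp add: sets_Gauss)

lemma spiked_map_measurable:
  "(\<lambda>(x, w). \<lambda>(i, j)\<in>upper_pairs N. sqrt (l / real N) * x i * x j + w (i, j))
    \<in> measurable (prior N \<Otimes>\<^sub>M GE N) (\<Pi>\<^sub>M e\<in>upper_pairs N. (borel :: real measure))"
proof -
  have "(\<lambda>p. \<lambda>e\<in>upper_pairs N. feat l N (fst p) e + snd p e) \<in> measurable (prior N \<Otimes>\<^sub>M GE N) (\<Pi>\<^sub>M e\<in>upper_pairs N. (borel :: real measure))"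
  proof (rule measurable_restrict)
    fix e assume e: "e \<in> upper_pairs N"
    have "(\<lambda>p. feat l N (fst p) e) \<in> borel_measurable (prior N \<Otimes>\<^sub>M GE N)"
      by (rule measurable_compose[OF measurable_fst measurable_feat[OF e]])
    moreover have "(\<lambda>p. snd p e) \<in> borel_measurable (prior N \<Otimes>\<^sub>M GE N)"
      by (rule measurable_Gauss_component[OF measurable_snd e])
    ultimately show "(\<lambda>p. feat l N (fst p) e + snd p e) \<in> borel_measurable (prior N \<Otimes>\<^sub>M GE N)" by measurable
  qed
  moreover have "(\<lambda>(x, w). \<lambda>(i, j)\<in>upper_pairs N. sqrt (l / real N) * x i * x j + w (i, j)) = (\<lambda>p. \<lambda>e\<in>upper_pairs N. feat l N (fst p) e + snd p e)"
    by (auto simp: fun_eq_iff feat_def restrict_def)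
  ultimately show ?thesis by simp
qed

lemma prob_space_spiked_wigner_law: "prob_space (spiked_wigner_law P l N)"
proof -
  interpret pr: prob_space "prior N" by (rule prob_space_prior)
  interpret G: prob_space "GE N" by (rule prob_space_Gauss)
  interpret pG: pair_prob_space "prior N" "GE N" ..
  show ?thesis
    using pG.prob_space_distr[OF spiked_map_measurable]
    unfolding spiked_wigner_law_def prior_def Gauss_def .
qed

text \<open>For a fixed spike the observation is a translated Gaussian vector with density
  \<open>LR\<close>; averaging over the prior gives \<open>Lik\<close>.\<close>

lemma emeasure_spiked_wigner_law:
  assumes A: "A \<in> sets (GE N)"
  shows "emeasure (spiked_wigner_law P l N) A = (\<integral>\<^sup>+w. ennreal (Lik l N w) * indicator A w \<partial>GE N)"
proof -
  interpret pr: prob_space "prior N" by (rule prob_space_prior)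
  interpret G: prob_space "GE N" by (rule prob_space_Gauss)
  let ?T = "\<lambda>(x, w). \<lambda>(i, j)\<in>upper_pairs N. sqrt (l / real N) * x i * x j + w (i, j :: nat)"
  have A' [measurable]: "A \<in> sets (\<Pi>\<^sub>M e\<in>upper_pairs N. (borel :: real measure))" using A by (simp add: sets_Gauss)
  have T: "?T p = (\<lambda>e\<in>upper_pairs N. feat l N (fst p) e + snd p e)" for p
    by (cases p) (auto simp: fun_eq_iff feat_def restrict_def)
  note [measurable] = spiked_map_measurable[where N = N and l = l]
  have "emeasure (spiked_wigner_law P l N) A = (\<integral>\<^sup>+y. indicator A y \<partial>distr (prior N \<Otimes>\<^sub>M GE N) (\<Pi>\<^sub>M e\<in>upper_pairs N. (borel :: real measure)) ?T)"
    unfolding spiked_wigner_law_def prior_def[symmetric] Gauss_def[symmetric] by (simp add: A')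
  also have "\<dots> = (\<integral>\<^sup>+p. indicator A (?T p) \<partial>(prior N \<Otimes>\<^sub>M GE N))"
    by (rule nn_integral_distr) measurable
  also have "\<dots> = (\<integral>\<^sup>+x. (\<integral>\<^sup>+w. indicator A (?T (x, w)) \<partial>GE N) \<partial>prior N)"
    by (rule G.nn_integral_fst[symmetric]) measurable
  also have "\<dots> = (\<integral>\<^sup>+x. (\<integral>\<^sup>+w. ennreal (LR l N x w) * indicator A w \<partial>GE N) \<partial>prior N)"
    unfolding T fst_conv snd_conv using A by (intro nn_integral_cong nn_integral_LR_shift[symmetric]) auto
  also have "\<dots> = (\<integral>\<^sup>+w. ennreal (Lik l N w) * indicator A w \<partial>GE N)"
    by (rule nn_integral_LR_prior) (use A in auto)
  finally show ?thesis .
qed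

lemma measure_spiked_wigner_law_0:
  assumes A: "A \<in> sets (GE N)"
  shows "measure (spiked_wigner_law P 0 N) A = measure (GE N) A"
proof -
  interpret pr: prob_space "prior N" by (rule prob_space_prior)
  have "Lik 0 N w = 1" for w
    unfolding Lik_def LR_def wick_def feat_def by (simp add: pr.prob_space)
  then have "emeasure (spiked_wigner_law P 0 N) A = emeasure (GE N) A"
    unfolding emeasure_spiked_wigner_law[OF A] using A by simp
  then show ?thesis by (simp add: measure_def)
qed

text \<open>With \<open>Q\<close> spiked and \<open>R\<close> unspiked, both directions split off
  exceptional values of the density: \<open>Q(A) <= K R(A) + E[L; L > K]\<close> and
  \<open>R(A) <= Q(A) / h + R(L <= h)\<close>. The last terms are small uniformly over large
  \<open>N\<close>.\<close>

theorem mutually_contiguous_spiked_wigner: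
  assumes l: "0 < l" "l < l'" and psi: "\<And>r. 0 \<le> r \<Longrightarrow> psi P r \<le> r\<^sup>2 / (4 * l')"
  shows "mutually_contiguous (spiked_wigner_law P l) (spiked_wigner_law P 0)"
  unfolding mutually_contiguous_def
proof (intro allI impI)
  fix A assume "\<forall>N. A N \<in> sets (spiked_wigner_law P l N)"
  then have A: "A N \<in> sets (GE N)" for N by simp
  let ?Q = "\<lambda>N. measure (spiked_wigner_law P l N) (A N)" and ?R = "\<lambda>N. measure (GE N) (A N)"
  have Q: "ennreal (?Q N) = (\<integral>\<^sup>+w. ennreal (Lik l N w) * indicator (A N) w \<partial>GE N)" for N
  proof -
    interpret L: prob_space "spiked_wigner_law P l N" by (rule prob_space_spiked_wigner_law)
    show ?thesis by (simp only: L.emeasure_eq_measure[symmetric] emeasure_spiked_wigner_law[OF A])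
  qed
  have up: "?Q \<longlonglongrightarrow> 0" if R: "?R \<longlonglongrightarrow> 0"
  proof (rule LIMSEQ_I)
    fix r :: real assume r: "0 < r"
    obtain K :: real and N0 :: nat where K: "0 < K"
      and tight: "\<And>N. N0 \<le> N \<Longrightarrow> (\<integral>\<^sup>+w. ennreal (Lik l N w) * indicator {w. K < Lik l N w} w \<partial>GE N) \<le> ennreal (r / 2)"
      by (rule Lik_upper_tight[OF l psi, of "r / 2"]) (assumption, use r in simp, rule that)
    have "\<forall>\<^sub>F N in sequentially. ?R N < r / (2 * K)"
      by (rule order_tendstoD(2)[OF R]) (use r K in simp)
    then obtain N1 where N1: "\<And>N. N1 \<le> N \<Longrightarrow> ?R N < r / (2 * K)" unfolding eventually_sequentially by auto
    show "\<exists>N2. \<forall>N\<ge>N2. norm (?Q N - 0) < r"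
    proof (intro exI allI impI)
      fix N assume N: "max N0 N1 \<le> N"
      interpret G: prob_space "GE N" by (rule prob_space_Gauss)
      note [measurable] = A[of N]
      have "ennreal (?Q N) \<le> (\<integral>\<^sup>+w. ennreal K * indicator (A N) w + ennreal (Lik l N w) * indicator {w. K < Lik l N w} w \<partial>GE N)"
        unfolding Q
      proof (rule nn_integral_mono)
        fix w
        show "ennreal (Lik l N w) * indicator (A N) w \<le> ennreal K * indicator (A N) w + ennreal (Lik l N w) * indicator {w. K < Lik l N w} w"
          by (auto simp: indicator_def intro: ennreal_leI)
      qed
      also have "\<dots> = ennreal K * emeasure (GE N) (A N) + (\<integral>\<^sup>+w. ennreal (Lik l N w) * indicator {w. K < Lik l N w} w \<partial>GE N)"
      proof -
        have [measurable]: "(\<lambda>w. indicator {w. K < Lik l N w} w :: ennreal) \<in> borel_measurable (GE N)"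
          unfolding indicator_def by measurable
        show ?thesis by (subst nn_integral_add) (auto simp: nn_integral_cmult)
      qed
      also have "\<dots> \<le> ennreal K * ennreal (?R N) + ennreal (r / 2)"
        using N by (intro add_mono tight) (auto simp: G.emeasure_eq_measure)
      also have "\<dots> = ennreal (K * ?R N + r / 2)" using K r by (simp add: ennreal_mult)
      finally have "?Q N \<le> K * ?R N + r / 2" using K r by (subst (asm) ennreal_le_iff) auto
      also have "K * ?R N < r / 2" using N1[of N] N K by (simp add: field_simps)
      finally show "norm (?Q N - 0) < r" by simp
    qed
  qed
  have down: "?R \<longlonglongrightarrow> 0" if QQ: "?Q \<longlonglongrightarrow> 0"
  proof (rule LIMSEQ_I)
    fix r :: real assume r: "0 < r"
    obtain h :: real and N0 :: nat where h: "0 < h"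
      and tight: "\<And>N. N0 \<le> N \<Longrightarrow> measure (GE N) {w \<in> space (GE N). Lik l N w \<le> h} \<le> r / 2"
      by (rule Lik_lower_tight[OF l psi, of "r / 2"]) (assumption, use r in simp, rule that)
    have "\<forall>\<^sub>F N in sequentially. ?Q N < r * h / 2"
      by (rule order_tendstoD(2)[OF QQ]) (use r h in simp)
    then obtain N1 where N1: "\<And>N. N1 \<le> N \<Longrightarrow> ?Q N < r * h / 2" unfolding eventually_sequentially by auto
    show "\<exists>N2. \<forall>N\<ge>N2. norm (?R N - 0) < r"
    proof (intro exI allI impI)
      fix N assume N: "max N0 N1 \<le> N"
      interpret G: prob_space "GE N" by (rule prob_space_Gauss)
      note [measurable] = A[of N]
      let ?D = "{w \<in> space (GE N). Lik l N w \<le> h}"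
      have "ennreal (?R N) = (\<integral>\<^sup>+w. indicator (A N) w \<partial>GE N)" by (simp add: G.emeasure_eq_measure)
      also have "\<dots> \<le> (\<integral>\<^sup>+w. ennreal (1 / h) * (ennreal (Lik l N w) * indicator (A N) w) + indicator ?D w \<partial>GE N)"
      proof (rule nn_integral_mono)
        fix w assume w: "w \<in> space (GE N)"
        show "indicator (A N) w \<le> ennreal (1 / h) * (ennreal (Lik l N w) * indicator (A N) w) + indicator ?D w"
        proof (cases "Lik l N w \<le> h")
          case True
          then show ?thesis using w by (auto simp: indicator_def)
        next
          case False
          then have "1 \<le> 1 / h * Lik l N w" using h by (simp add: field_simps)
          then have "ennreal 1 \<le> ennreal (1 / h * Lik l N w)" by (rule ennreal_leI)
          also have "\<dots> = ennreal (1 / h) * ennreal (Lik l N w)" using h False by (intro ennreal_mult) auto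
          finally show ?thesis by (auto simp: indicator_def)
        qed
      qed
      also have "\<dots> = ennreal (1 / h) * ennreal (?Q N) + emeasure (GE N) ?D"
        unfolding Q by (subst nn_integral_add) (auto simp: nn_integral_cmult)
      also have "\<dots> \<le> ennreal (1 / h) * ennreal (?Q N) + ennreal (r / 2)"
        using tight[of N] N by (intro add_left_mono) (auto simp: G.emeasure_eq_measure intro: ennreal_leI)
      also have "\<dots> = ennreal (1 / h * ?Q N + r / 2)" using h r by (simp add: ennreal_mult[symmetric])
      finally have "?R N \<le> 1 / h * ?Q N + r / 2" using h r by (subst (asm) ennreal_le_iff) auto
      also have "1 / h * ?Q N < r / 2" using N1[of N] N h by (simp add: field_simps)
      finally show "norm (?R N - 0) < r" by simp
    qed
  qed
  show "(\<lambda>N. measure (spiked_wigner_law P l N) (A N)) \<longlonglongrightarrow> 0 \<longleftrightarrow> (\<lambda>N. measure (spiked_wigner_law P 0 N) (A N)) \<longlonglongrightarrow> 0"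
    unfolding measure_spiked_wigner_law_0[OF A] using up down by blast
qed

end

text \<open>The complement of the support is the union of all open null sets, and by the Lindelof
  property a countable subfamily has the same union.\<close>

lemma AE_mem_measure_support:
  fixes M :: "'a::second_countable_topology measure"
  assumes M: "sets M = sets borel"
  shows "AE x in M. x \<in> measure_support M"
proof -
  let ?F = "{U. open U \<and> emeasure M U = 0}"
  obtain F' where F': "F' \<subseteq> ?F" "countable F'" "\<Union>F' = \<Union>?F"
    by (rule Lindelof[of ?F]) auto
  have "\<Union>F' \<in> null_sets M"
    using F'(1,2) by (intro null_sets_UN'[of F' "\<lambda>U. U", simplified]) (auto simp: null_sets_def M)
  then have "\<Union>?F \<in> null_sets M" unfolding F'(3) .
  then show ?thesis
    by (rule AE_I') (auto simp: measure_support_def zero_less_iff_neq_zero)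
qed

theorem corollary3:
  fixes P :: "real measure" and lam :: real
  assumes "real_distribution P"
    and "bounded (measure_support P)"
    and "prob_space.expectation P (\<lambda>x. x) = 0"
    and "prob_space.variance P (\<lambda>x. x) = 1"
    and "0 \<le> lam"
    and "ennreal lam < lambda_c P"
  shows "mutually_contiguous (spiked_wigner_law P lam) (spiked_wigner_law P 0)"
proof (cases "lam = 0")
  \<comment> \<open>The estimates are set up for positive signal strength; at \<open>0\<close> the
    two laws coincide.\<close>
  case True
  then show ?thesis by (simp add: mutually_contiguous_def)
next
  case False
  interpret real_distribution P by (rule assms(1))
  obtain B0 where B0: "\<And>x. x \<in> measure_support P \<Longrightarrow> \<bar>x\<bar> \<le> B0"
    using assms(2) unfolding bounded_iff by auto
  interpret bounded_prior P "max 1 B0"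
  proof
    have "AE x in P. x \<in> measure_support P" by (rule AE_mem_measure_support) simp
    then show "AE x in P. \<bar>x\<bar> \<le> max 1 B0"
      by eventually_elim (use B0 in \<open>auto intro: max.coboundedI2\<close>)
    show "expectation (\<lambda>x. x) = 0" by (rule assms(3))
    show "expectation (\<lambda>x. x\<^sup>2) = 1" using assms(4) unfolding assms(3) by simp
  qed simp
  \<comment> \<open>\<open>lambda_c\<close> is a supremum, so \<open>phi_RS\<close> vanishes at some
    \<open>l'\<close> strictly above \<open>lam\<close>. The resulting bound on \<open>psi\<close>
    is quadratic with coefficient \<open>1 / (4 l')\<close>, and the excess of \<open>l'\<close>
    over \<open>lam\<close> is what makes the decay exponential.\<close>
  obtain l' where l': "lam < l'" "phi_RS P l' = 0"
    by (rule ex_phi_RS_zero[OF assms(5,6)])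
  show ?thesis
  proof (rule mutually_contiguous_spiked_wigner[OF _ l'(1)])
    show "0 < lam" using assms(5) False by simp
    show "psi P r \<le> r\<^sup>2 / (4 * l')" if "0 \<le> r" for r
      by (rule psi_le_of_phi_RS[OF _ l'(2) that]) (use assms(5) l'(1) in simp)
  qed
qed

end
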